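(* For all sufficiently large integers $n$, \[ g_{1,1}(n)>g_{2,1}(n)\quad\text{and}\quad g_{1,2}(n)<g_{2,2}(n). \]
   Context: A partition $\lambda=(\lambda_1\ge \lambda_2\ge\cdots\ge\lambda_k)$ of $n$ is a weakly decreasing sequence of positive integers summing to $n$; its conjugate is $\lambda'$ with $\lambda'_j=\#\{i:\lambda_i\ge j\}$. For the cell in row $i$ and column $j$ of the Young diagram of $\lambda$, its hook length is $h(i,j)=\lambda_i+\lambda'_j-i-j+1$. A $t$-hook is a cell with hook length $t$. For a positive integer $t$, $g_{1,t}(n)$ denotes the total number of $t$-hooks, summed over all partitions of $n$ such that consecutive parts differ by at least $2$ and, whenever $\lambda_i$ is odd, $\lambda_i-\lambda_{i+1}>2$ (i.e. parts differ by at least 2 and no two odd parts differ by exactly 2); $g_{2,t}(n)$ denotes the total number of $t$-hooks, summed over all partitions of $n$ all of whose parts are congruent to $1$, $5$ or $6$ modulo $8$. *)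

theory Defs
  imports Complex_Main
begin

text \<open>A partition is the list of its parts in weakly decreasing order; rows and columns of its
  Young diagram are numbered from 1.\<close>

definition partitions :: "nat \<Rightarrow> nat list set" where
  "partitions n = {lam. sorted_wrt (\<ge>) lam \<and> (\<forall>p\<in>set lam. 0 < p) \<and> sum_list lam = n}"

definition part :: "nat list \<Rightarrow> nat \<Rightarrow> nat" where
  "part lam i = lam ! (i - 1)"

definition conj_part :: "nat list \<Rightarrow> nat \<Rightarrow> nat" where
  "conj_part lam j = card {i. 1 \<le> i \<and> i \<le> length lam \<and> part lam i \<ge> j}"

definition diagram :: "nat list \<Rightarrow> (nat \<times> nat) set" where
  "diagram lam = {(i, j). 1 \<le> i \<and> i \<le> length lam \<and> 1 \<le> j \<and> j \<le> part lam i}"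

definition hook_length :: "nat list \<Rightarrow> nat \<Rightarrow> nat \<Rightarrow> int" where
  "hook_length lam i j = int (part lam i) + int (conj_part lam j) - int i - int j + 1"

definition num_hooks :: "nat \<Rightarrow> nat list \<Rightarrow> nat" where
  "num_hooks t lam = card {(i, j) \<in> diagram lam. hook_length lam i j = int t}"

text \<open>The gap conditions compare actual parts only: nothing is required of the last part.  Natural
  number subtraction does not truncate here, as the parts are weakly decreasing.\<close>

definition gap_partitions :: "nat \<Rightarrow> nat list set" where
  "gap_partitions n = {lam \<in> partitions n. \<forall>i. 1 \<le> i \<and> i < length lam \<longrightarrow>
     part lam i - part lam (i + 1) \<ge> 2 \<and>
     (odd (part lam i) \<longrightarrow> part lam i - part lam (i + 1) > 2)}"

definition congruence_partitions :: "nat \<Rightarrow> nat list set" where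
  "congruence_partitions n = {lam \<in> partitions n. \<forall>p\<in>set lam. p mod 8 \<in> {1, 5, 6}}"

definition g1 :: "nat \<Rightarrow> nat \<Rightarrow> nat" where
  "g1 t n = (\<Sum>lam\<in>gap_partitions n. num_hooks t lam)"

definition g2 :: "nat \<Rightarrow> nat \<Rightarrow> nat" where
  "g2 t n = (\<Sum>lam\<in>congruence_partitions n. num_hooks t lam)"

text \<open>The sums and cardinalities above range over finite sets.\<close>

lemma length_le_sum_list_pos:
  "(\<forall>p\<in>set lam. 0 < p) \<Longrightarrow> length lam \<le> sum_list (lam :: nat list)"
  by (induction lam) auto

lemma finite_partitions: "finite (partitions n)"
proof (rule finite_subset)
  show "partitions n \<subseteq> {lam. set lam \<subseteq> {..n} \<and> length lam \<le> n}"
    unfolding partitions_def using length_le_sum_list_pos member_le_sum_list by fastforce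
  show "finite {lam. set lam \<subseteq> {..n} \<and> length lam \<le> n}"
    by (rule finite_lists_length_le) simp
qed

lemma finite_gap_partitions: "finite (gap_partitions n)"
  unfolding gap_partitions_def using finite_partitions by simp

lemma finite_congruence_partitions: "finite (congruence_partitions n)"
  unfolding congruence_partitions_def using finite_partitions by simp

lemma finite_diagram: "finite (diagram lam)"
proof -
  have "diagram lam = (SIGMA i:{1..length lam}. {1..part lam i})"
    unfolding diagram_def by auto
  then show ?thesis by simp
qed

end

theory Submission
  imports Defs "HOL-Computational_Algebra.Formal_Power_Series" "HOL-Library.Multiset"
begin

text \<open>
  Let \<open>A\<^sub>k\<close> be the generating function of the gap partitions with all parts greater than \<open>2k\<close>. By the
  little Goellnitz identity, \<open>A\<^sub>0\<close> also enumerates the partitions into parts congruent to 1, 5 or 6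
  modulo 8, so the generating functions of \<open>g2\<close> are \<open>A\<^sub>0\<close> times explicit rational functions. On the other side
  every gap partition is counted with (essentially) its number of parts \<open>N\<close>. Writing \<open>u = q\<^sup>2\<^sup>N\<close>,
  \<open>q\<close>-analogues of the bounds
  \<open>(1 - u) + (1 - u)\<^sup>2 / 2 \<le> - ln u \<le> (1 - u) + (1 - u)\<^sup>2 / 2 + (1 - u)\<^sup>3 / (3 u)\<close>
  hold coefficientwise and bound \<open>\<Sum> N t\<^sub>N\<close> linearly in the \<open>A\<^sub>k\<close>. The recursion
  \<open>A\<^sub>k = (1 + q\<^sup>2\<^sup>k\<^sup>+\<^sup>2) A\<^sub>k\<^sub>+\<^sub>1 + q\<^sup>2\<^sup>k\<^sup>+\<^sup>1 A\<^sub>k\<^sub>+\<^sub>2\<close> reduces both inequalities to combinations of two of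
  the \<open>A\<^sub>k\<close>. These have increasing coefficients beyond the constant one (enlarge the largest part by
  one), and after a summation by parts all coefficients are nonnegative up to a bounded error, with a
  main term of linear growth.
\<close>

section \<open>Real power series with nonnegative coefficients\<close>

unbundle fps_syntax

text \<open>The place where the logarithm is truncated is forced by constants. Heuristically, as
  \<open>q\<close> tends to 1 the terms \<open>t\<^sub>N\<close> concentrate where consecutive ones
  agree. By \<open>gap_ratio\<close> this means \<open>u + u^2 = 1 - u\<close>, so
  \<open>u = sqrt 2 - 1\<close>, and the mean of \<open>N\<close> is about
  \<open>- ln u / 2 = 0.4407\<close> times \<open>1 / (1 - q)\<close>. On the residue side the
  factors of \<open>1 / (1 - q)\<close> are \<open>3/8\<close> for 1-hooks and
  \<open>3/16 + 3/8 - 1/16 = 1/2\<close> for 2-hooks. Half the lower bound is 0.3787 with two terms,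
  barely above \<open>3/8\<close>, but only 0.2929 with one. Half the upper bound is 0.4596, below
  \<open>1/2\<close>, whereas a geometric tail starting one term earlier,
  \<open>(1 - u)^2 / (2 u)\<close>, gives exactly \<open>1/2\<close>. No asymptotic analysis is
  needed to make this rigorous: the analogue of \<open>(1 - u)^k\<close> is a product that cancels
  \<open>k\<close> denominators of \<open>t\<^sub>N\<close>, and what remains has nonnegative
  coefficients.\<close>

definition nonneg_fps :: "real fps \<Rightarrow> bool" where
  "nonneg_fps f \<longleftrightarrow> (\<forall>n. 0 \<le> f $ n)"

named_theorems nonneg_intros

lemma nonneg_fps_zero [nonneg_intros]: "nonneg_fps 0"
  by (simp add: nonneg_fps_def)

lemma nonneg_fps_one [nonneg_intros]: "nonneg_fps 1"
  by (simp add: nonneg_fps_def)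

lemma nonneg_fps_X [nonneg_intros]: "nonneg_fps fps_X"
  by (simp add: nonneg_fps_def fps_X_def)

lemma nonneg_fps_numeral [nonneg_intros]: "nonneg_fps (numeral k)"
  by (simp add: nonneg_fps_def fps_numeral_nth)

lemma nonneg_fps_add [nonneg_intros]: "nonneg_fps f \<Longrightarrow> nonneg_fps g \<Longrightarrow> nonneg_fps (f
    + g)"
  by (simp add: nonneg_fps_def)

lemma nonneg_fps_mult [nonneg_intros]: "nonneg_fps f \<Longrightarrow> nonneg_fps g \<Longrightarrow> nonneg_fps (f * g)"
  by (auto simp: nonneg_fps_def fps_mult_nth intro!: sum_nonneg)

lemma nonneg_fps_power [nonneg_intros]: "nonneg_fps f \<Longrightarrow> nonneg_fps (f ^ k)"
  by (induction k) (auto intro: nonneg_intros)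

lemma nonneg_fps_sum [nonneg_intros]: "(\<And>i. i \<in> I \<Longrightarrow> nonneg_fps (f i)) \<Longrightarrow> nonneg_fps (\<Sum>i\<in>I. f i)"
  by (auto simp: nonneg_fps_def fps_sum_nth intro!: sum_nonneg)

lemma nonneg_fps_X_power_cancel:
  assumes "nonneg_fps (fps_X ^ m * f)"
  shows "nonneg_fps f"
  unfolding nonneg_fps_def
proof
  fix n
  have "0 \<le> (fps_X ^ m * f) $ (n + m)"
    using assms unfolding nonneg_fps_def by blast
  then show "0 \<le> f $ n"
    by (simp add: fps_X_power_mult_nth)
qed

section \<open>Geometric series and increasing coefficients\<close>

definition geo :: "nat \<Rightarrow> real fps" where
  "geo k = Abs_fps (\<lambda>n. if k dvd n then 1 else 0)"

lemma nonneg_fps_geo [nonneg_intros]: "nonneg_fps (geo k)"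
  by (simp add: nonneg_fps_def geo_def)

lemma geo_mult:
  assumes "0 < k"
  shows "(1 - fps_X ^ k) * geo k = 1"
proof (rule fps_ext)
  fix n
  have "n < k \<Longrightarrow> k dvd n \<longleftrightarrow> n = 0"
    using nat_dvd_not_less by blast
  moreover have "\<not> n < k \<Longrightarrow> k dvd n - k \<longleftrightarrow> k dvd n"
    by (simp add: dvd_minus_self)
  ultimately show "((1 - fps_X ^ k) * geo k) $ n = 1 $ n"
    using assms by (auto simp: left_diff_distrib fps_X_power_mult_nth geo_def)
qed

lemma geo_eqI:
  assumes "0 < k" and "(1 - fps_X ^ k) * f = g"
  shows "f = geo k * g"
  using geo_mult[OF assms(1)] assms(2) by (metis mult.assoc mult.commute mult_1)

lemma geo_multiple:
  assumes "0 < k"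
  shows "nonneg_fps ((1 - fps_X ^ (k * m)) * geo k)"
proof -
  have "(1 - fps_X ^ k) * (\<Sum>i<m. (fps_X ^ k) ^ i) = (1 - fps_X ^ (k * m) :: real fps)"
    by (simp add: one_diff_power_eq power_mult)
  then have "(\<Sum>i<m. (fps_X ^ k) ^ i) = geo k * (1 - fps_X ^ (k * m))"
    using geo_eqI assms by blast
  then show ?thesis
    by (metis mult.commute nonneg_fps_X nonneg_fps_power nonneg_fps_sum)
qed

text \<open>Multiplying by \<open>1 - q\<close> takes differences of coefficients, so the hypothesis
  says that \<open>f\<close> is nonnegative and increasing. The quotient
  \<open>(1 - q^m) / (1 - q)\<close> is a finite sum of powers of \<open>q\<close>.\<close>

lemma nonneg_fps_one_minus_power:
  assumes "nonneg_fps ((1 - fps_X) * f)"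
  shows "nonneg_fps ((1 - fps_X ^ m) * f)"
proof -
  have "(1 - fps_X ^ (1 * m)) * geo 1 * ((1 - fps_X) * f) = ((1 - fps_X ^ 1) * geo 1) * ((1
      - fps_X ^ m) * f)"
    by (simp only: power_one_right mult_1 ac_simps)
  also have "\<dots> = (1 - fps_X ^ m) * f"
    by (subst geo_mult) simp_all
  finally show ?thesis
    using nonneg_fps_mult[OF geo_multiple[OF zero_less_one, of m] assms] by metis
qed

section \<open>Sums of sequences of power series\<close>

definition fsum :: "(nat \<Rightarrow> real fps) \<Rightarrow> real fps" where
  "fsum f = Abs_fps (\<lambda>n. \<Sum>N\<le>n. f N $ n)"

text \<open>Coefficient \<open>n\<close> of \<open>fsum f\<close> stops at the index
  \<open>n\<close>. For a graded sequence nothing is lost by this cutoff, so \<open>fsum\<close> is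
  the true infinite sum and is compatible with multiplication and index shifts.\<close>

definition graded :: "(nat \<Rightarrow> real fps) \<Rightarrow> bool" where
  "graded f \<longleftrightarrow> (\<forall>N. fps_X ^ N dvd f N)"

lemma X_power_dvd_nth: "fps_X ^ N dvd (f :: real fps) \<Longrightarrow> n < N \<Longrightarrow> f $ n = 0"
  by (auto simp: fps_X_power_mult_nth elim!: dvdE)

lemma graded_nth: "graded f \<Longrightarrow> n < N \<Longrightarrow> f N $ n = 0"
  unfolding graded_def using X_power_dvd_nth by blast

lemma graded_mult: "graded f \<Longrightarrow> graded (\<lambda>N. g N * f N)"
  by (simp add: graded_def)

lemma fsum_add: "fsum (\<lambda>N. f N + g N) = fsum f + fsum g"
  by (rule fps_ext) (simp add: fsum_def sum.distrib)

lemma fsum_diff: "fsum (\<lambda>N. f N - g N) = fsum f - fsum g"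
  by (rule fps_ext) (simp add: fsum_def sum_subtractf)

lemma fsum_mult:
  assumes "graded f"
  shows "fsum (\<lambda>N. c * f N) = c * fsum f"
proof (rule fps_ext)
  fix n
  have "(\<Sum>N\<le>n. f N $ (n - i)) = (\<Sum>N\<le>n - i. f N $ (n - i))" for i
    using graded_nth[OF assms] by (intro sum.mono_neutral_right) auto
  then show "fsum (\<lambda>N. c * f N) $ n = (c * fsum f) $ n"
    by (simp add: fsum_def fps_mult_nth sum.swap[of _ "{0..n}"] flip: sum_distrib_left)
qed

lemma fsum_Suc:
  assumes "graded f"
  shows "fsum f = f 0 + fsum (\<lambda>N. f (Suc N))"
proof (rule fps_ext)
  fix n
  have "(\<Sum>N\<le>n. f N $ n) = (\<Sum>N\<le>Suc n. f N $ n)"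
    using graded_nth[OF assms, of n "Suc n"] by simp
  then show "fsum f $ n = (f 0 + fsum (\<lambda>N. f (Suc N))) $ n"
    by (simp only: sum.atMost_Suc_shift fsum_def fps_nth_Abs_fps fps_add_nth)
qed

lemma nonneg_fps_fsum: "(\<And>N. nonneg_fps (f N)) \<Longrightarrow> nonneg_fps (fsum f)"
  by (auto simp: nonneg_fps_def fsum_def intro!: sum_nonneg)

lemma fsum_single:
  assumes "fps_X ^ M dvd g"
  shows "fsum (\<lambda>N. if N = M then g else 0) = g"
  by (rule fps_ext) (auto simp: fsum_def if_distrib[of "\<lambda>h. h $ _"] X_power_dvd_nth[OF assms] cong: if_cong)

section \<open>Gap partitions with a given number of parts\<close>

abbreviation q :: "real fps" where "q \<equiv> fps_X"

lemma graded_shift: "graded f \<Longrightarrow> graded (\<lambda>N. f (N + k))"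
  unfolding graded_def by (meson dvd_trans le_add1 le_imp_power_dvd)

lemma fsum_shift:
  assumes "graded f" and "\<And>N. N < k \<Longrightarrow> f N = 0"
  shows "fsum f = fsum (\<lambda>N. f (N + k))"
  using assms
proof (induction k arbitrary: f)
  case (Suc k)
  have "fsum f = fsum (\<lambda>N. f (Suc N))"
    using fsum_Suc[OF Suc.prems(1)] Suc.prems(2) by simp
  also have "\<dots> = fsum (\<lambda>N. f (Suc (N + k)))"
    using Suc.IH[of "\<lambda>N. f (Suc N)"] Suc.prems graded_shift[of f 1] by simp
  finally show ?case by simp
qed simp

text \<open>Equal to \<open>q^(2 M + 2) (1 + q^(2 M - 1))\<close>, the quotient of consecutive terms
  of the little Goellnitz series up to its denominator. It is written as a sum because the exponent
  \<open>2 M - 1\<close> is -1 at \<open>M = 0\<close>.\<close>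

definition gap_ratio :: "nat \<Rightarrow> real fps" where
  "gap_ratio M = q ^ (2 * M + 2) + q ^ (4 * M + 1)"

text \<open>The generating function of gap partitions with \<open>N\<close> parts, see \<open>gap_lists_gf_eq\<close> below.\<close>
primrec gap_gf :: "nat \<Rightarrow> real fps" where
  "gap_gf 0 = 1"
| "gap_gf (Suc M) = geo (2 * M + 2) * (gap_ratio M * gap_gf M)"

declare gap_gf.simps(2) [simp del]

lemma gap_gf_Suc: "(1 - q ^ (2 * M + 2)) * gap_gf (Suc M) = gap_ratio M * gap_gf M"
proof -
  have "(1 - q ^ (2 * M + 2)) * geo (2 * M + 2) = 1"
    by (rule geo_mult) simp
  then show ?thesis
    unfolding gap_gf.simps(2) mult.assoc[symmetric] by simp
qed

lemma nonneg_gap_ratio [nonneg_intros]: "nonneg_fps (gap_ratio M)"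
  unfolding gap_ratio_def by (intro nonneg_intros)

lemma nonneg_gap_gf [nonneg_intros]: "nonneg_fps (gap_gf N)"
  by (induction N) (auto simp: gap_gf.simps(2) intro!: nonneg_intros)

lemma graded_gap_gf: "graded gap_gf"
  unfolding graded_def
proof
  fix N show "q ^ N dvd gap_gf N"
  proof (induction N)
    case (Suc N)
    have "q dvd gap_ratio N"
      unfolding gap_ratio_def by (intro dvd_add) (auto simp: dvd_power)
    then have "q * q ^ N dvd gap_ratio N * gap_gf N"
      using Suc by (rule mult_dvd_mono)
    then show ?case
      unfolding gap_gf.simps(2) power_Suc by (rule dvd_mult)
  qed simp
qed

lemma gap_gf_1: "(1 - q) * gap_gf 1 = q"
proof -
  have gf: "gap_gf 1 = geo 2 * (q ^ 2 + q)"
    using gap_gf.simps(2)[of 0] by (simp add: gap_ratio_def numeral_2_eq_2)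
  have "(1 - q) * gap_gf 1 = ((1 - q ^ 2) * geo 2) * q"
    unfolding gf by (simp add: algebra_simps power2_eq_square)
  then show ?thesis
    by (simp add: geo_mult)
qed

text \<open>The one-part series \<open>q / (1 - q)\<close> already contains the factor
  \<open>1 / (1 - q)\<close>, and every further step multiplies by series with nonnegative
  coefficients.\<close>

lemma gap_gf_increasing: "nonneg_fps ((1 - q) * gap_gf (Suc N))"
proof (induction N)
  case 0
  then show ?case using gap_gf_1 by (simp add: nonneg_intros)
next
  case (Suc N)
  have "(1 - q) * gap_gf (Suc (Suc N)) = geo (2 * Suc N + 2) * gap_ratio (Suc N) * ((1
      - q) * gap_gf (Suc N))"
    by (subst gap_gf.simps(2)) (simp only: ac_simps)
  then show ?case
    using nonneg_fps_mult[OF nonneg_fps_mult[OF nonneg_fps_geo nonneg_gap_ratio] Suc] by metis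
qed

text \<open>For \<open>k > N\<close> the factor \<open>j = N\<close> vanishes; the truncated subtraction beyond it is harmless.\<close>
definition qpoch :: "nat \<Rightarrow> nat \<Rightarrow> real fps" where
  "qpoch k N = (\<Prod>j<k. 1 - q ^ (2 * (N - j)))"

lemma qpoch_0 [simp]: "qpoch 0 N = 1"
  by (simp add: qpoch_def)

lemma qpoch_Suc: "qpoch (Suc k) N = qpoch k N * (1 - q ^ (2 * (N - k)))"
  by (simp add: qpoch_def)

lemma qpoch_Suc_Suc: "qpoch (Suc k) (Suc N) = (1 - q ^ (2 * N + 2)) * qpoch k N"
  by (simp add: qpoch_def prod.lessThan_Suc_shift del: prod.lessThan_Suc)

lemma qpoch_eq_0: "N < k \<Longrightarrow> qpoch k N = 0"
  unfolding qpoch_def by (rule prod_zero) (auto intro!: bexI[of _ N])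

text \<open>The leading factor of \<open>qpoch\<close> is the last denominator of
  \<open>gap_gf\<close>. Although \<open>qpoch\<close> itself has negative coefficients, iterating
  this cancellation leaves a product of nonnegative series.\<close>

lemma qpoch_gap_gf_Suc: "qpoch (Suc k) (Suc M) * gap_gf (Suc M) = gap_ratio M * (qpoch k M * gap_gf M)"
proof -
  have "qpoch (Suc k) (Suc M) * gap_gf (Suc M) = qpoch k M * ((1 - q ^ (2 * M + 2)) * gap_gf (Suc M))"
    unfolding qpoch_Suc_Suc by (simp only: ac_simps)
  then show ?thesis
    unfolding gap_gf_Suc by (simp only: ac_simps)
qed

lemma qpoch_gap_gf_shift: "qpoch k (M + k) * gap_gf (M + k) = (\<Prod>j<k. gap_ratio (M + j)) * gap_gf M"
proof (induction k)
  case (Suc k)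
  then show ?case
    using qpoch_gap_gf_Suc[of k "M + k"] by simp
qed simp

lemma nonneg_qpoch_gap_gf [nonneg_intros]: "nonneg_fps (qpoch k N * gap_gf N)"
proof (induction k arbitrary: N)
  case (Suc k)
  show ?case
  proof (cases N)
    case (Suc M)
    then show ?thesis using Suc.IH qpoch_gap_gf_Suc by (simp add: nonneg_intros)
  qed (simp add: qpoch_eq_0 nonneg_intros)
qed (simp add: nonneg_intros)

text \<open>For \<open>k < N\<close> at least the one-part series survives the cancellation and
  supplies the factor \<open>1 / (1 - q)\<close>. For \<open>k = N\<close> all denominators are gone
  and only a polynomial is left.\<close>

lemma qpoch_gap_gf_increasing: "k < N \<Longrightarrow> nonneg_fps ((1 - q) * (qpoch k N * gap_gf N))"
proof (induction k arbitrary: N)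
  case 0
  then show ?case using gap_gf_increasing[of "N - 1"] by simp
next
  case (Suc k)
  then obtain M where N: "N = Suc M" "k < M"
    using Suc_lessE by metis
  have "(1 - q) * (qpoch (Suc k) N * gap_gf N) = gap_ratio M * ((1 - q) * (qpoch k M * gap_gf M))"
    unfolding N qpoch_gap_gf_Suc by (simp only: ac_simps)
  then show ?case using nonneg_fps_mult[OF nonneg_gap_ratio Suc.IH[OF N(2)]] by metis
qed

lemma qpoch_telescope: "k \<le> N \<Longrightarrow> qpoch k N * q ^ (2 * (N - k)) = qpoch k N
    - qpoch (Suc k) N"
  unfolding qpoch_Suc by (simp add: algebra_simps)

lemma qpoch_gap_gf_antimono:
  assumes "k \<le> l"
  shows "nonneg_fps (qpoch k N * gap_gf N - qpoch l N * gap_gf N)"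
  using assms
proof (induction l rule: dec_induct)
  case (step l)
  have "nonneg_fps (qpoch l N * gap_gf N - qpoch (Suc l) N * gap_gf N)"
  proof (cases "l \<le> N")
    case True
    then have "qpoch l N * gap_gf N - qpoch (Suc l) N * gap_gf N = q ^ (2 * (N
        - l)) * (qpoch l N * gap_gf N)"
      unfolding left_diff_distrib[symmetric] qpoch_telescope[OF True, symmetric] by (simp only: ac_simps)
    then show ?thesis
      by (metis nonneg_fps_X nonneg_fps_mult nonneg_fps_power nonneg_qpoch_gap_gf)
  qed (simp add: qpoch_eq_0 nonneg_intros)
  from nonneg_fps_add[OF step.IH this] show ?case by simp
qed (simp add: nonneg_intros)

text \<open>The \<open>q\<close>-analogue of \<open>- ln u = \<Sum> (1 - u)\<^sup>k / k\<close> for \<open>u = q\<^sup>2\<^sup>N\<close>.\<close>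
lemma of_nat_eq_sum_qpoch: "of_nat N = (\<Sum>k<N + m. qpoch (Suc k) N * geo (2 * Suc k))"
proof -
  have "(of_nat N :: real fps) = (\<Sum>k<N. qpoch (Suc k) N * geo (2 * Suc k))"
  proof (induction N)
    case (Suc N)
    \<comment> \<open>The increment from \<open>N\<close> to \<open>N + 1\<close> is a difference in
      \<open>k\<close>, because comparing the two products produces a factor
      \<open>1 - q^(2 k + 2)\<close> that cancels \<open>geo (2 * Suc k)\<close>. Summed over
      \<open>k\<close>, it telescopes from \<open>qpoch 0 N = 1\<close> down to
      \<open>qpoch (Suc N) N = 0\<close>.\<close>
    have diff: "qpoch (Suc k) (Suc N) * geo (2 * Suc k)
        = qpoch (Suc k) N * geo (2 * Suc k) + (qpoch k N - qpoch (Suc k) N)" if "k < Suc N" for k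
    proof -
      have "2 * (N - k) + 2 * Suc k = 2 * N + 2"
        using that by simp
      then have "q ^ (2 * N + 2) = q ^ (2 * (N - k)) * q ^ (2 * Suc k)"
        by (metis power_add)
      then have "qpoch (Suc k) (Suc N) - qpoch (Suc k) N
          = (1 - q ^ (2 * (N - k)) * q ^ (2 * Suc k)) * qpoch k N - qpoch k N * (1 - q ^ (2 * (N - k)))"
        by (simp only: qpoch_Suc_Suc qpoch_Suc[of k N])
      also have "\<dots> = qpoch k N * q ^ (2 * (N - k)) * (1 - q ^ (2 * Suc k))"
        by (simp only: ring_distribs ac_simps mult_1 mult_1_right) simp
      finally have "(qpoch (Suc k) (Suc N) - qpoch (Suc k) N) * geo (2 * Suc k)
          = (qpoch k N * q ^ (2 * (N - k))) * ((1 - q ^ (2 * Suc k)) * geo (2 * Suc k))"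
        by (simp only: mult.assoc)
      also have "\<dots> = qpoch k N - qpoch (Suc k) N"
        using that qpoch_telescope[of k N] by (subst geo_mult) simp_all
      finally show ?thesis by (simp add: algebra_simps)
    qed
    have "(\<Sum>k<Suc N. qpoch (Suc k) (Suc N) * geo (2 * Suc k))
        = (\<Sum>k<Suc N. qpoch (Suc k) N * geo (2 * Suc k)) + (\<Sum>k<Suc N. qpoch k N
            - qpoch (Suc k) N)"
      unfolding sum.distrib[symmetric] using diff by (intro sum.cong) auto
    also have "(\<Sum>k<Suc N. qpoch k N - qpoch (Suc k) N) = 1"
      by (subst sum_lessThan_telescope') (simp add: qpoch_eq_0)
    also have "(\<Sum>k<Suc N. qpoch (Suc k) N * geo (2 * Suc k)) = of_nat N"
      using Suc by (simp add: qpoch_eq_0)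
    finally show ?case by simp
  qed simp
  \<comment> \<open>The \<open>m\<close> additional terms vanish. They let a fixed number of initial
    terms be split off even when \<open>N\<close> is smaller than that number.\<close>
  also have "\<dots> = (\<Sum>k<N + m. qpoch (Suc k) N * geo (2 * Suc k))"
    by (rule sum.mono_neutral_left) (auto simp: qpoch_eq_0)
  finally show ?thesis .
qed

text \<open>The factor \<open>q^(2 k N)\<close> adds \<open>2k\<close> to each of the \<open>N\<close> parts, so \<open>gap_min_gf k\<close> enumerates the gap
  partitions with all parts greater than \<open>2k\<close>; \<open>gap_min_pos k\<close> omits the empty partition.\<close>
definition gap_min_gf :: "nat \<Rightarrow> real fps" where
  "gap_min_gf k = fsum (\<lambda>N. q ^ (2 * k * N) * gap_gf N)"

definition gap_min_pos :: "nat \<Rightarrow> real fps" where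
  "gap_min_pos k = fsum (\<lambda>N. q ^ (2 * k * Suc N) * gap_gf (Suc N))"

lemma graded_gap_gf_mult: "graded (\<lambda>N. f N * gap_gf N)"
  using graded_mult[OF graded_gap_gf] .

lemma graded_gap_gf_Suc_mult: "graded (\<lambda>N. f N * gap_gf (Suc N))"
  using graded_mult[OF graded_shift[OF graded_gap_gf, of 1]] by simp

lemma fsum_power_gap_gf: "fsum (\<lambda>N. c * (q ^ (2 * k * N) * gap_gf N)) = c * gap_min_gf k"
  unfolding gap_min_gf_def by (rule fsum_mult[OF graded_gap_gf_mult])

lemma gap_min_gf_eq: "gap_min_gf k = 1 + gap_min_pos k"
  unfolding gap_min_gf_def gap_min_pos_def by (subst fsum_Suc[OF graded_gap_gf_mult]) simp

text \<open>Multiplying the \<open>N\<close>-th term by \<open>1 - q^(2 N)\<close> cancels its last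
  denominator. After an index shift the two monomials of \<open>gap_ratio\<close> give the two
  families on the right.\<close>

lemma gap_min_gf_rec:
  "gap_min_gf k = (1 + q ^ (2 * k + 2)) * gap_min_gf (k + 1) + q ^ (2 * k + 1) * gap_min_gf (k + 2)"
proof -
  have "gap_min_gf k - gap_min_gf (k + 1) = fsum (\<lambda>N. (q ^ (2 * k * N) * (1
      - q ^ (2 * N))) * gap_gf N)"
    unfolding gap_min_gf_def fsum_diff[symmetric]
    by (rule arg_cong[of _ _ fsum]) (simp add: fun_eq_iff algebra_simps power_add)
  also have "\<dots> = fsum (\<lambda>N. q ^ (2 * k * Suc N) * ((1 - q ^ (2 * N + 2)) * gap_gf (Suc N)))"
    by (subst fsum_Suc[OF graded_gap_gf_mult]) (simp add: mult.assoc)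
  also have "\<dots> = fsum (\<lambda>N. q ^ (2 * k + 2) * (q ^ (2 * (k + 1) * N) * gap_gf N)
      + q ^ (2 * k + 1) * (q ^ (2 * (k + 2) * N) * gap_gf N))"
    unfolding gap_gf_Suc gap_ratio_def
    by (rule arg_cong[of _ _ fsum]) (simp add: fun_eq_iff algebra_simps power_add)
  also have "\<dots> = q ^ (2 * k + 2) * gap_min_gf (k + 1) + q ^ (2 * k + 1) * gap_min_gf (k + 2)"
    unfolding fsum_add fsum_power_gap_gf ..
  finally show ?thesis
    by (simp add: algebra_simps)
qed

text \<open>The one-part term is \<open>q^(2 k) * q / (1 - q)\<close>, whose differences are exactly
  \<open>q^(2 k + 1)\<close>; all further terms are increasing. Keeping this jump is what later
  yields linear growth.\<close>

lemma gap_min_pos_increasing: "nonneg_fps ((1 - q) * gap_min_pos k - q ^ (2 * k + 1))"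
proof -
  have "(1 - q) * gap_min_pos k = fsum (\<lambda>N. (1 - q) * (q ^ (2 * k * Suc N) * gap_gf (Suc N)))"
    unfolding gap_min_pos_def using fsum_mult[OF graded_gap_gf_Suc_mult] by simp
  also have "\<dots> = q ^ (2 * k) * ((1 - q) * gap_gf 1)
      + fsum (\<lambda>N. (1 - q) * (q ^ (2 * k * Suc (Suc N)) * gap_gf (Suc (Suc N))))"
    by (subst fsum_Suc[OF graded_mult[OF graded_gap_gf_Suc_mult]]) (simp add: ac_simps)
  also have "q ^ (2 * k) * ((1 - q) * gap_gf 1) = q ^ (2 * k + 1)"
    unfolding gap_gf_1 by simp
  also have "fsum (\<lambda>N. (1 - q) * (q ^ (2 * k * Suc (Suc N)) * gap_gf (Suc (Suc N))))
      = fsum (\<lambda>N. q ^ (2 * k * Suc (Suc N)) * ((1 - q) * gap_gf (Suc (Suc N))))"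
    by (simp only: ac_simps)
  finally have eq: "(1 - q) * gap_min_pos k - q ^ (2 * k + 1)
      = fsum (\<lambda>N. q ^ (2 * k * Suc (Suc N)) * ((1 - q) * gap_gf (Suc (Suc N))))"
    by simp
  show ?thesis
    unfolding eq by (intro nonneg_fps_fsum nonneg_fps_mult gap_gf_increasing nonneg_fps_power nonneg_fps_X)
qed

text \<open>In the term with \<open>N + 1\<close> parts the two sides differ by the factor
  \<open>q^(2 N)\<close>, and \<open>1 - q^(2 N)\<close> is harmless on an increasing series.
  Iterated, this trades families of larger index for \<open>gap_min_pos 4\<close>.\<close>

lemma gap_min_pos_Suc_le: "nonneg_fps (q ^ 2 * gap_min_pos k - gap_min_pos (Suc k))"
proof -
  have eq: "q ^ 2 * gap_min_pos k - gap_min_pos (Suc k)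
      = fsum (\<lambda>N. q ^ (2 * k * Suc N + 2) * ((1 - q ^ (2 * N)) * gap_gf (Suc N)))"
    unfolding gap_min_pos_def fsum_mult[OF graded_gap_gf_Suc_mult, symmetric] fsum_diff[symmetric]
    by (rule arg_cong[of _ _ fsum])
      (simp add: fun_eq_iff algebra_simps power_add power2_eq_square)
  show ?thesis
    unfolding eq
    by (intro nonneg_fps_fsum nonneg_fps_mult nonneg_fps_one_minus_power gap_gf_increasing
        nonneg_fps_power nonneg_fps_X)
qed

lemma gap_min_pos_add_le: "nonneg_fps (q ^ (2 * i) * gap_min_pos k - gap_min_pos (k + i))"
proof (induction i)
  case (Suc i)
  have "q ^ (2 * Suc i) * gap_min_pos k - gap_min_pos (k + Suc i)
      = q ^ 2 * (q ^ (2 * i) * gap_min_pos k - gap_min_pos (k + i))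
        + (q ^ 2 * gap_min_pos (k + i) - gap_min_pos (Suc (k + i)))"
    by (simp add: algebra_simps power2_eq_square)
  then show ?case
    using nonneg_fps_add[OF nonneg_fps_mult[OF nonneg_fps_power[OF nonneg_fps_X] Suc] gap_min_pos_Suc_le]
    by metis
qed (simp add: nonneg_intros)

section \<open>Weighted sums as combinations of the shifted families\<close>

definition qpoch_sum :: "nat \<Rightarrow> real fps" where
  "qpoch_sum k = fsum (\<lambda>N. qpoch k N * gap_gf N)"

text \<open>With \<open>N = M + k\<close> the product of the \<open>gap_ratio\<close> is a
  polynomial in \<open>q^(2 M)\<close>, and each power of \<open>q^(2 M)\<close> selects one
  \<open>gap_min_gf\<close>.\<close>

lemma qpoch_sum_eq: "qpoch_sum k = fsum (\<lambda>M. (\<Prod>j<k. gap_ratio (M + j)) * gap_gf M)"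
  unfolding qpoch_sum_def qpoch_gap_gf_shift[symmetric]
  by (rule fsum_shift[OF graded_gap_gf_mult]) (simp add: qpoch_eq_0)

lemma gap_ratio_eq: "gap_ratio M = q ^ 2 * q ^ (2 * M) + q * (q ^ (2 * M)) ^ 2"
  by (simp add: gap_ratio_def algebra_simps power_add power2_eq_square eval_nat_numeral)

lemma gap_ratio_shift:
  "gap_ratio (M + 1) = q ^ 4 * q ^ (2 * M) + q ^ 5 * (q ^ (2 * M)) ^ 2"
  "gap_ratio (M + 2) = q ^ 6 * q ^ (2 * M) + q ^ 9 * (q ^ (2 * M)) ^ 2"
  "gap_ratio (M + 3) = q ^ 8 * q ^ (2 * M) + q ^ 13 * (q ^ (2 * M)) ^ 2"
  by (simp_all add: gap_ratio_def algebra_simps power_add power2_eq_square eval_nat_numeral)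

lemma power_gap_gf: "q ^ (2 * k * M) * gap_gf M = (q ^ (2 * M)) ^ k * gap_gf M"
  by (simp add: ac_simps flip: power_mult)

lemma qpoch_sum_1: "qpoch_sum 1 = q ^ 2 * gap_min_gf 1 + q * gap_min_gf 2"
proof -
  have ring: "(x ^ 2 * u + x * u ^ 2) * g = x ^ 2 * (u ^ 1 * g)
      + x * (u ^ 2 * g)" for x u g :: "real fps"
    by algebra
  have "(\<Prod>j<1. gap_ratio (M + j)) * gap_gf M
      = q ^ 2 * (q ^ (2 * 1 * M) * gap_gf M) + q * (q ^ (2 * 2 * M) * gap_gf M)" for M
  proof -
    have "(\<Prod>j<1. gap_ratio (M + j)) = gap_ratio M"
      by simp
    then show ?thesis
      unfolding power_gap_gf gap_ratio_shift unfolding gap_ratio_eq by (simp only: ring)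
  qed
  then show ?thesis
    unfolding qpoch_sum_eq by (simp only: fsum_add fsum_power_gap_gf)
qed

lemma qpoch_sum_2:
  "qpoch_sum 2 = q ^ 6 * gap_min_gf 2 + (q ^ 5 + q ^ 7) * gap_min_gf 3 + q ^ 6 * gap_min_gf 4"
proof -
  have ring: "(x ^ 2 * u + x * u ^ 2) * (x ^ 4 * u + x ^ 5 * u ^ 2) * g
      = x ^ 6 * (u ^ 2 * g) + (x ^ 5 + x ^ 7) * (u ^ 3 * g)
          + x ^ 6 * (u ^ 4 * g)" for x u g :: "real fps"
    by algebra
  have "(\<Prod>j<2. gap_ratio (M + j)) * gap_gf M
      = q ^ 6 * (q ^ (2 * 2 * M) * gap_gf M) + (q ^ 5 + q ^ 7) * (q ^ (2 * 3 * M) * gap_gf M)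
        + q ^ 6 * (q ^ (2 * 4 * M) * gap_gf M)" for M
  proof -
    have "(\<Prod>j<2. gap_ratio (M + j)) = gap_ratio M * gap_ratio (M + 1)"
      by (simp add: numeral_2_eq_2)
    then show ?thesis
      unfolding power_gap_gf gap_ratio_shift unfolding gap_ratio_eq by (simp only: ring)
  qed
  then show ?thesis
    unfolding qpoch_sum_eq by (simp only: fsum_add fsum_power_gap_gf)
qed

lemma qpoch_sum_4:
  "qpoch_sum 4 = q ^ 20 * gap_min_gf 4 + (q ^ 19 + q ^ 21 + q ^ 23 + q ^ 25) * gap_min_gf 5
     + (q ^ 20 + q ^ 22 + 2 * q ^ 24 + q ^ 26 + q ^ 28) * gap_min_gf 6
     + (q ^ 23 + q ^ 25 + q ^ 27 + q ^ 29) * gap_min_gf 7 + q ^ 28 * gap_min_gf 8"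
proof -
  have ring: "(x ^ 2 * u + x * u ^ 2) * (x ^ 4 * u + x ^ 5 * u ^ 2) * (x ^ 6 * u + x ^ 9 * u ^ 2)
        * (x ^ 8 * u + x ^ 13 * u ^ 2) * g
      = x ^ 20 * (u ^ 4 * g) + (x ^ 19 + x ^ 21 + x ^ 23 + x ^ 25) * (u ^ 5 * g)
        + (x ^ 20 + x ^ 22 + 2 * x ^ 24 + x ^ 26 + x ^ 28) * (u ^ 6 * g)
        + (x ^ 23 + x ^ 25 + x ^ 27 + x ^ 29) * (u ^ 7 * g)
            + x ^ 28 * (u ^ 8 * g)" for x u g :: "real fps"
    by algebra
  have "(\<Prod>j<4. gap_ratio (M + j)) * gap_gf M
      = q ^ 20 * (q ^ (2 * 4 * M) * gap_gf M)
        + (q ^ 19 + q ^ 21 + q ^ 23 + q ^ 25) * (q ^ (2 * 5 * M) * gap_gf M)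
        + (q ^ 20 + q ^ 22 + 2 * q ^ 24 + q ^ 26 + q ^ 28) * (q ^ (2 * 6 * M) * gap_gf M)
        + (q ^ 23 + q ^ 25 + q ^ 27 + q ^ 29) * (q ^ (2 * 7 * M) * gap_gf M)
        + q ^ 28 * (q ^ (2 * 8 * M) * gap_gf M)" for M
  proof -
    have "(\<Prod>j<4. gap_ratio (M + j)) = gap_ratio M * gap_ratio (M + 1) * gap_ratio (M + 2) * gap_ratio (M + 3)"
      by (simp add: eval_nat_numeral)
    then show ?thesis
      unfolding power_gap_gf gap_ratio_shift unfolding gap_ratio_eq by (simp only: ring)
  qed
  then show ?thesis
    unfolding qpoch_sum_eq by (simp only: fsum_add fsum_power_gap_gf)
qed

text \<open>Two terms of the logarithmic series are kept; the discarded ones become nonnegative once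
  multiplied by \<open>gap_gf\<close>.\<close>

lemma gap_gf_parts_lower:
  "nonneg_fps (fsum (\<lambda>N. of_nat N * gap_gf N) - (geo 2 * qpoch_sum 1 + geo 4 * qpoch_sum 2))"
proof -
  have "nonneg_fps (of_nat N * gap_gf N - (geo 2 * (qpoch 1 N * gap_gf N)
      + geo 4 * (qpoch 2 N * gap_gf N)))" for N
  proof -
    have "(of_nat N :: real fps) = qpoch 1 N * geo 2 + (qpoch 2 N * geo 4 + (\<Sum>k<N. qpoch (k
        + 3) N * geo (2 * (k + 3))))"
      using of_nat_eq_sum_qpoch[of N 2] by (simp add: sum.lessThan_Suc_shift eval_nat_numeral del: sum.lessThan_Suc)
    then have "of_nat N * gap_gf N - (geo 2 * (qpoch 1 N * gap_gf N) + geo 4 * (qpoch 2 N * gap_gf N))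
       = (\<Sum>k<N. geo (2 * (k + 3)) * (qpoch (k + 3) N * gap_gf N))"
      by (simp add: algebra_simps sum_distrib_left)
    also have "nonneg_fps \<dots>"
      by (intro nonneg_fps_sum nonneg_fps_mult[OF nonneg_fps_geo] nonneg_qpoch_gap_gf)
    finally show ?thesis .
  qed
  then have "nonneg_fps (fsum (\<lambda>N. of_nat N * gap_gf N - (geo 2 * (qpoch 1 N * gap_gf N)
      + geo 4 * (qpoch 2 N * gap_gf N))))"
    by (rule nonneg_fps_fsum)
  then show ?thesis
    by (simp only: fsum_diff fsum_add fsum_mult[OF graded_gap_gf_mult] qpoch_sum_def)
qed

text \<open>The counterpart of \<open>(1 - u)\<^sup>3 / u\<close>, with the power of \<open>q\<close> divided out to avoid negative exponents.\<close>
definition qpoch3_div :: "nat \<Rightarrow> real fps" where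
  "qpoch3_div M = (q ^ 2 + q ^ (2 * M + 1)) * gap_ratio (M + 1) * gap_ratio (M + 2) * gap_gf M"

lemma qpoch3_div: "q ^ (2 * M) * qpoch3_div M = qpoch 3 (M + 3) * gap_gf (M + 3)"
proof -
  have "q ^ (2 * M) * qpoch3_div M = (q ^ (2 * M) * (q ^ 2 + q ^ (2 * M + 1))) * gap_ratio (M
      + 1) * gap_ratio (M + 2) * gap_gf M"
    by (simp only: qpoch3_div_def mult.assoc)
  also have "q ^ (2 * M) * (q ^ 2 + q ^ (2 * M + 1)) = gap_ratio M"
    by (simp add: gap_ratio_def algebra_simps flip: power_add)
  also have "gap_ratio M * gap_ratio (M + 1) * gap_ratio (M + 2) * gap_gf M = qpoch 3 (M + 3) * gap_gf (M + 3)"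
    unfolding qpoch_gap_gf_shift by (simp add: eval_nat_numeral)
  finally show ?thesis .
qed

lemma fsum_qpoch3_div:
  "fsum qpoch3_div = q ^ 12 * gap_min_gf 2 + (q ^ 11 + q ^ 13 + q ^ 15) * gap_min_gf 3
     + (q ^ 12 + q ^ 14 + q ^ 16) * gap_min_gf 4 + q ^ 15 * gap_min_gf 5"
proof -
  have ring: "(x ^ 2 + x * u) * (x ^ 4 * u + x ^ 5 * u ^ 2) * (x ^ 6 * u + x ^ 9 * u ^ 2) * g
      = x ^ 12 * (u ^ 2 * g) + (x ^ 11 + x ^ 13 + x ^ 15) * (u ^ 3 * g)
        + (x ^ 12 + x ^ 14 + x ^ 16) * (u ^ 4 * g) + x ^ 15 * (u ^ 5 * g)" for x u g :: "real fps"
    by algebra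
  have "qpoch3_div M
      = q ^ 12 * (q ^ (2 * 2 * M) * gap_gf M) + (q ^ 11 + q ^ 13 + q ^ 15) * (q ^ (2 * 3 * M) * gap_gf M)
     + (q ^ 12 + q ^ 14 + q ^ 16) * (q ^ (2 * 4 * M) * gap_gf M)
         + q ^ 15 * (q ^ (2 * 5 * M) * gap_gf M)" for M
  proof -
    have "qpoch3_div M = (q ^ 2 + q * q ^ (2 * M)) * gap_ratio (M + 1) * gap_ratio (M + 2) * gap_gf M"
      by (simp add: qpoch3_div_def)
    then show ?thesis
      unfolding power_gap_gf gap_ratio_shift unfolding gap_ratio_eq by (simp only: ring)
  qed
  then have "fsum qpoch3_div = fsum (\<lambda>M. q ^ 12 * (q ^ (2 * 2 * M) * gap_gf M) + (q ^ 11
      + q ^ 13 + q ^ 15) * (q ^ (2 * 3 * M) * gap_gf M)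
     + (q ^ 12 + q ^ 14 + q ^ 16) * (q ^ (2 * 4 * M) * gap_gf M)
         + q ^ 15 * (q ^ (2 * 5 * M) * gap_gf M))"
    by (intro arg_cong[of _ _ fsum]) blast
  then show ?thesis
    by (simp only: fsum_add fsum_power_gap_gf)
qed

text \<open>For \<open>N = M + 3\<close> the last factor of \<open>qpoch N N\<close> is
  \<open>1 - q^2\<close>, and \<open>1 - (1 - q^2) / (1 - q^(2 N)) = q^2 (1 - q^(2 N - 2)) / (1 -
  q^(2 N))\<close>. The numerator \<open>1 - q^(2 N - 2)\<close> acts on an increasing series, since
  only \<open>N - 1\<close> factors of \<open>qpoch\<close> remain.\<close>

lemma qpoch_top_le:
  assumes "1 \<le> M"
  shows "nonneg_fps (qpoch (M + 2) (M + 3) * gap_gf (M + 3)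
    - qpoch (M + 3) (M + 3) * gap_gf (M + 3) * geo (2 * (M + 3)))"
proof -
  let ?c = "qpoch (M + 2) (M + 3) * gap_gf (M + 3)"
  have "qpoch (M + 3) (M + 3) = qpoch (M + 2) (M + 3) * (1 - q ^ 2)"
    using qpoch_Suc[of "M + 2" "M + 3"] by (simp add: eval_nat_numeral)
  then have "?c - qpoch (M + 3) (M + 3) * gap_gf (M + 3) * geo (2 * (M + 3))
      = ?c * ((1 - q ^ (2 * (M + 3))) * geo (2 * (M + 3))) - ?c * (1 - q ^ 2) * geo (2 * (M + 3))"
    by (subst geo_mult) (simp_all add: ac_simps)
  also have "\<dots> = geo (2 * (M + 3)) * (q ^ 2 * ((1 - q ^ (2 * M + 4)) * ?c))"
    by (simp add: algebra_simps power_add eval_nat_numeral)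
  also have "nonneg_fps \<dots>"
    by (intro nonneg_fps_mult nonneg_fps_geo nonneg_fps_power nonneg_fps_X nonneg_fps_one_minus_power
        qpoch_gap_gf_increasing) simp
  finally show ?thesis .
qed

text \<open>The summand with \<open>k = N\<close> is not increasing, so it escapes the comparison of the other
  summands with a geometric series and is estimated separately.\<close>
definition top_error :: "nat \<Rightarrow> real fps" where
  "top_error M = qpoch 4 (M + 3) * gap_gf (M + 3)
     + (if M = 1 then qpoch 4 4 * gap_gf 4 * geo 8 else 0)"

lemma nonneg_top_error: "nonneg_fps (top_error M)"
  unfolding top_error_def by (auto intro!: nonneg_intros)

text \<open>For \<open>M \<ge> 2\<close> the bound by \<open>qpoch (M + 2)\<close> weakens to one by
  \<open>qpoch 4\<close>. At \<open>M = 1\<close> its index is 3, so the summand itself is put into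
  the error.\<close>

lemma top_error_ge:
  assumes "1 \<le> M"
  shows "nonneg_fps (top_error M - qpoch (M + 3) (M + 3) * gap_gf (M + 3) * geo (2 * (M + 3)))"
proof (cases "M = 1")
  case True
  then show ?thesis
    by (simp add: top_error_def eval_nat_numeral nonneg_qpoch_gap_gf)
next
  case False
  then have "4 \<le> M + 2" using assms by simp
  from nonneg_fps_add[OF qpoch_gap_gf_antimono[OF this, of "M + 3"] qpoch_top_le[OF assms]] False
  show ?thesis
    by (simp add: top_error_def)
qed

text \<open>After multiplication by \<open>q\<^sup>2\<^sup>M\<close> the tail telescopes against \<open>qpoch3_div\<close>.\<close>
lemma sum_qpoch_tail_upper:
  "nonneg_fps (geo 6 * qpoch3_div M + top_error M
     - (\<Sum>k<Suc M. qpoch (k + 3) (M + 3) * gap_gf (M + 3) * geo (2 * (k + 3))))"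
    (is "nonneg_fps (?W + _ - ?S)")
proof -
  define c where "c k = qpoch (k + 3) (M + 3) * gap_gf (M + 3)" for k
  have c_nonneg: "nonneg_fps (c k)" for k
    unfolding c_def by (rule nonneg_qpoch_gap_gf)
  \<comment> \<open>The analogue of summing \<open>(1 - u)^(k + 3) u\<close> to
    \<open>(1 - u)^3\<close>: each weight turns its summand into a difference.\<close>
  have "(\<Sum>k<Suc M. c k * q ^ (2 * (M - k))) = (\<Sum>k<Suc M. c k - c (Suc k))"
  proof (rule sum.cong)
    fix k assume "k \<in> {..<Suc M}"
    then have "qpoch (k + 3) (M + 3) * q ^ (2 * (M - k)) = qpoch (k + 3) (M + 3) - qpoch (Suc k
        + 3) (M + 3)"
      using qpoch_telescope[of "k + 3" "M + 3"] by simp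
    then have "(qpoch (k + 3) (M + 3) * q ^ (2 * (M - k))) * gap_gf (M + 3) = c k - c (Suc k)"
      by (simp only: c_def left_diff_distrib)
    then show "c k * q ^ (2 * (M - k)) = c k - c (Suc k)"
      by (simp only: c_def ac_simps)
  qed simp
  also have "\<dots> = c 0"
    by (subst sum_lessThan_telescope') (simp add: c_def qpoch_eq_0)
  finally have tele: "q ^ (2 * M) * qpoch3_div M = (\<Sum>k<Suc M. c k * q ^ (2 * (M - k)))"
    using qpoch3_div[of M] by (simp add: c_def)
  \<comment> \<open>The analogue of replacing \<open>1 / (k + 3)\<close> by \<open>1 / 3\<close>.
    The loss is \<open>1 - q^(2 k)\<close> times geometric series, and \<open>c k\<close> is
    increasing because \<open>k + 3 < M + 3\<close>.\<close>
  have term_nonneg: "nonneg_fps (c k * q ^ (2 * (M - k)) * geo 6 - q ^ (2 * M) * (c k * geo (2 * (k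
      + 3))))"
    if "k < M" for k
  proof -
    have g6: "(1 - q ^ 6) * geo 6 = 1" and gk: "(1 - q ^ (2 * (k + 3))) * geo (2 * (k + 3)) = 1"
      by (rule geo_mult; simp)+
    have "2 * M = 2 * (M - k) + 2 * k"
      using that by simp
    then have qM: "q ^ (2 * M) = q ^ (2 * (M - k)) * q ^ (2 * k)"
      by (simp only: power_add)
    have q6: "q ^ (2 * (k + 3)) = q ^ (2 * k) * q ^ 6"
      by (simp flip: power_add)
    have "geo 6 - q ^ (2 * k) * geo (2 * (k + 3))
        = ((1 - q ^ (2 * k) * q ^ 6) * geo (2 * (k + 3))) * geo 6
          - q ^ (2 * k) * (((1 - q ^ 6) * geo 6) * geo (2 * (k + 3)))"
      unfolding g6 gk[unfolded q6] by simp
    also have "\<dots> = geo 6 * geo (2 * (k + 3)) * (1 - q ^ (2 * k))"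
      by (simp add: algebra_simps)
    finally have diff: "geo 6 - q ^ (2 * k) * geo (2 * (k + 3)) = geo 6 * geo (2 * (k + 3)) * (1
        - q ^ (2 * k))" .
    have "c k * q ^ (2 * (M - k)) * geo 6 - q ^ (2 * M) * (c k * geo (2 * (k + 3)))
        = c k * q ^ (2 * (M - k)) * (geo 6 - q ^ (2 * k) * geo (2 * (k + 3)))"
      unfolding qM by (simp add: algebra_simps)
    also have "\<dots> = q ^ (2 * (M - k)) * geo 6 * geo (2 * (k + 3)) * ((1 - q ^ (2 * k)) * c k)"
      unfolding diff by (simp only: ac_simps)
    also have "nonneg_fps \<dots>"
      using that unfolding c_def
      by (intro nonneg_fps_mult nonneg_fps_geo nonneg_fps_power nonneg_fps_X nonneg_fps_one_minus_power
        qpoch_gap_gf_increasing) simp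
    finally show ?thesis .
  qed
  have top: "nonneg_fps (c M * geo 6 - q ^ (2 * M) * (c M * geo (2 * (M + 3)))
      + q ^ (2 * M) * top_error M)"
  proof (cases "M = 0")
    case True
    then show ?thesis by (simp add: nonneg_top_error)
  next
    case False
    then have "nonneg_fps (c M * geo 6 + q ^ (2 * M) * (top_error M - c M * geo (2 * (M + 3))))"
      unfolding c_def
      by (intro nonneg_fps_add nonneg_fps_mult nonneg_qpoch_gap_gf nonneg_fps_geo nonneg_fps_power
          nonneg_fps_X top_error_ge) simp
    then show ?thesis by (simp add: algebra_simps)
  qed
  have "q ^ (2 * M) * (?W + top_error M - ?S)
      = geo 6 * (q ^ (2 * M) * qpoch3_div M) + q ^ (2 * M) * top_error M - q ^ (2 * M) * ?S"
    by (simp only: ring_distribs ac_simps)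
  also have "\<dots> = (\<Sum>k<Suc M. c k * q ^ (2 * (M - k)) * geo 6
      - q ^ (2 * M) * (c k * geo (2 * (k + 3))))
      + q ^ (2 * M) * top_error M"
    unfolding tele c_def[symmetric] sum_distrib_left sum_subtractf by (simp only: ac_simps) simp
  also have "\<dots> = (\<Sum>k<M. c k * q ^ (2 * (M - k)) * geo 6
      - q ^ (2 * M) * (c k * geo (2 * (k + 3))))
      + (c M * geo 6 - q ^ (2 * M) * (c M * geo (2 * (M + 3))) + q ^ (2 * M) * top_error M)"
    by simp
  finally have "nonneg_fps (q ^ (2 * M) * (?W + top_error M - ?S))"
    using nonneg_fps_add[OF nonneg_fps_sum[OF term_nonneg] top, of "{..<M}"] by simp
  then show ?thesis
    by (rule nonneg_fps_X_power_cancel)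
qed

text \<open>The tail from the third term on is nonzero only for \<open>N \<ge> 3\<close>, hence the
  shift to \<open>M + 3\<close>. Its geometric majorant sums to
  \<open>geo 6 * fsum qpoch3_div\<close>; the summands with \<open>k = N\<close> account for
  \<open>qpoch_sum 4\<close> and the isolated term with four parts.\<close>

lemma gap_gf_parts_upper:
  "nonneg_fps (geo 2 * qpoch_sum 1 + geo 4 * qpoch_sum 2 + geo 6 * fsum qpoch3_div
     + qpoch_sum 4 + qpoch 4 4 * gap_gf 4 * geo 8 - fsum (\<lambda>N. of_nat N * gap_gf N))"
proof -
  define R where "R N = (\<Sum>k<N + 1. qpoch (k + 3) N * gap_gf N * geo (2 * (k + 3)))" for N
  have "of_nat N * gap_gf N = geo 2 * (qpoch 1 N * gap_gf N) + geo 4 * (qpoch 2 N * gap_gf N)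
      + R N" for N
  proof -
    have "(of_nat N :: real fps) = qpoch 1 N * geo 2 + (qpoch 2 N * geo 4 + (\<Sum>k<N + 1. qpoch (k
        + 3) N * geo (2 * (k + 3))))"
      using of_nat_eq_sum_qpoch[of N 3] by (simp add: sum.lessThan_Suc_shift eval_nat_numeral del: sum.lessThan_Suc)
    then show ?thesis
      unfolding R_def by (simp only: ring_distribs sum_distrib_left sum_distrib_right ac_simps)
  qed
  then have "fsum (\<lambda>N. of_nat N * gap_gf N)
      = fsum (\<lambda>N. geo 2 * (qpoch 1 N * gap_gf N) + geo 4 * (qpoch 2 N * gap_gf N) + R N)"
    by simp
  also have "\<dots> = geo 2 * qpoch_sum 1 + geo 4 * qpoch_sum 2 + fsum R"
    by (simp only: fsum_add fsum_mult[OF graded_gap_gf_mult] qpoch_sum_def)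
  also have "fsum R = fsum (\<lambda>M. R (M + 3))"
  proof (rule fsum_shift)
    have "R = (\<lambda>N. (\<Sum>k<N + 1. qpoch (k + 3) N * geo (2 * (k + 3))) * gap_gf N)"
      unfolding R_def sum_distrib_right by (simp only: ac_simps)
    then show "graded R"
      using graded_gap_gf_mult by simp
  qed (simp add: R_def qpoch_eq_0)
  finally have parts: "fsum (\<lambda>N. of_nat N * gap_gf N)
      = geo 2 * qpoch_sum 1 + geo 4 * qpoch_sum 2 + fsum (\<lambda>M. R (M + 3))" .
  have R_eq: "R (M + 3) = (\<Sum>k<Suc M. qpoch (k + 3) (M + 3) * gap_gf (M + 3) * geo (2 * (k
      + 3)))" for M
    unfolding R_def by (rule sum.mono_neutral_right) (auto simp: qpoch_eq_0)
  have "fsum top_error = qpoch_sum 4 + qpoch 4 4 * gap_gf 4 * geo 8"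
  proof -
    have "q ^ 1 dvd qpoch 4 4 * gap_gf 4 * geo 8"
      using graded_gap_gf unfolding graded_def
      by (meson dvd_mult dvd_mult2 dvd_trans le_imp_power_dvd one_le_numeral)
    from fsum_single[OF this]
    show ?thesis
      unfolding top_error_def fsum_add qpoch_sum_def
      by (subst fsum_shift[OF graded_gap_gf_mult, of 3]) (simp_all add: qpoch_eq_0)
  qed
  moreover have "fsum (\<lambda>M. geo 6 * qpoch3_div M) = geo 6 * fsum qpoch3_div"
    unfolding qpoch3_div_def by (rule fsum_mult[OF graded_gap_gf_mult])
  moreover have "nonneg_fps (fsum (\<lambda>M. geo 6 * qpoch3_div M + top_error M - R (M + 3)))"
    unfolding R_eq by (intro nonneg_fps_fsum sum_qpoch_tail_upper)
  ultimately show ?thesis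
    unfolding parts fsum_diff fsum_add by (simp add: algebra_simps)
qed

section \<open>The inequalities between generating functions\<close>

definition bounded_fps :: "real fps \<Rightarrow> bool" where
  "bounded_fps f \<longleftrightarrow> (\<exists>C. \<forall>n. \<bar>f $ n\<bar> \<le> C)"

text \<open>Stands in for being a polynomial, with closure rules that follow the syntax of explicit
  expressions. For \<open>k > 0\<close> the series \<open>geo k\<close> is bounded but no
  multiplier, since \<open>geo k * geo 1\<close> grows linearly.\<close>

definition bounded_multiplier :: "real fps \<Rightarrow> bool" where
  "bounded_multiplier p \<longleftrightarrow> (\<forall>f. bounded_fps f \<longrightarrow> bounded_fps (p * f))"

named_theorems bounded_intros

lemma bounded_fps_zero: "bounded_fps 0"
  by (auto simp: bounded_fps_def)

lemma bounded_fps_add: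
  assumes "bounded_fps f" and "bounded_fps g"
  shows "bounded_fps (f + g)"
proof -
  obtain C D where "\<And>n. \<bar>f $ n\<bar> \<le> C" and "\<And>n. \<bar>g $ n\<bar> \<le> D"
    using assms unfolding bounded_fps_def by blast
  then have "\<bar>(f + g) $ n\<bar> \<le> C + D" for n
    unfolding fps_add_nth by (meson abs_triangle_ineq add_mono order_trans)
  then show ?thesis
    unfolding bounded_fps_def by blast
qed

lemma bounded_fps_uminus: "bounded_fps f \<Longrightarrow> bounded_fps (- f)"
  by (simp add: bounded_fps_def)

lemma bounded_fps_diff: "bounded_fps f \<Longrightarrow> bounded_fps g \<Longrightarrow> bounded_fps (f
    - g)"
  using bounded_fps_add[of f "- g"] bounded_fps_uminus by simp

lemma bounded_fps_geo: "bounded_fps (geo k)"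
  unfolding bounded_fps_def geo_def by (intro exI[of _ 1]) simp

lemma bounded_multiplier_one [bounded_intros]: "bounded_multiplier 1"
  by (simp add: bounded_multiplier_def)

lemma bounded_multiplier_X [bounded_intros]: "bounded_multiplier fps_X"
  unfolding bounded_multiplier_def bounded_fps_def
  by (metis abs_0 abs_ge_zero fps_X_mult_nth order_trans)

lemma bounded_multiplier_add [bounded_intros]:
  "bounded_multiplier f \<Longrightarrow> bounded_multiplier g \<Longrightarrow> bounded_multiplier (f
      + g)"
  by (simp add: bounded_multiplier_def distrib_right bounded_fps_add)

lemma bounded_multiplier_diff [bounded_intros]:
  "bounded_multiplier f \<Longrightarrow> bounded_multiplier g \<Longrightarrow> bounded_multiplier (f
      - g)"
  by (simp add: bounded_multiplier_def left_diff_distrib bounded_fps_diff)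

lemma bounded_multiplier_mult [bounded_intros]:
  "bounded_multiplier f \<Longrightarrow> bounded_multiplier g \<Longrightarrow> bounded_multiplier (f * g)"
  by (simp add: bounded_multiplier_def mult.assoc)

lemma bounded_multiplier_power [bounded_intros]:
  "bounded_multiplier f \<Longrightarrow> bounded_multiplier (f ^ k)"
  by (induction k) (auto intro: bounded_intros)

lemma bounded_multiplier_of_nat: "bounded_multiplier (of_nat k)"
proof (induction k)
  case (Suc k)
  then show ?case
    using bounded_multiplier_add[OF bounded_multiplier_one Suc] by simp
qed (simp add: bounded_multiplier_def bounded_fps_zero)

lemma bounded_multiplier_numeral [bounded_intros]: "bounded_multiplier (numeral k)"
  using bounded_multiplier_of_nat[of "numeral k"] by simp

lemma bounded_multiplier_prod [bounded_intros]:
  "(\<And>i. i \<in> I \<Longrightarrow> bounded_multiplier (f i)) \<Longrightarrow> bounded_multiplier (\<Prod>i\<in>I. f i)"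
  by (induction I rule: infinite_finite_induct) (auto intro: bounded_intros)

lemma bounded_multiplier_mult_geo: "bounded_multiplier p \<Longrightarrow> bounded_fps (p * geo k)"
  using bounded_fps_geo by (simp add: bounded_multiplier_def)

lemma bounded_multiplier_imp_bounded:
  assumes "bounded_multiplier p"
  shows "bounded_fps p"
proof -
  have "bounded_fps ((p * (1 - q ^ 1)) * geo 1)"
    by (intro bounded_multiplier_mult_geo bounded_intros assms)
  moreover have "(p * (1 - q ^ 1)) * geo 1 = p"
    unfolding mult.assoc by (subst geo_mult) simp_all
  ultimately show ?thesis by metis
qed

lemma geo_mult_geo_1_ge:
  assumes "0 < k"
  shows "real (n div k) \<le> (geo k * geo 1) $ n"
proof -
  have sub: "(*) k ` {..<n div k} \<subseteq> {0..n}"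
  proof
    fix i assume "i \<in> (*) k ` {..<n div k}"
    then obtain j where "i = k * j" and "j < n div k"
      by blast
    then have "i \<le> k * (n div k)"
      by simp
    also have "\<dots> \<le> n"
      by (rule times_div_less_eq_dividend)
    finally show "i \<in> {0..n}"
      by simp
  qed
  have "real (n div k) = real (card ((*) k ` {..<n div k}))"
    using assms by (subst card_image) (auto simp: inj_on_def)
  also have "\<dots> = (\<Sum>i\<in>(*) k ` {..<n div k}. if k dvd i then 1 else 0)"
    unfolding card_eq_sum of_nat_sum by (rule sum.cong) auto
  also have "\<dots> \<le> (\<Sum>i = 0..n. if k dvd i then 1 else 0)"
    by (rule sum_mono2[OF _ sub]) auto
  also have "\<dots> = (geo k * geo 1) $ n"
    by (simp add: fps_mult_nth geo_def)
  finally show ?thesis .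
qed

text \<open>A double pole at 1 gives linear growth, which outweighs any bounded error as soon as
  \<open>(n - m) div k\<close> exceeds its bound.\<close>

lemma eventually_positive:
  assumes "bounded_fps c" and "0 < k" and "nonneg_fps (f - (c + q ^ m * (geo k * geo 1)))"
  shows "\<exists>N. \<forall>n\<ge>N. 0 < f $ n"
proof -
  obtain C where C: "\<And>n. \<bar>c $ n\<bar> \<le> C"
    using assms(1) unfolding bounded_fps_def by blast
  have "0 < f $ n" if n: "n \<ge> m + k * (nat \<lceil>C\<rceil> + 1)" for n
  proof -
    have "k * (nat \<lceil>C\<rceil> + 1) \<le> n - m"
      using n by simp
    then have "nat \<lceil>C\<rceil> + 1 \<le> (n - m) div k"
      using \<open>0 < k\<close> by (simp add: less_eq_div_iff_mult_less_eq mult.commute)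
    then have "C < real ((n - m) div k)"
      by linarith
    also have "\<dots> \<le> (q ^ m * (geo k * geo 1)) $ n"
      using n geo_mult_geo_1_ge[OF \<open>0 < k\<close>] by (simp add: fps_X_power_mult_nth)
    finally have "0 < c $ n + (q ^ m * (geo k * geo 1)) $ n"
      using C[of n] by linarith
    also have "\<dots> \<le> f $ n"
      using assms(3) unfolding nonneg_fps_def by simp
    finally show ?thesis .
  qed
  then show ?thesis by blast
qed

lemma geo_cong:
  assumes "0 < k" and "0 < l" and "(1 - q ^ k) * p = (1 - q ^ l) * r"
  shows "geo k * r = geo l * p"
proof -
  have "geo k * r = geo k * (((1 - q ^ l) * geo l) * r)"
    by (subst geo_mult) (use assms in simp_all)
  also have "\<dots> = geo k * ((1 - q ^ l) * r) * geo l"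
    by (simp only: ac_simps)
  also have "\<dots> = ((1 - q ^ k) * geo k) * (geo l * p)"
    unfolding assms(3)[symmetric] by (simp only: ac_simps)
  finally show ?thesis
    using geo_mult[OF assms(1)] by simp
qed

section \<open>Eliminating the shifted families by their recursion\<close>

lemma gap_min_gf_recs:
  "gap_min_gf 0 = (1 + q ^ 2) * gap_min_gf 1 + q * gap_min_gf 2"
  "gap_min_gf 1 = (1 + q ^ 4) * gap_min_gf 2 + q ^ 3 * gap_min_gf 3"
  "gap_min_gf 2 = (1 + q ^ 6) * gap_min_gf 3 + q ^ 5 * gap_min_gf 4"
  "gap_min_gf 3 = (1 + q ^ 8) * gap_min_gf 4 + q ^ 7 * gap_min_gf 5"
  "gap_min_gf 4 = (1 + q ^ 10) * gap_min_gf 5 + q ^ 9 * gap_min_gf 6"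
  using gap_min_gf_rec[of 0] gap_min_gf_rec[of 1] gap_min_gf_rec[of 2] gap_min_gf_rec[of 3] gap_min_gf_rec[of 4]
  by (simp_all add: numeral_2_eq_2[symmetric])

lemma nonneg_one_minus_gap_min_pos: "nonneg_fps ((1 - q) * gap_min_pos k)"
proof -
  have "nonneg_fps (((1 - q) * gap_min_pos k - q ^ (2 * k + 1)) + q ^ (2 * k + 1))"
    by (intro nonneg_fps_add gap_min_pos_increasing nonneg_intros)
  then show ?thesis by simp
qed

lemma gap_min_pos_ge_geo: "nonneg_fps (gap_min_pos k - q ^ (2 * k + 1) * geo 1)"
proof -
  have "gap_min_pos k = geo 1 * ((1 - q) * gap_min_pos k)"
    by (rule geo_eqI) simp_all
  then have "gap_min_pos k - q ^ (2 * k + 1) * geo 1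
      = geo 1 * ((1 - q) * gap_min_pos k - q ^ (2 * k + 1))"
    by (simp add: algebra_simps)
  then show ?thesis
    using nonneg_fps_mult[OF nonneg_fps_geo gap_min_pos_increasing] by metis
qed

text \<open>The polynomials below arise by eliminating \<open>a0\<close>, \<open>a1\<close> and \<open>a2\<close>. What matters is that, after division
  by \<open>1 - x\<close>, both have nonnegative coefficients.\<close>
lemma one_hooks_ring:
  fixes x a0 a1 a2 a3 a4 :: "real fps"
  assumes "a2 = (1 + x ^ 6) * a3 + x ^ 5 * a4" and "a1 = (1 + x ^ 4) * a2 + x ^ 3 * a3"
    and "a0 = (1 + x ^ 2) * a1 + x * a2"
  shows "(1 + x ^ 2 + x ^ 4 + x ^ 6) * (x ^ 2 * a1 + x * a2)
      + (1 + x ^ 4) * (x ^ 6 * a2 + (x ^ 5 + x ^ 7) * a3 + x ^ 6 * a4) - (x + x ^ 5 + x ^ 6) * a0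
    = (x ^ 5 + x ^ 10 - x ^ 11 + x ^ 12 - 2 * x ^ 13 + x ^ 14 - x ^ 15 + x ^ 16 - x ^ 17) * a3
      + (x ^ 6 + x ^ 9 + x ^ 11 - 2 * x ^ 12 + x ^ 13 - x ^ 14 + x ^ 15 - x ^ 16) * a4"
  unfolding assms by algebra

lemma one_hooks_positive:
  "\<exists>N. \<forall>n\<ge>N. 0 < (fsum (\<lambda>N. of_nat N * gap_gf N) - geo 8 * (q + q ^ 5
      + q ^ 6) * gap_min_gf 0) $ n"
proof -
  let ?F = "fsum (\<lambda>N. of_nat N * gap_gf N)"
  \<comment> \<open>\<open>u\<close> is the quotient of \<open>p3\<close> by \<open>1 - q\<close>.
    The value of \<open>p4\<close> at 1 is 1, so \<open>q^16\<close> is split off before dividing;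
    this remainder carries the growth.\<close>
  define u where "u = q ^ 5 + q ^ 6 + q ^ 7 + q ^ 8 + q ^ 9 + 2 * q ^ 10 + q ^ 11 + 2 * q ^ 12
      + q ^ 14 + q ^ 16"
  define v where "v = q ^ 6 + q ^ 7 + q ^ 8 + 2 * q ^ 9 + 2 * q ^ 10 + 3 * q ^ 11 + q ^ 12
      + 2 * q ^ 13 + q ^ 14 + 2 * q ^ 15"
  define p3 where "p3 = (1 - q) * u"
  define p4 where "p4 = (1 - q) * v + q ^ 16"
  have p3: "p3 = q ^ 5 + q ^ 10 - q ^ 11 + q ^ 12 - 2 * q ^ 13 + q ^ 14 - q ^ 15 + q ^ 16 - q ^ 17"
    unfolding p3_def u_def by algebra
  have p4: "p4 = q ^ 6 + q ^ 9 + q ^ 11 - 2 * q ^ 12 + q ^ 13 - q ^ 14 + q ^ 15 - q ^ 16"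
    unfolding p4_def v_def by algebra
  have g2: "geo 2 = geo 8 * (1 + q ^ 2 + q ^ 4 + q ^ 6)" and g4: "geo 4 = geo 8 * (1 + q ^ 4)"
    using geo_cong[of 2 8 "1 + q ^ 2 + q ^ 4 + q ^ 6" 1] geo_cong[of 4 8 "1 + q ^ 4" 1]
    by (simp_all add: algebra_simps flip: power_add)
  have "geo 2 * qpoch_sum 1 + geo 4 * qpoch_sum 2 - geo 8 * (q + q ^ 5 + q ^ 6) * gap_min_gf 0
      = geo 8 * ((1 + q ^ 2 + q ^ 4 + q ^ 6) * qpoch_sum 1 + (1 + q ^ 4) * qpoch_sum 2
          - (q + q ^ 5 + q ^ 6) * gap_min_gf 0)"
    unfolding g2 g4 by (simp only: ring_distribs mult.assoc)
  also have "\<dots> = geo 8 * (p3 * gap_min_gf 3 + p4 * gap_min_gf 4)"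
    unfolding qpoch_sum_1 qpoch_sum_2 p3 p4
    by (subst one_hooks_ring[OF gap_min_gf_recs(3,2,1)]) (rule refl)
  also have "\<dots> = (p3 + p4) * geo 8 + geo 8 * u * ((1 - q) * gap_min_pos 3)
      + geo 8 * v * ((1 - q) * gap_min_pos 4) + geo 8 * q ^ 16 * gap_min_pos 4"
    unfolding gap_min_gf_eq p3_def p4_def by (simp only: ring_distribs mult_1_left mult_1_right ac_simps)
  \<comment> \<open>The constant terms of the two families give the bounded series
    \<open>(p3 + p4) * geo 8\<close>. The exponent 25 is 16 + 9, where 9 is the least part counted
    by \<open>gap_min_pos 4\<close>.\<close>
  finally have eq: "?F - geo 8 * (q + q ^ 5 + q ^ 6) * gap_min_gf 0
        - ((p3 + p4) * geo 8 + q ^ 25 * (geo 8 * geo 1))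
      = (?F - (geo 2 * qpoch_sum 1 + geo 4 * qpoch_sum 2))
        + (geo 8 * u * ((1 - q) * gap_min_pos 3) + (geo 8 * v * ((1 - q) * gap_min_pos 4)
        + geo 8 * q ^ 16 * (gap_min_pos 4 - q ^ (2 * 4 + 1) * geo 1)))"
    by (simp add: algebra_simps flip: power_add)
  have "nonneg_fps u" and "nonneg_fps v"
    unfolding u_def v_def by (intro nonneg_intros)+
  then have "nonneg_fps (?F - geo 8 * (q + q ^ 5 + q ^ 6) * gap_min_gf 0
        - ((p3 + p4) * geo 8 + q ^ 25 * (geo 8 * geo 1)))"
    unfolding eq
    by (intro nonneg_fps_add nonneg_fps_mult nonneg_fps_geo nonneg_fps_power nonneg_fps_X
        gap_gf_parts_lower nonneg_one_minus_gap_min_pos gap_min_pos_ge_geo)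
  moreover have "bounded_fps ((p3 + p4) * geo 8)"
    unfolding p3 p4 by (intro bounded_multiplier_mult_geo bounded_intros)
  ultimately show ?thesis
    by (intro eventually_positive[of "(p3 + p4) * geo 8" 8]) simp_all
qed

text \<open>The simple poles of \<open>geo 2\<close>, \<open>geo 4\<close>, \<open>geo 6\<close> and
  \<open>geo 8\<close> are put over \<open>(1 - x^6) (1 - x^8)\<close>, which has a double zero at
  1. Every term on the left is therefore divisible by \<open>1 - x^2\<close>, and this factor is
  kept apart on the right.\<close>

lemma two_hooks_ring:
  fixes x a0 a1 a2 a3 a4 a5 :: "real fps"
  assumes "a3 = (1 + x ^ 8) * a4 + x ^ 7 * a5" and "a2 = (1 + x ^ 6) * a3 + x ^ 5 * a4"
    and "a1 = (1 + x ^ 4) * a2 + x ^ 3 * a3" and "a0 = (1 + x ^ 2) * a1 + x * a2"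
  shows "(1 - x ^ 6) * (x ^ 2 + x ^ 5 + x ^ 6 + x ^ 9 - x ^ 11 + x ^ 12) * a0
      + (1 - x ^ 8) * (1 + x ^ 2 + x ^ 4) * (1 - x) * (a0 - a1)
      - ((1 - x ^ 8) * (1 + x ^ 2 + x ^ 4) * (x ^ 2 * a1 + x * a2)
       + (1 - x ^ 6) * (1 + x ^ 4) * (x ^ 6 * a2 + (x ^ 5 + x ^ 7) * a3 + x ^ 6 * a4)
       + (1 - x ^ 8) * (x ^ 12 * a2 + (x ^ 11 + x ^ 13 + x ^ 15) * a3
          + (x ^ 12 + x ^ 14 + x ^ 16) * a4 + x ^ 15 * a5))
    = (1 - x ^ 2) * ((x ^ 12 - x ^ 6 + x ^ 14 + x ^ 15 + 2 * x ^ 16 + 2 * x ^ 18 + 4 * x ^ 20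
        - x ^ 21 + 5 * x ^ 22 - x ^ 23 + 5 * x ^ 24 - x ^ 25 + 4 * x ^ 26 - x ^ 27 + 4 * x ^ 28
        - x ^ 29 + 3 * x ^ 30 - x ^ 31 + 2 * x ^ 32 - x ^ 33 + 2 * x ^ 34 - x ^ 35 + x ^ 36) * a4
      + (x ^ 17 - x ^ 18 + 2 * x ^ 19 - 2 * x ^ 20 + 3 * x ^ 21 - 2 * x ^ 22 + 4 * x ^ 23
          - 2 * x ^ 24 + 3 * x ^ 25 - x ^ 26 + 3 * x ^ 27 - x ^ 28 + 3 * x ^ 29 - x ^ 30
          + 2 * x ^ 31 - x ^ 32 + 2 * x ^ 33 - x ^ 34 + x ^ 35) * a5)"
  unfolding assms by algebra

text \<open>With \<open>p\<close> the polynomial on the left, \<open>(1 + x) p / ((1 - x^6) (1 - x^8))\<close> is negative only at \<open>x^6\<close>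
  and \<open>x^7\<close>. The correction terms compensate this and leave room for \<open>qpoch_sum 4\<close>.\<close>
lemma two_hooks_certificate:
  fixes x g b :: "real fps"
  assumes "g * ((1 - x ^ 6) * (1 - x ^ 8)) = 1"
  shows "g * ((1 - x ^ 2) * (x ^ 12 - x ^ 6 + x ^ 14 + x ^ 15 + 2 * x ^ 16 + 2 * x ^ 18 + 4 * x ^ 20
      - x ^ 21 + 5 * x ^ 22 - x ^ 23 + 5 * x ^ 24 - x ^ 25 + 4 * x ^ 26 - x ^ 27 + 4 * x ^ 28
      - x ^ 29 + 3 * x ^ 30 - x ^ 31 + 2 * x ^ 32 - x ^ 33 + 2 * x ^ 34 - x ^ 35 + x ^ 36)) * b
    = g * (x ^ 15 + 3 * x ^ 16 + 2 * x ^ 17 + x ^ 18 + 2 * x ^ 20 - x ^ 23 - x ^ 24 - x ^ 25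
        - x ^ 26 - x ^ 28 - x ^ 30 - x ^ 32 - x ^ 33 + x ^ 34 + x ^ 35 + 2 * x ^ 36 + 4 * x ^ 37
        + 4 * x ^ 38 + 5 * x ^ 39 + 5 * x ^ 40 + 6 * x ^ 41 + 5 * x ^ 42 + 5 * x ^ 43 + 5 * x ^ 44
        + 4 * x ^ 45 + 3 * x ^ 46 + 2 * x ^ 47 + 2 * x ^ 48 + x ^ 49)
        * ((1 - x) * b)
      - x ^ 6 * ((1 - x ^ 2) * b) + (x ^ 18 + x ^ 19) * b
      + (x ^ 20 + x ^ 21 + x ^ 23 + x ^ 24 + x ^ 25 + x ^ 26 + x ^ 27 + 2 * x ^ 28 + x ^ 29 + x ^ 30
          + x ^ 31 + x ^ 32 + x ^ 33 + x ^ 35 + x ^ 36) * b"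
proof -
  have "(1 - x ^ 2) * (x ^ 12 - x ^ 6 + x ^ 14 + x ^ 15 + 2 * x ^ 16 + 2 * x ^ 18 + 4 * x ^ 20
      - x ^ 21 + 5 * x ^ 22 - x ^ 23 + 5 * x ^ 24 - x ^ 25 + 4 * x ^ 26 - x ^ 27 + 4 * x ^ 28
      - x ^ 29 + 3 * x ^ 30 - x ^ 31 + 2 * x ^ 32 - x ^ 33 + 2 * x ^ 34 - x ^ 35 + x ^ 36)
    = (x ^ 15 + 3 * x ^ 16 + 2 * x ^ 17 + x ^ 18 + 2 * x ^ 20 - x ^ 23 - x ^ 24 - x ^ 25 - x ^ 26
        - x ^ 28 - x ^ 30 - x ^ 32 - x ^ 33 + x ^ 34 + x ^ 35 + 2 * x ^ 36 + 4 * x ^ 37 + 4 * x ^ 38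
        + 5 * x ^ 39 + 5 * x ^ 40 + 6 * x ^ 41 + 5 * x ^ 42 + 5 * x ^ 43 + 5 * x ^ 44 + 4 * x ^ 45
        + 3 * x ^ 46 + 2 * x ^ 47 + 2 * x ^ 48 + x ^ 49) * (1 - x)
      + (x ^ 20 + x ^ 21 + x ^ 23 + x ^ 24 + x ^ 25 + x ^ 26 + x ^ 27 + 2 * x ^ 28 + x ^ 29 + x ^ 30
          + x ^ 31 + x ^ 32 + x ^ 33 + x ^ 35 + x ^ 36
         + x ^ 18 + x ^ 19 - x ^ 6 * (1 - x ^ 2)) * ((1 - x ^ 6) * (1 - x ^ 8))"
    by algebra
  then have "g * ((1 - x ^ 2) * (x ^ 12 - x ^ 6 + x ^ 14 + x ^ 15 + 2 * x ^ 16 + 2 * x ^ 18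
      + 4 * x ^ 20 - x ^ 21 + 5 * x ^ 22 - x ^ 23 + 5 * x ^ 24 - x ^ 25 + 4 * x ^ 26 - x ^ 27
      + 4 * x ^ 28 - x ^ 29 + 3 * x ^ 30 - x ^ 31 + 2 * x ^ 32 - x ^ 33 + 2 * x ^ 34 - x ^ 35
      + x ^ 36)) * b
    = g * (x ^ 15 + 3 * x ^ 16 + 2 * x ^ 17 + x ^ 18 + 2 * x ^ 20 - x ^ 23 - x ^ 24 - x ^ 25
        - x ^ 26 - x ^ 28 - x ^ 30 - x ^ 32 - x ^ 33 + x ^ 34 + x ^ 35 + 2 * x ^ 36 + 4 * x ^ 37
        + 4 * x ^ 38 + 5 * x ^ 39 + 5 * x ^ 40 + 6 * x ^ 41 + 5 * x ^ 42 + 5 * x ^ 43 + 5 * x ^ 44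
        + 4 * x ^ 45 + 3 * x ^ 46 + 2 * x ^ 47 + 2 * x ^ 48 + x ^ 49) * ((1 - x) * b)
      + (g * ((1 - x ^ 6) * (1 - x ^ 8))) * ((x ^ 20 + x ^ 21 + x ^ 23 + x ^ 24 + x ^ 25 + x ^ 26
          + x ^ 27 + 2 * x ^ 28 + x ^ 29 + x ^ 30 + x ^ 31 + x ^ 32 + x ^ 33 + x ^ 35 + x ^ 36
         + x ^ 18 + x ^ 19 - x ^ 6 * (1 - x ^ 2)) * b)"
    by (simp only: distrib_left distrib_right mult.assoc mult.left_commute mult.commute)
  then show ?thesis
    unfolding assms by (simp add: algebra_simps)
qed

text \<open>\<open>h\<close> will be the series of gap partitions containing the part 1, which have
  one 2-hook fewer than parts. An equation with the factor \<open>1 + q\<close> fixes it without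
  division.\<close>

lemma two_hooks_positive:
  assumes h: "(1 + q) * h = gap_min_gf 0 - gap_min_gf 1"
  shows "\<exists>N. \<forall>n\<ge>N. 0 < ((geo 16 * (q ^ 2 + q ^ 10 + q ^ 12) + geo 8 * (q + q ^ 5
      + q ^ 6) - q - geo 16 * q ^ 11)
    * gap_min_gf 0 - (fsum (\<lambda>N. of_nat N * gap_gf N) - h)) $ n"
    (is "\<exists>N. \<forall>n\<ge>N. 0 < ?F $ n")
proof -
  let ?parts = "fsum (\<lambda>N. of_nat N * gap_gf N)"
  \<comment> \<open>The residue side over the single denominator \<open>1 - q^8\<close>. There
    \<open>q / (1 - q^8) - q\<close> is \<open>q^9 / (1 - q^8)\<close>, and
    \<open>q^2 + q^10\<close> is divisible by \<open>1 + q^8\<close>. Changing the denominator of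
    \<open>q^12 - q^11\<close> from \<open>1 - q^16\<close> leaves a surplus
    \<open>q^19 (1 - q) / (1 - q^16)\<close>, which is nonnegative on the increasing
    \<open>gap_min_gf 0\<close>.\<close>
  define L where "L = q ^ 2 + q ^ 5 + q ^ 6 + q ^ 9 - q ^ 11 + q ^ 12"
  define p4 where "p4 = q ^ 12 - q ^ 6 + q ^ 14 + q ^ 15 + 2 * q ^ 16 + 2 * q ^ 18 + 4 * q ^ 20
      - q ^ 21 + 5 * q ^ 22 - q ^ 23 + 5 * q ^ 24 - q ^ 25 + 4 * q ^ 26 - q ^ 27 + 4 * q ^ 28
      - q ^ 29 + 3 * q ^ 30 - q ^ 31 + 2 * q ^ 32 - q ^ 33 + 2 * q ^ 34 - q ^ 35 + q ^ 36"
  define p5 where "p5 = q ^ 17 - q ^ 18 + 2 * q ^ 19 - 2 * q ^ 20 + 3 * q ^ 21 - 2 * q ^ 22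
      + 4 * q ^ 23 - 2 * q ^ 24 + 3 * q ^ 25 - q ^ 26 + 3 * q ^ 27 - q ^ 28 + 3 * q ^ 29 - q ^ 30
      + 2 * q ^ 31 - q ^ 32 + 2 * q ^ 33 - q ^ 34 + q ^ 35"
  define y where "y = q ^ 20 + q ^ 21 + q ^ 23 + q ^ 24 + q ^ 25 + q ^ 26 + q ^ 27 + 2 * q ^ 28
      + q ^ 29 + q ^ 30 + q ^ 31 + q ^ 32 + q ^ 33 + q ^ 35 + q ^ 36"
  \<comment> \<open>The cofactor of \<open>(1 - q) * gap_min_pos 4\<close> in the certificate has
    negative coefficients. Written as \<open>a + (1 - q^6) b + (1 - q^8) c\<close>, it is
    nonnegative after multiplication by \<open>G\<close>, since \<open>G (1 - q^6) = geo 8\<close>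
    and \<open>G (1 - q^8) = geo 6\<close>.\<close>
  define a where "a = q ^ 16 + q ^ 34 + q ^ 35 + 2 * q ^ 36 + 4 * q ^ 37 + 4 * q ^ 38 + 5 * q ^ 39
      + 5 * q ^ 40 + 6 * q ^ 41 + 5 * q ^ 42 + 5 * q ^ 43 + 5 * q ^ 44 + 4 * q ^ 45 + 3 * q ^ 46
      + 2 * q ^ 47 + 2 * q ^ 48 + q ^ 49"
  define b where "b = q ^ 15 + q ^ 16 + q ^ 17 + q ^ 18 + 2 * q ^ 20 + q ^ 21 + q ^ 22 + q ^ 24
      + q ^ 26 + q ^ 27"
  define c where "c = q ^ 16 + q ^ 17"
  define m where "m = q ^ 17 + q ^ 19 + q ^ 21 + q ^ 22 + 2 * q ^ 23 + 2 * q ^ 24 + q ^ 25 + q ^ 26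
      + q ^ 27 + q ^ 28 + q ^ 29 + q ^ 30 + q ^ 32 + q ^ 33 + q ^ 34 + q ^ 36"
  define e5 where "e5 = q ^ 19 + q ^ 21 + q ^ 23 + q ^ 25"
  define e6 where "e6 = q ^ 20 + q ^ 22 + 2 * q ^ 24 + q ^ 26 + q ^ 28"
  define e7 where "e7 = q ^ 23 + q ^ 25 + q ^ 27 + q ^ 29"
  define top where "top = qpoch 4 4 * gap_gf 4 * geo 8"
  define V where "V = geo 8 * L * gap_min_gf 0 + h
    - (geo 2 * qpoch_sum 1 + geo 4 * qpoch_sum 2 + geo 6 * fsum qpoch3_div)"
  define G where "G = geo 6 * geo 8"
  \<comment> \<open>Collects everything that stays bounded. \<open>G * (1 - q^2)\<close> has only
    simple poles because 6 and 8 have greatest common divisor 2; so it is a polynomial over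
    \<open>1 - q^24\<close>, with 24 the least common multiple.\<close>
  define bd where "bd = (1 - q ^ 2 + q ^ 6 - q ^ 10 + q ^ 12) * (p4 + p5) * geo 24
    - (q ^ 20 + e5 + e6 + e7 + q ^ 28) - top - q ^ 6 * (q ^ 9 + q ^ 10)"
  have g6: "(1 - q ^ 6) * geo 6 = 1" and g8: "(1 - q ^ 8) * geo 8 = 1"
    by (rule geo_mult; simp)+
  have G: "G * ((1 - q ^ 6) * (1 - q ^ 8)) = 1"
  proof -
    have "G * ((1 - q ^ 6) * (1 - q ^ 8)) = ((1 - q ^ 6) * geo 6) * ((1 - q ^ 8) * geo 8)"
      unfolding G_def by (simp only: ac_simps)
    then show ?thesis unfolding g6 g8 by simp
  qed
  have G_div: "geo k * r = G * s" if "0 < k" and "(1 - q ^ k) * s = (1 - q ^ 6) * (1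
      - q ^ 8) * r" for k r s
  proof -
    have "G * s = (G * s) * ((1 - q ^ k) * geo k)"
      using geo_mult[OF that(1)] by simp
    also have "\<dots> = G * ((1 - q ^ k) * s) * geo k"
      by (simp only: ac_simps)
    also have "\<dots> = (G * ((1 - q ^ 6) * (1 - q ^ 8))) * (geo k * r)"
      unfolding that(2) by (simp only: ac_simps)
    finally show ?thesis
      unfolding G by simp
  qed
  have G2: "geo 2 = G * ((1 - q ^ 8) * (1 + q ^ 2 + q ^ 4))"
    using G_div[of 2 "((1 - q ^ 8) * (1 + q ^ 2 + q ^ 4))" 1] by simp algebra
  have G4: "geo 4 = G * ((1 - q ^ 6) * (1 + q ^ 4))"
    using G_div[of 4 "((1 - q ^ 6) * (1 + q ^ 4))" 1] by simp algebra
  have G6: "geo 6 = G * (1 - q ^ 8)"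
    using G_div[of 6 "(1 - q ^ 8)" 1] by simp
  have G8: "geo 8 = G * (1 - q ^ 6)"
    using G_div[of 8 "(1 - q ^ 6)" 1] by simp
  have G24: "geo 24 * (1 - q ^ 2 + q ^ 6 - q ^ 10 + q ^ 12) = G * (1 - q ^ 2)"
    by (rule G_div) (simp, algebra)
  have Gh: "h = G * ((1 - q ^ 8) * (1 + q ^ 2 + q ^ 4) * (1 - q) * (gap_min_gf 0 - gap_min_gf 1))"
  proof -
    have "(1 - q ^ 6) * (1 - q ^ 8) * h = (1 - q ^ 8) * (1 + q ^ 2 + q ^ 4) * (1 - q) * ((1 + q) * h)"
      by algebra
    then have "G * ((1 - q ^ 6) * (1 - q ^ 8)) * h
        = G * ((1 - q ^ 8) * (1 + q ^ 2 + q ^ 4) * (1 - q) * ((1 + q) * h))"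
      by (simp only: mult.assoc)
    then show ?thesis
      unfolding G h by simp
  qed
  have "V = G * ((1 - q ^ 6) * L * gap_min_gf 0
      + (1 - q ^ 8) * (1 + q ^ 2 + q ^ 4) * (1 - q) * (gap_min_gf 0 - gap_min_gf 1)
      - ((1 - q ^ 8) * (1 + q ^ 2 + q ^ 4) * qpoch_sum 1
       + (1 - q ^ 6) * (1 + q ^ 4) * qpoch_sum 2
       + (1 - q ^ 8) * fsum qpoch3_div))"
    unfolding V_def G2 G4 G6 G8 by (subst Gh) algebra
  also have "\<dots> = G * ((1 - q ^ 2) * (p4 * gap_min_gf 4 + p5 * gap_min_gf 5))"
    unfolding L_def qpoch_sum_1 qpoch_sum_2 fsum_qpoch3_div p4_def p5_def
    by (subst two_hooks_ring[OF gap_min_gf_recs(4,3,2,1)]) (rule refl)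
  also have "\<dots> = G * (1 - q ^ 2) * (p4 + p5) + G * ((1 - q ^ 2) * p4) * gap_min_pos 4
      + G * ((1 + q) * p5) * ((1 - q) * gap_min_pos 5)"
    unfolding gap_min_gf_eq by algebra
  also have "G * ((1 - q ^ 2) * p4) * gap_min_pos 4
      = G * (a + (1 - q ^ 6) * b + (1 - q ^ 8) * c) * ((1 - q) * gap_min_pos 4)
        - q ^ 6 * ((1 - q ^ 2) * gap_min_pos 4) + (q ^ 18 + q ^ 19) * gap_min_pos 4 + y * gap_min_pos 4"
  proof -
    have "a + (1 - q ^ 6) * b + (1 - q ^ 8) * c = q ^ 15 + 3 * q ^ 16 + 2 * q ^ 17 + q ^ 18
        + 2 * q ^ 20 - q ^ 23 - q ^ 24 - q ^ 25 - q ^ 26 - q ^ 28 - q ^ 30 - q ^ 32 - q ^ 33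
        + q ^ 34 + q ^ 35 + 2 * q ^ 36 + 4 * q ^ 37 + 4 * q ^ 38 + 5 * q ^ 39 + 5 * q ^ 40
        + 6 * q ^ 41 + 5 * q ^ 42 + 5 * q ^ 43 + 5 * q ^ 44 + 4 * q ^ 45 + 3 * q ^ 46 + 2 * q ^ 47
        + 2 * q ^ 48 + q ^ 49"
      unfolding a_def b_def c_def by algebra
    then show ?thesis
      unfolding p4_def y_def using two_hooks_certificate[OF G] by simp
  qed
  also have "G * (a + (1 - q ^ 6) * b + (1 - q ^ 8) * c) = G * a + geo 8 * b + geo 6 * c"
    unfolding G6 G8 by algebra
  also have "G * ((1 + q) * p5) * ((1 - q) * gap_min_pos 5)
      = G * m * ((1 - q) * gap_min_pos 5) + geo 8 * q ^ 26 * gap_min_pos 5"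
  proof -
    \<comment> \<open>\<open>(1 + q) * p5\<close> has nonnegative coefficients. From it
      \<open>q^26 (1 + q + ... + q^5)\<close> is set aside, which after multiplication by
      \<open>G\<close> leaves the growing term \<open>geo 8 * q^26 * gap_min_pos 5\<close>.\<close>
    have factor: "(1 + q) * p5 * (1 - q) = m * (1 - q) + q ^ 26 * (1 - q ^ 6)"
      unfolding p5_def m_def by algebra
    have "G * ((1 + q) * p5) * ((1 - q) * gap_min_pos 5) = G * ((1 + q) * p5 * (1 - q)) * gap_min_pos 5"
      by (simp only: mult.assoc)
    also have "\<dots> = G * (m * (1 - q) + q ^ 26 * (1 - q ^ 6)) * gap_min_pos 5"
      unfolding factor ..
    also have "\<dots> = G * m * ((1 - q) * gap_min_pos 5) + (G * (1 - q ^ 6)) * q ^ 26 * gap_min_pos 5"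
      by (simp only: ring_distribs ac_simps)
    finally show ?thesis
      unfolding G8[symmetric] by simp
  qed
  finally have V: "V = G * (1 - q ^ 2) * (p4 + p5)
      + ((G * a + geo 8 * b + geo 6 * c) * ((1 - q) * gap_min_pos 4)
        - q ^ 6 * ((1 - q ^ 2) * gap_min_pos 4) + (q ^ 18 + q ^ 19) * gap_min_pos 4 + y * gap_min_pos 4)
      + (G * m * ((1 - q) * gap_min_pos 5) + geo 8 * q ^ 26 * gap_min_pos 5)" .

  have pos4: "gap_min_pos 4 = q ^ 9 + q ^ 10 + (1 + q ^ 10) * gap_min_pos 5 + q ^ 9 * gap_min_pos 6"
    using gap_min_gf_recs(5) unfolding gap_min_gf_eq by (simp add: algebra_simps)
  have pos_le: "nonneg_fps (q ^ 2 * gap_min_pos 4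
      - gap_min_pos 5)" "nonneg_fps (q ^ 4 * gap_min_pos 4 - gap_min_pos 6)"
      "nonneg_fps (q ^ 6 * gap_min_pos 4 - gap_min_pos 7)" "nonneg_fps (q ^ 8 * gap_min_pos 4
          - gap_min_pos 8)"
    using gap_min_pos_add_le[of 1 4] gap_min_pos_add_le[of 2 4] gap_min_pos_add_le[of 3 4] gap_min_pos_add_le[of 4 4]
    by simp_all
  \<comment> \<open>Pays for the negative term \<open>- q^6 * ((1 - q^2) * gap_min_pos 4)\<close>.
    In the recursion \<open>gap_min_pos 5\<close> and \<open>gap_min_pos 6\<close> are at most
    \<open>q^2\<close> and \<open>q^4\<close> times \<open>gap_min_pos 4\<close>, so
    \<open>q^10 q^2\<close> and \<open>q^9 q^4\<close> produce \<open>q^12 + q^13\<close>. Times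
    \<open>q^6\<close> this is the \<open>q^18 + q^19\<close> of the certificate.\<close>
  have rec4: "nonneg_fps (q ^ 9 + q ^ 10 + (q ^ 12 + q ^ 13) * gap_min_pos 4 - (1
      - q ^ 2) * gap_min_pos 4)"
  proof -
    have "(q ^ 9 + q ^ 10 + (q ^ 12 + q ^ 13) * gap_min_pos 4 - (1 - q ^ 2) * gap_min_pos 4)
        = (q ^ 9 + q ^ 10 + (q ^ 12 + q ^ 13 + q ^ 2) * gap_min_pos 4) - gap_min_pos 4"
      by (simp add: algebra_simps)
    also have "\<dots> = (q ^ 9 + q ^ 10 + (q ^ 12 + q ^ 13 + q ^ 2) * gap_min_pos 4)
        - (q ^ 9 + q ^ 10 + (1 + q ^ 10) * gap_min_pos 5 + q ^ 9 * gap_min_pos 6)"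
      using pos4 by simp
    also have "\<dots> = (1 + q ^ 10) * (q ^ 2 * gap_min_pos 4 - gap_min_pos 5)
        + q ^ 9 * (q ^ 4 * gap_min_pos 4 - gap_min_pos 6)"
      by algebra
    also have "nonneg_fps \<dots>"
      by (intro nonneg_fps_add nonneg_fps_mult pos_le nonneg_intros)
    finally show ?thesis .
  qed
  \<comment> \<open>\<open>y\<close> is what \<open>qpoch_sum 4\<close> turns into when each
    \<open>gap_min_pos (4 + i)\<close> is replaced by its bound
    \<open>q^(2 i) * gap_min_pos 4\<close>.\<close>
  have tail: "nonneg_fps (y * gap_min_pos 4 - (q ^ 20 * gap_min_pos 4 + e5 * gap_min_pos 5
      + e6 * gap_min_pos 6
      + e7 * gap_min_pos 7 + q ^ 28 * gap_min_pos 8))"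
  proof -
    have y_eq: "y = q ^ 20 + e5 * q ^ 2 + e6 * q ^ 4 + e7 * q ^ 6 + q ^ 28 * q ^ 8"
      unfolding y_def e5_def e6_def e7_def by algebra
    have "y * gap_min_pos 4 - (q ^ 20 * gap_min_pos 4 + e5 * gap_min_pos 5 + e6 * gap_min_pos 6
        + e7 * gap_min_pos 7 + q ^ 28 * gap_min_pos 8)
      = e5 * (q ^ 2 * gap_min_pos 4 - gap_min_pos 5) + e6 * (q ^ 4 * gap_min_pos 4 - gap_min_pos 6)
        + e7 * (q ^ 6 * gap_min_pos 4 - gap_min_pos 7) + q ^ 28 * (q ^ 8 * gap_min_pos 4
            - gap_min_pos 8)"
      unfolding y_eq by algebra
    also have "nonneg_fps \<dots>"
      unfolding e5_def e6_def e7_def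
      by (intro nonneg_fps_add nonneg_fps_mult pos_le nonneg_intros)
    finally show ?thesis .
  qed
  have first: "nonneg_fps ((geo 16 * (q ^ 2 + q ^ 10 + q ^ 12) + geo 8 * (q + q ^ 5 + q ^ 6) - q
      - geo 16 * q ^ 11)
      * gap_min_gf 0 - geo 8 * L * gap_min_gf 0)"
  proof -
    have g16: "geo 8 = geo 16 * (1 + q ^ 8)"
      using geo_cong[of 8 16 "1 + q ^ 8" 1] by (simp add: algebra_simps flip: power_add)
    have "((1 - q ^ 8) * geo 8) * q = q"
      unfolding g8 by simp
    then have "(geo 16 * (q ^ 2 + q ^ 10 + q ^ 12) + geo 8 * (q + q ^ 5 + q ^ 6) - q
        - geo 16 * q ^ 11) - geo 8 * L
        = geo 16 * (q ^ 2 + q ^ 10 + q ^ 12 - q ^ 11) + geo 8 * (q + q ^ 5 + q ^ 6 - (1 - q ^ 8) * q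
            - L)"
      by (simp add: algebra_simps)
    also have "\<dots> = geo 16 * (q ^ 2 + q ^ 10 + q ^ 12 - q ^ 11 + (1 + q ^ 8) * (q + q ^ 5
        + q ^ 6 - (1 - q ^ 8) * q - L))"
      unfolding g16 by algebra
    also have "q ^ 2 + q ^ 10 + q ^ 12 - q ^ 11 + (1 + q ^ 8) * (q + q ^ 5 + q ^ 6 - (1 - q ^ 8) * q
        - L) = q ^ 19 * (1 - q)"
      unfolding L_def by algebra
    finally have eq: "(geo 16 * (q ^ 2 + q ^ 10 + q ^ 12) + geo 8 * (q + q ^ 5 + q ^ 6) - q
        - geo 16 * q ^ 11)
        * gap_min_gf 0 - geo 8 * L * gap_min_gf 0 = geo 16 * q ^ 19 * ((1 - q) * gap_min_gf 0)"
      unfolding left_diff_distrib[symmetric] by (simp only: mult.assoc)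
    have "(1 - q) * gap_min_gf 0 = 1 + ((1 - q) * gap_min_pos 0 - q ^ (2 * 0 + 1))"
      unfolding gap_min_gf_eq by (simp add: algebra_simps)
    then have "nonneg_fps ((1 - q) * gap_min_gf 0)"
      using nonneg_fps_add[OF nonneg_fps_one gap_min_pos_increasing[of 0]] by metis
    then show ?thesis
      unfolding eq by (rule nonneg_fps_mult[OF nonneg_fps_mult[OF nonneg_fps_geo nonneg_fps_power[OF nonneg_fps_X]]])
  qed
  have upper: "nonneg_fps (geo 2 * qpoch_sum 1 + geo 4 * qpoch_sum 2 + geo 6 * fsum qpoch3_div
     + qpoch_sum 4 + top - ?parts)"
    unfolding top_def by (rule gap_gf_parts_upper)
  have sum4: "qpoch_sum 4 = (q ^ 20 + e5 + e6 + e7 + q ^ 28)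
      + (q ^ 20 * gap_min_pos 4 + e5 * gap_min_pos 5 + e6 * gap_min_pos 6
      + e7 * gap_min_pos 7 + q ^ 28 * gap_min_pos 8)"
    unfolding qpoch_sum_4 gap_min_gf_eq e5_def e6_def e7_def by algebra
  \<comment> \<open>The growth exponent 37 is 26 + 11, where 11 is the least part counted by
    \<open>gap_min_pos 5\<close>.\<close>
  have q_split: "(q ^ 18 + q ^ 19) * z = q ^ 6 * ((q ^ 12 + q ^ 13) * z)"
      "q ^ 37 * (geo 8 * geo 1) = geo 8 * q ^ 26 * (q ^ (2 * 5 + 1) * geo 1)" for z
    by (simp_all add: algebra_simps flip: power_add)
  define A where "A = (geo 16 * (q ^ 2 + q ^ 10 + q ^ 12) + geo 8 * (q + q ^ 5 + q ^ 6) - q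
      - geo 16 * q ^ 11)
      * gap_min_gf 0 - geo 8 * L * gap_min_gf 0"
  define B where "B = geo 2 * qpoch_sum 1 + geo 4 * qpoch_sum 2 + geo 6 * fsum qpoch3_div
      + qpoch_sum 4 + top - ?parts"
  define C where "C = (G * a + geo 8 * b + geo 6 * c) * ((1 - q) * gap_min_pos 4)"
  define D where "D = q ^ 9 + q ^ 10 + (q ^ 12 + q ^ 13) * gap_min_pos 4 - (1 - q ^ 2) * gap_min_pos 4"
  define E where "E = y * gap_min_pos 4 - (q ^ 20 * gap_min_pos 4 + e5 * gap_min_pos 5
      + e6 * gap_min_pos 6
      + e7 * gap_min_pos 7 + q ^ 28 * gap_min_pos 8)"
  define H where "H = G * m * ((1 - q) * gap_min_pos 5)"
  define K where "K = gap_min_pos 5 - q ^ (2 * 5 + 1) * geo 1"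
  have bd_eq: "bd = G * (1 - q ^ 2) * (p4 + p5) - (q ^ 20 + e5 + e6 + e7 + q ^ 28) - top
      - q ^ 6 * (q ^ 9 + q ^ 10)"
    unfolding bd_def G24[symmetric] by (simp only: ac_simps)
  have "?F = A + B + (V - qpoch_sum 4 - top)"
    unfolding A_def B_def V_def by simp
  also have "V - qpoch_sum 4 - top = bd + C + q ^ 6 * D + E + H + geo 8 * q ^ 26 * gap_min_pos 5"
    unfolding V sum4 bd_eq C_def D_def E_def H_def q_split(1) by algebra
  finally have eq: "?F - (bd + q ^ 37 * (geo 8 * geo 1)) = A + B + C + q ^ 6 * D + E + H
      + geo 8 * q ^ 26 * K"
    unfolding K_def q_split(2) by (simp add: right_diff_distrib)
  have "nonneg_fps a" "nonneg_fps b" "nonneg_fps c" "nonneg_fps m" "nonneg_fps G"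
    unfolding a_def b_def c_def m_def G_def by (intro nonneg_intros)+
  then have "nonneg_fps (G * a + geo 8 * b + geo 6 * c)" "nonneg_fps (G * m)"
    by (simp_all add: nonneg_intros)
  then have "nonneg_fps C" "nonneg_fps H"
    unfolding C_def H_def by (auto intro: nonneg_fps_mult[OF _ nonneg_one_minus_gap_min_pos])
  moreover have "nonneg_fps A" "nonneg_fps B" "nonneg_fps D" "nonneg_fps E" "nonneg_fps K"
    using first upper rec4 tail gap_min_pos_ge_geo[of 5] by (simp_all only: A_def B_def D_def E_def K_def)
  ultimately have "nonneg_fps (?F - (bd + q ^ 37 * (geo 8 * geo 1)))"
    unfolding eq by (intro nonneg_fps_add nonneg_fps_mult nonneg_fps_geo nonneg_fps_power nonneg_fps_X)
  moreover have "bounded_fps bd"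
  proof -
    have "qpoch 4 4 * gap_gf 4 = (\<Prod>j<4. gap_ratio j)"
      using qpoch_gap_gf_shift[of 4 0] by simp
    then have "bounded_fps top"
      unfolding top_def gap_ratio_def by (simp only:) (intro bounded_multiplier_mult_geo bounded_intros)
    moreover have "bounded_fps ((1 - q ^ 2 + q ^ 6 - q ^ 10 + q ^ 12) * (p4 + p5) * geo 24)"
      unfolding p4_def p5_def by (intro bounded_multiplier_mult_geo bounded_intros)
    moreover have "bounded_fps (q ^ 20 + e5 + e6 + e7 + q ^ 28)" and "bounded_fps (q ^ 6 * (q ^ 9
        + q ^ 10))"
      unfolding e5_def e6_def e7_def by (intro bounded_multiplier_imp_bounded bounded_intros)+
    ultimately show ?thesis
      unfolding bd_def by (intro bounded_fps_diff)
  qed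
  ultimately show ?thesis
    by (intro eventually_positive[of bd 8]) simp_all
qed

section \<open>The little Goellnitz identity\<close>

text \<open>Congruence modulo \<open>q^m\<close>. Infinite products are thereby replaced by finite
  ones that are long enough for the required precision.\<close>

definition agree :: "nat \<Rightarrow> real fps \<Rightarrow> real fps \<Rightarrow> bool" where
  "agree m f g \<longleftrightarrow> (\<forall>n<m. f $ n = g $ n)"

lemma agree_refl: "agree m f f"
  by (simp add: agree_def)

lemma agree_trans [trans]: "agree m f g \<Longrightarrow> agree m g h \<Longrightarrow> agree m f h"
  by (simp add: agree_def)

lemma agree_mult: "agree m f g \<Longrightarrow> agree m (h * f) (h * g)"
  unfolding agree_def fps_mult_nth by (auto intro!: sum.cong)

lemma agree_fsum: "(\<And>N. agree m (f N) (g N)) \<Longrightarrow> agree m (fsum f) (fsum g)"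
  by (simp add: agree_def fsum_def)

lemma agree_plus_power: "m \<le> a \<Longrightarrow> agree m (f + q ^ a * g) f"
  by (simp add: agree_def fps_X_power_mult_nth)

lemma agree_one_plus_power: "m \<le> a \<Longrightarrow> agree m ((1 + q ^ a) * f) f"
  using agree_plus_power[of m a f f] by (simp add: algebra_simps)

lemma agree_one_minus_power: "m \<le> a \<Longrightarrow> agree m ((1 - q ^ a) * f) f"
  using agree_plus_power[of m a f "- f"] by (simp add: algebra_simps)

lemma agree_prod_one_plus:
  assumes "\<And>i. i \<in> I \<Longrightarrow> m \<le> a i"
  shows "agree m ((\<Prod>i\<in>I. 1 + q ^ a i) * f) f"
  using assms
proof (induction I rule: infinite_finite_induct)
  case (insert i I)
  then have "agree m ((1 + q ^ a i) * ((\<Prod>i\<in>I. 1 + q ^ a i) * f)) f"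
    by (intro agree_trans[OF agree_one_plus_power]) auto
  then show ?case
    using insert by (simp add: mult.assoc)
qed (simp_all add: agree_refl)

lemma agree_prod_one_minus:
  assumes "\<And>i. i \<in> I \<Longrightarrow> m \<le> a i"
  shows "agree m ((\<Prod>i\<in>I. 1 - q ^ a i) * f) f"
  using assms
proof (induction I rule: infinite_finite_induct)
  case (insert i I)
  then have "agree m ((1 - q ^ a i) * ((\<Prod>i\<in>I. 1 - q ^ a i) * f)) f"
    by (intro agree_trans[OF agree_one_minus_power]) auto
  then show ?case
    using insert by (simp add: mult.assoc)
qed (simp_all add: agree_refl)

lemma agree_cancel:
  assumes "agree m (u * f) (u * g)" and "h * u = 1"
  shows "agree m f g"
  using agree_mult[OF assms(1), of h] assms(2) by (simp flip: mult.assoc)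

section \<open>Distinct even parts and Lebesgue's identity\<close>

primrec even_gf :: "nat \<Rightarrow> real fps" where
  "even_gf 0 = 1"
| "even_gf (Suc n) = geo (2 * n + 2) * (q ^ (2 * n + 2) * even_gf n)"

declare even_gf.simps(2) [simp del]

lemma even_gf_Suc: "(1 - q ^ (2 * n + 2)) * even_gf (Suc n) = q ^ (2 * n + 2) * even_gf n"
proof -
  have "(1 - q ^ (2 * n + 2)) * geo (2 * n + 2) = 1"
    by (rule geo_mult) simp
  then show ?thesis
    unfolding even_gf.simps(2) mult.assoc[symmetric] by simp
qed

lemma graded_even_gf: "graded even_gf"
  unfolding graded_def
proof
  fix N show "q ^ N dvd even_gf N"
  proof (induction N)
    case (Suc N)
    have "q * q ^ N dvd q ^ (2 * N + 2) * even_gf N"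
      using Suc by (intro mult_dvd_mono) (auto simp: dvd_power)
    then show ?case
      unfolding even_gf.simps(2) power_Suc by (rule dvd_mult)
  qed simp
qed

lemma graded_even_gf_mult: "graded (\<lambda>N. f N * even_gf N)"
  by (rule graded_mult[OF graded_even_gf])

lemma graded_even_gf_Suc_mult: "graded (\<lambda>N. f N * even_gf (Suc N))"
  using graded_mult[OF graded_shift[OF graded_even_gf, of 1]] by simp

text \<open>\<open>even_gf n\<close> is
  \<open>q^(n (n + 1)) / ((1 - q^2) ... (1 - q^(2 n)))\<close>, the series of partitions into
  \<open>n\<close> distinct even parts, and the weight raises each part by \<open>2 k\<close>. The
  recursion below reflects whether \<open>2 k + 2\<close> is a part.\<close>

definition even_min_gf :: "nat \<Rightarrow> real fps" where
  "even_min_gf k = fsum (\<lambda>n. q ^ (2 * k * n) * even_gf n)"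

lemma even_min_gf_rec: "even_min_gf k = (1 + q ^ (2 * k + 2)) * even_min_gf (Suc k)"
proof -
  have "even_min_gf k - even_min_gf (Suc k) = fsum (\<lambda>n. (q ^ (2 * k * n) * (1
      - q ^ (2 * n))) * even_gf n)"
    unfolding even_min_gf_def fsum_diff[symmetric]
    by (rule arg_cong[of _ _ fsum]) (simp add: fun_eq_iff algebra_simps power_add)
  also have "\<dots> = fsum (\<lambda>n. q ^ (2 * k * Suc n) * ((1 - q ^ (2 * n
      + 2)) * even_gf (Suc n)))"
    by (subst fsum_Suc[OF graded_even_gf_mult]) (simp add: mult.assoc)
  also have "\<dots> = fsum (\<lambda>n. q ^ (2 * k + 2) * (q ^ (2 * Suc k * n) * even_gf n))"
    unfolding even_gf_Suc
    by (rule arg_cong[of _ _ fsum]) (simp add: fun_eq_iff algebra_simps power_add)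
  also have "\<dots> = q ^ (2 * k + 2) * even_min_gf (Suc k)"
    unfolding even_min_gf_def by (rule fsum_mult[OF graded_even_gf_mult])
  finally show ?thesis
    by (simp add: algebra_simps)
qed

lemma even_min_gf_0: "even_min_gf 0 = (\<Prod>k<K. 1 + q ^ (2 * k + 2)) * even_min_gf K"
proof (induction K)
  case (Suc K)
  then show ?case
    using even_min_gf_rec[of K] by (simp add: mult.assoc)
qed simp

lemma agree_even_min_gf: "agree (2 * K) (even_min_gf K) 1"
proof -
  have "even_min_gf K = 1 + fsum (\<lambda>n. q ^ (2 * K * Suc n) * even_gf (Suc n))"
    unfolding even_min_gf_def by (subst fsum_Suc[OF graded_even_gf_mult]) simp
  also have "fsum (\<lambda>n. q ^ (2 * K * Suc n) * even_gf (Suc n))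
      = fsum (\<lambda>n. q ^ (2 * K) * (q ^ (2 * K * n) * even_gf (Suc n)))"
    by (simp add: power_add mult.assoc)
  also have "\<dots> = q ^ (2 * K) * fsum (\<lambda>n. q ^ (2 * K * n) * even_gf (Suc n))"
    by (rule fsum_mult[OF graded_even_gf_Suc_mult])
  finally show ?thesis
    using agree_plus_power by simp
qed

text \<open>\<open>q\<close> times the summand
  \<open>q^(n (n + 1)) (-q^(4 i - 1); q^2)_n / (q^2; q^2)_n\<close>. The extra \<open>q\<close> is
  merged with the first factor \<open>1 + q^(4 i - 1)\<close>, whose exponent is -1 at
  \<open>i = 0\<close>, the case of the little Goellnitz series.\<close>

definition lebesgue_term :: "nat \<Rightarrow> nat \<Rightarrow> real fps" where
  "lebesgue_term i n = (case n of 0 \<Rightarrow> q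
     | Suc m \<Rightarrow> (q + q ^ (4 * i)) * (\<Prod>j<m. 1 + q ^ (4 * i + 1
         + 2 * j)) * even_gf (Suc m))"

definition lebesgue_flow :: "nat \<Rightarrow> nat \<Rightarrow> real fps" where
  "lebesgue_flow i m = q ^ (4 * i + 2 * m + 2) * (\<Prod>j<m. 1 + q ^ (4 * i + 1 + 2 * j)) * even_gf m"

lemma lebesgue_term_0: "lebesgue_term 0 n = q * gap_gf n"
proof (cases n)
  case (Suc m)
  have "lebesgue_term 0 (Suc m) = q * gap_gf (Suc m)" for m
  proof (induction m)
    case 0
    show ?case
      by (simp add: lebesgue_term_def even_gf.simps(2) gap_gf.simps(2) gap_ratio_def algebra_simps
          numeral_2_eq_2)
  next
    case (Suc m)
    have "lebesgue_term 0 (Suc (Suc m))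
        = geo (2 * Suc m + 2) * (q ^ (2 * Suc m + 2) * (1 + q ^ (1 + 2 * m)) * lebesgue_term 0 (Suc m))"
      by (simp add: lebesgue_term_def even_gf.simps(2)[of "Suc m"] ac_simps)
    also have "q ^ (2 * Suc m + 2) * (1 + q ^ (1 + 2 * m)) = gap_ratio (Suc m)"
      by (simp add: gap_ratio_def algebra_simps power_add eval_nat_numeral)
    also have "geo (2 * Suc m
        + 2) * (gap_ratio (Suc m) * lebesgue_term 0 (Suc m)) = q * gap_gf (Suc (Suc m))"
      unfolding Suc gap_gf.simps(2)[of "Suc m"] by (simp only: ac_simps)
    finally show ?case .
  qed
  then show ?thesis using Suc by simp
qed (simp add: lebesgue_term_def)

text \<open>The \<^term>\<open>lebesgue_flow\<close> terms telescope, which is Lebesgue's functional equation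
  \<open>L(a) = (1 + a x\<^sup>2) L(a x\<^sup>2)\<close> with \<open>x = q\<^sup>2\<close>.\<close>
lemma lebesgue_telescope:
  "lebesgue_term i n - (1 + q ^ (4 * i + 1)) * lebesgue_term (Suc i) n
    = (case n of 0 \<Rightarrow> 0 | Suc m \<Rightarrow> lebesgue_flow i m) - lebesgue_flow i n"
proof (cases n)
  case 0
  then show ?thesis
    by (simp add: lebesgue_term_def lebesgue_flow_def algebra_simps)
next
  case (Suc m)
  define P where "P = (\<Prod>j<m. 1 + q ^ (4 * i + 1 + 2 * j))"
  define a where "a = q ^ (4 * i + 1 + 2 * m)"
  define b where "b = q ^ (4 * i + 1 + 2 * Suc m)"
  have P2: "(\<Prod>j<Suc (Suc m). 1 + q ^ (4 * i + 1 + 2 * j))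
      = (1 + q ^ (4 * i + 1)) * ((1 + q ^ (4 * i + 3)) * (\<Prod>j<m. 1 + q ^ (4 * Suc i + 1 + 2 * j)))"
    unfolding prod.lessThan_Suc_shift by (simp add: eval_nat_numeral)
  have "(1 + q ^ (4 * i + 1)) * lebesgue_term (Suc i) n
      = q * ((1 + q ^ (4 * i + 1)) * ((1 + q ^ (4 * i + 3)) * (\<Prod>j<m. 1 + q ^ (4 * Suc i + 1
          + 2 * j)))) * even_gf (Suc m)"
    using Suc by (simp add: lebesgue_term_def algebra_simps power_add eval_nat_numeral)
  also have "\<dots> = q * (P * (1 + a) * (1 + b)) * even_gf (Suc m)"
    unfolding P2[symmetric] by (simp add: P_def a_def b_def)
  finally have step: "(1 + q ^ (4 * i + 1)) * lebesgue_term (Suc i) n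
    = q * (P * (1 + a) * (1 + b)) * even_gf (Suc m)" .
  have flow_m: "lebesgue_flow i m = q ^ (4 * i) * P * ((1 - q ^ (2 * m + 2)) * even_gf (Suc m))"
    unfolding even_gf_Suc lebesgue_flow_def P_def[symmetric] by (simp add: power_add ac_simps)
  have flow_n: "lebesgue_flow i n = q * b * (P * (1 + a)) * even_gf (Suc m)"
    using Suc by (simp add: lebesgue_flow_def P_def a_def b_def ac_simps)
  \<comment> \<open>By this relation \<open>q - q (1 + a) (1 + b)\<close> contains
    \<open>- q^(4 i) q^(2 m + 2)\<close>, which joins \<open>q^(4 i)\<close> to form the denominator
    \<open>1 - q^(2 m + 2)\<close> of \<open>even_gf (Suc m)\<close>.\<close>
  have "q * a = q ^ (4 * i) * q ^ (2 * m + 2)"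
    unfolding a_def by (simp add: power_add ac_simps eval_nat_numeral)
  then have "(q + q ^ (4 * i)) - q * ((1 + a) * (1 + b))
      = q ^ (4 * i) * (1 - q ^ (2 * m + 2)) - q * b * (1 + a)"
    by (simp add: algebra_simps)
  then have key: "((q + q ^ (4 * i)) - q * ((1 + a) * (1 + b))) * (P * even_gf (Suc m))
      = (q ^ (4 * i) * (1 - q ^ (2 * m + 2)) - q * b * (1 + a)) * (P * even_gf (Suc m))"
    by simp
  have "lebesgue_term i n = (q + q ^ (4 * i)) * P * even_gf (Suc m)"
    using Suc by (simp add: lebesgue_term_def P_def)
  then have "lebesgue_term i n - (1 + q ^ (4 * i + 1)) * lebesgue_term (Suc i) n
      = ((q + q ^ (4 * i)) - q * ((1 + a) * (1 + b))) * (P * even_gf (Suc m))"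
    unfolding step by (simp add: algebra_simps)
  also have "\<dots> = lebesgue_flow i m - lebesgue_flow i n"
    unfolding key flow_m flow_n by (simp only: ring_distribs ac_simps)
  finally show ?thesis
    using Suc by simp
qed

lemma graded_lebesgue_term: "graded (lebesgue_term i)"
  unfolding graded_def
proof
  fix n show "q ^ n dvd lebesgue_term i n"
  proof (cases n)
    case (Suc m)
    then show ?thesis
      using graded_even_gf unfolding graded_def lebesgue_term_def by (auto intro: dvd_mult simp del: power_Suc)
  qed simp
qed

lemma lebesgue_rec: "fsum (lebesgue_term i) = (1 + q ^ (4 * i + 1)) * fsum (lebesgue_term (Suc i))"
proof -
  let ?prev = "\<lambda>n. case n of 0 \<Rightarrow> 0 | Suc m \<Rightarrow> lebesgue_flow i m"
  have "graded ?prev"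
    unfolding graded_def
  proof
    fix n show "q ^ n dvd ?prev n"
    proof (cases n)
      case (Suc m)
      have "q * q ^ m dvd q ^ (4 * i + 2 * m + 2) * even_gf m"
        using graded_even_gf by (intro mult_dvd_mono) (auto simp: dvd_power graded_def)
      then have "q ^ Suc m dvd (\<Prod>j<m. 1 + q ^ (4 * i + 1 + 2 * j)) * (q ^ (4 * i + 2 * m
          + 2) * even_gf m)"
        unfolding power_Suc by (rule dvd_mult)
      then show ?thesis
        using Suc unfolding lebesgue_flow_def by (simp only: ac_simps nat.case)
    qed simp
  qed
  from fsum_Suc[OF this] have "fsum ?prev = fsum (lebesgue_flow i)"
    by simp
  then have "fsum (\<lambda>n. lebesgue_term i n - (1 + q ^ (4 * i + 1)) * lebesgue_term (Suc i) n) = 0"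
    unfolding lebesgue_telescope fsum_diff by simp
  then show ?thesis
    unfolding fsum_diff fsum_mult[OF graded_lebesgue_term] by simp
qed

lemma lebesgue_prod: "fsum (lebesgue_term 0) = (\<Prod>i<I. 1 + q ^ (4 * i
    + 1)) * fsum (lebesgue_term I)"
proof (induction I)
  case (Suc I)
  then show ?case
    using lebesgue_rec[of I] by (simp add: mult.assoc)
qed simp

text \<open>Every power of \<open>q\<close> that involves \<open>i\<close> has exponent at least
  \<open>4 i\<close>. This is the limit that ends the iteration of the functional equation.\<close>

lemma agree_lebesgue_term: "agree (4 * i) (lebesgue_term i n) (q * even_gf n)"
proof (cases n)
  case (Suc m)
  define P where "P = (\<Prod>j<m. 1 + q ^ (4 * i + 1 + 2 * j))"
  have "lebesgue_term i n = P * (q * even_gf n) + q ^ (4 * i) * (P * even_gf n)"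
    using Suc by (simp add: lebesgue_term_def P_def algebra_simps)
  also have "agree (4 * i) \<dots> (P * (q * even_gf n))"
    by (rule agree_plus_power) simp
  also have "agree (4 * i) \<dots> (q * even_gf n)"
    unfolding P_def by (rule agree_prod_one_plus) simp
  finally show ?thesis .
qed (simp add: lebesgue_term_def agree_refl)

lemma gap_min_gf_agree_prod:
  "agree (8 * i) (q * gap_min_gf 0) ((\<Prod>j<2 * i. 1 + q ^ (4 * j + 1)) * (q * (\<Prod>k<4 * i. 1
      + q ^ (2 * k + 2))))"
proof -
  have "q * gap_min_gf 0 = fsum (\<lambda>n. q * gap_gf n)"
    unfolding gap_min_gf_def fsum_mult[OF graded_gap_gf] by simp
  also have "\<dots> = (\<Prod>j<2 * i. 1 + q ^ (4 * j + 1)) * fsum (lebesgue_term (2 * i))"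
    unfolding lebesgue_term_0[symmetric] by (rule lebesgue_prod)
  also have "agree (8 * i) \<dots> ((\<Prod>j<2 * i. 1 + q ^ (4 * j
      + 1)) * fsum (\<lambda>n. q * even_gf n))"
    using agree_lebesgue_term[of "2 * i"] by (intro agree_mult agree_fsum) simp
  also have "fsum (\<lambda>n. q * even_gf n) = q * even_min_gf 0"
    unfolding even_min_gf_def fsum_mult[OF graded_even_gf] by simp
  also have "(\<Prod>j<2 * i. 1 + q ^ (4 * j + 1)) * (q * even_min_gf 0)
      = ((\<Prod>j<2 * i. 1 + q ^ (4 * j + 1)) * (q * (\<Prod>k<4 * i. 1 + q ^ (2 * k
          + 2)))) * even_min_gf (4 * i)"
    unfolding even_min_gf_0[of "4 * i"] by (simp only: mult.assoc)
  also have "agree (8 * i) \<dots> (((\<Prod>j<2 * i. 1 + q ^ (4 * j + 1)) * (q * (\<Prod>k<4 * i. 1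
      + q ^ (2 * k + 2)))) * 1)"
    using agree_even_min_gf[of "4 * i"] by (intro agree_mult) simp
  finally show ?thesis
    by simp
qed

text \<open>A finite form, in \<open>q^2\<close>, of Euler's theorem on odd and distinct parts:
  \<open>1 + y = (1 - y^2) / (1 - y)\<close> for \<open>y = q^(2 k + 2)\<close>, with the
  denominators multiplied out and sorted into exponents \<open>4 j + 2\<close> and
  \<open>4 k + 4\<close>.\<close>

lemma euler_odd_distinct:
  "(\<Prod>j<n. 1 - q ^ (4 * j + 2)) * (\<Prod>k<2 * n. 1 + q ^ (2 * k + 2)) * (\<Prod>k<n. 1
      - q ^ (4 * k + 4))
    = (\<Prod>k<2 * n. 1 - q ^ (4 * k + 4))"
proof (induction n)
  case (Suc n)
  have "(1 - q ^ (4 * n + 2)) * ((1 + q ^ (4 * n + 2)) * (1 + q ^ (4 * n + 4))) * (1 - q ^ (4 * n + 4))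
      = (1 - (q ^ (4 * n + 2)) ^ 2) * (1 - (q ^ (4 * n + 4)) ^ 2)"
    by (simp add: algebra_simps power2_eq_square)
  also have "\<dots> = (1 - q ^ (8 * n + 4)) * (1 - q ^ (8 * n + 8))"
  proof -
    have "(4 * n + 2) * 2 = 8 * n + 4" and "(4 * n + 4) * 2 = 8 * n + 8"
      by simp_all
    then show ?thesis
      unfolding power_mult[symmetric] by (simp only:)
  qed
  finally have step: "(1 - q ^ (4 * n + 2)) * ((1 + q ^ (4 * n + 2)) * (1 + q ^ (4 * n + 4))) * (1
      - q ^ (4 * n + 4))
      = (1 - q ^ (8 * n + 4)) * (1 - q ^ (8 * n + 8))" .
  have "(\<Prod>j<Suc n. 1 - q ^ (4 * j + 2)) * (\<Prod>k<2 * Suc n. 1 + q ^ (2 * k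
      + 2)) * (\<Prod>k<Suc n. 1 - q ^ (4 * k + 4))
      = ((\<Prod>j<n. 1 - q ^ (4 * j + 2)) * (\<Prod>k<2 * n. 1 + q ^ (2 * k + 2)) * (\<Prod>k<n. 1
          - q ^ (4 * k + 4)))
        * ((1 - q ^ (4 * n + 2)) * ((1 + q ^ (4 * n + 2)) * (1 + q ^ (4 * n + 4))) * (1 - q ^ (4 * n
            + 4)))"
  proof -
    have e: "2 * Suc n = Suc (Suc (2 * n))" "2 * (2 * n) + 2 = 4 * n + 2" "2 * Suc (2 * n)
        + 2 = 4 * n + 4"
      by simp_all
    show ?thesis
      unfolding e prod.lessThan_Suc by (simp only: ac_simps)
  qed
  also have "\<dots> = (\<Prod>k<2 * Suc n. 1 - q ^ (4 * k + 4))"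
  proof -
    have e: "2 * Suc n = Suc (Suc (2 * n))" "4 * (2 * n) + 4 = 8 * n + 4" "4 * Suc (2 * n)
        + 4 = 8 * n + 8"
      by simp_all
    show ?thesis
      unfolding Suc step unfolding e prod.lessThan_Suc e by (simp only: ac_simps)
  qed
  finally show ?case .
qed simp

lemma agree_even_distinct_prod:
  "agree (4 * n) ((\<Prod>j<n. 1 - q ^ (4 * j + 2)) * (\<Prod>k<2 * n. 1 + q ^ (2 * k + 2))) 1"
proof (rule agree_cancel)
  let ?u = "\<Prod>k<n. 1 - q ^ (4 * k + 4)"
  have "(\<Prod>k<2 * n. 1 - q ^ (4 * k + 4)) = (\<Prod>k\<in>{n..<2 * n}. 1 - q ^ (4 * k + 4)) * ?u"
    by (subst prod.union_disjoint[symmetric]) (auto intro!: prod.cong)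
  then have "agree (4 * n) (\<Prod>k<2 * n. 1 - q ^ (4 * k + 4)) ?u"
    using agree_prod_one_minus[of "{n..<2 * n}" "4 * n" "\<lambda>k. 4 * k + 4" ?u] by simp
  then show "agree (4 * n) (?u * ((\<Prod>j<n. 1 - q ^ (4 * j + 2)) * (\<Prod>k<2 * n. 1
      + q ^ (2 * k + 2)))) (?u * 1)"
    using euler_odd_distinct[of n] by (simp add: ac_simps)
  show "(\<Prod>k<n. geo (4 * k + 4)) * ?u = 1"
    unfolding prod.distrib[symmetric]
  proof (rule prod.neutral, rule ballI)
    fix k show "geo (4 * k + 4) * (1 - q ^ (4 * k + 4)) = 1"
      by (subst mult.commute) (rule geo_mult, simp)
  qed
qed

text \<open>The factors \<open>1 - q^(4 j + 1)\<close> turn \<open>1 + q^(4 j + 1)\<close> into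
  \<open>1 - q^(8 j + 2)\<close>. Together with \<open>1 - q^(8 j + 6)\<close> these run through
  \<open>1 - q^(4 j + 2)\<close>, which cancel the distinct even parts by Euler's theorem. The
  common factor \<open>q\<close> stems from \<open>lebesgue_term\<close>.\<close>

lemma little_goellnitz_product:
  "agree (8 * i) (q * ((\<Prod>j<2 * i. 1 - q ^ (4 * j + 1)) * (\<Prod>j<i. 1 - q ^ (8 * j
      + 6)) * gap_min_gf 0)) q"
proof -
  let ?A = "\<Prod>j<2 * i. 1 - q ^ (4 * j + 1)" and ?B = "\<Prod>j<i. 1 - q ^ (8 * j + 6)"
  let ?C = "\<Prod>j<2 * i. 1 + q ^ (4 * j + 1)" and ?D = "\<Prod>k<4 * i. 1 + q ^ (2 * k + 2)"
  have AC: "?A * ?C = (\<Prod>j\<in>{i..<2 * i}. 1 - q ^ (8 * j + 2)) * (\<Prod>j<i. 1 - q ^ (8 * j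
      + 2))"
  proof -
    have "(1 - q ^ (4 * j + 1)) * (1 + q ^ (4 * j + 1)) = 1 - q ^ (8 * j + 2)" for j
    proof -
      have "(1 - q ^ (4 * j + 1)) * (1 + q ^ (4 * j + 1)) = 1 - (q ^ (4 * j + 1)) ^ 2"
        by (simp add: algebra_simps power2_eq_square)
      also have "\<dots> = 1 - q ^ (8 * j + 2)"
        unfolding power_mult[symmetric] by (simp add: algebra_simps)
      finally show ?thesis .
    qed
    then have "?A * ?C = (\<Prod>j<2 * i. 1 - q ^ (8 * j + 2))"
      unfolding prod.distrib[symmetric] by simp
    also have "\<dots> = (\<Prod>j\<in>{i..<2 * i}. 1 - q ^ (8 * j + 2)) * (\<Prod>j<i. 1
        - q ^ (8 * j + 2))"
      by (subst prod.union_disjoint[symmetric]) (auto intro!: prod.cong)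
    finally show ?thesis .
  qed
  have merge: "(\<Prod>j<i. 1 - q ^ (8 * j + 2)) * (\<Prod>j<i. 1 - q ^ (8 * j
      + 6)) = (\<Prod>j<2 * i. 1 - q ^ (4 * j + 2))" for i
  proof (induction i)
    case (Suc i)
    have e: "2 * Suc i = Suc (Suc (2 * i))" "4 * (2 * i) + 2 = 8 * i + 2" "4 * Suc (2 * i)
        + 2 = 8 * i + 6"
      by simp_all
    have "(\<Prod>j<Suc i. 1 - q ^ (8 * j + 2)) * (\<Prod>j<Suc i. 1 - q ^ (8 * j + 6))
        = ((\<Prod>j<i. 1 - q ^ (8 * j + 2)) * (\<Prod>j<i. 1 - q ^ (8 * j + 6)))
          * ((1 - q ^ (8 * i + 2)) * (1 - q ^ (8 * i + 6)))"
      unfolding prod.lessThan_Suc by (simp only: ac_simps)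
    also have "\<dots> = (\<Prod>j<2 * Suc i. 1 - q ^ (4 * j + 2))"
      unfolding Suc unfolding e prod.lessThan_Suc e by (simp only: ac_simps)
    finally show ?case .
  qed simp
  have "agree (8 * i) ((?A * ?B) * (q * gap_min_gf 0)) ((?A * ?B) * (?C * (q * ?D)))"
    by (rule agree_mult[OF gap_min_gf_agree_prod])
  also have "(?A * ?B) * (?C * (q * ?D)) = (?A * ?C) * (?B * (q * ?D))"
    by (simp only: ac_simps)
  also have "\<dots> = (\<Prod>j\<in>{i..<2 * i}. 1 - q ^ (8 * j + 2)) * (((\<Prod>j<i. 1
      - q ^ (8 * j + 2)) * ?B) * (q * ?D))"
    unfolding AC by (simp only: ac_simps)
  also have "agree (8 * i) \<dots> (((\<Prod>j<i. 1 - q ^ (8 * j + 2)) * ?B) * (q * ?D))"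
    by (rule agree_prod_one_minus) simp
  also have "((\<Prod>j<i. 1 - q ^ (8 * j + 2)) * ?B) * (q * ?D) = q * ((\<Prod>j<2 * i. 1
      - q ^ (4 * j + 2)) * ?D)"
    unfolding merge by (simp only: ac_simps)
  also have "agree (8 * i) \<dots> (q * 1)"
    using agree_even_distinct_prod[of "2 * i"] by (intro agree_mult) simp
  finally show ?thesis
    by (simp add: ac_simps)
qed

section \<open>Partitions into parts congruent to 1, 5 or 6 modulo 8\<close>

definition part_multisets :: "nat set \<Rightarrow> nat \<Rightarrow> nat multiset set" where
  "part_multisets S n = {M. set_mset M \<subseteq> S \<and> \<Sum>\<^sub># M = n}"

definition parts_gf :: "nat set \<Rightarrow> real fps" where
  "parts_gf S = Abs_fps (\<lambda>n. real (card (part_multisets S n)))"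

lemma bij_betw_mset_partitions:
  assumes "0 \<notin> S"
  shows "bij_betw mset {lam \<in> partitions n. set lam \<subseteq> S} (part_multisets S n)"
proof (rule bij_betwI[where g = "\<lambda>M. rev (sorted_list_of_multiset M)"])
  show "mset \<in> {lam \<in> partitions n. set lam \<subseteq> S} \<rightarrow> part_multisets S n"
    by (auto simp: partitions_def part_multisets_def sum_mset_sum_list)
  show "(\<lambda>M. rev (sorted_list_of_multiset M)) \<in> part_multisets S n \<rightarrow> {lam \<in> partitions n. set lam \<subseteq> S}"
  proof
    fix M assume M: "M \<in> part_multisets S n"
    have "sum_list (sorted_list_of_multiset M) = \<Sum>\<^sub># M"
      by (metis mset_sorted_list_of_multiset sum_mset_sum_list)
    moreover have "0 < p" if "p \<in># M" for p
      using M that assms unfolding part_multisets_def by (metis (mono_tags) gr0I mem_Collect_eq subsetD)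
    ultimately show "rev (sorted_list_of_multiset M) \<in> {lam \<in> partitions n. set lam \<subseteq> S}"
      using M sorted_sorted_list_of_multiset[of M]
      by (auto simp: partitions_def part_multisets_def sorted_wrt_rev)
  qed
  show "rev (sorted_list_of_multiset (mset lam)) = lam" if "lam \<in> {lam \<in> partitions n. set lam \<subseteq> S}" for lam
  proof -
    have "sorted (rev lam)"
      using that by (simp add: partitions_def sorted_wrt_rev)
    then have "sorted_list_of_multiset (mset (rev lam)) = rev lam"
      by (simp only: sorted_list_of_multiset_mset sort_key_id_if_sorted map_ident)
    then show ?thesis by simp
  qed
  show "mset (rev (sorted_list_of_multiset M)) = M" for M
    by simp
qed

lemma finite_part_multisets: "0 \<notin> S \<Longrightarrow> finite (part_multisets S n)"
  using bij_betw_finite[OF bij_betw_mset_partitions] finite_partitions by simp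

lemma card_part_multisets_containing:
  assumes "set_mset A \<subseteq> S"
  shows "card {M \<in> part_multisets S n. A \<subseteq># M}
    = (if \<Sum>\<^sub># A \<le> n then card (part_multisets S (n - \<Sum>\<^sub># A)) else 0)"
proof (cases "\<Sum>\<^sub># A \<le> n")
  case True
  have "bij_betw (\<lambda>M. M + A) (part_multisets S (n
      - \<Sum>\<^sub># A)) {M \<in> part_multisets S n. A \<subseteq># M}"
  proof (rule bij_betwI[where g = "\<lambda>M. M - A"])
    show "(\<lambda>M. M
        - A) \<in> {M \<in> part_multisets S n. A \<subseteq># M} \<rightarrow> part_multisets S (n
        - \<Sum>\<^sub># A)"
      by (auto simp: part_multisets_def sum_mset_diff dest: in_diffD)
  qed (use assms True in \<open>auto simp: part_multisets_def\<close>)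
  then show ?thesis
    using True by (simp add: bij_betw_same_card)
next
  case False
  have "\<Sum>\<^sub># A \<le> \<Sum>\<^sub># M" if "A \<subseteq># M" for M :: "nat multiset"
    using that by (metis le_add1 subset_mset.add_diff_inverse sum_mset.union)
  then have "{M \<in> part_multisets S n. A \<subseteq># M} = {}"
    using False unfolding part_multisets_def by auto
  then show ?thesis using False by (simp only: card.empty if_False)
qed

lemma parts_gf_insert:
  assumes "s \<notin> S" and "0 < s" and "0 \<notin> S"
  shows "(1 - q ^ s) * parts_gf (insert s S) = parts_gf S"
proof -
  have "parts_gf (insert s S) = parts_gf S + q ^ s * parts_gf (insert s S)"
  proof (rule fps_ext)
    fix n
    have "part_multisets (insert s S) n = part_multisets S n \<union> {M \<in> part_multisets (insert s S) n. {#s#} \<subseteq># M}"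
      unfolding part_multisets_def by auto
    moreover have "part_multisets S n \<inter> {M \<in> part_multisets (insert s S) n. {#s#} \<subseteq># M} = {}"
      using assms(1) unfolding part_multisets_def by auto
    moreover have "finite (part_multisets (insert s S) n)" and "finite (part_multisets S n)"
      using assms by (auto intro!: finite_part_multisets)
    ultimately have "card (part_multisets (insert s S) n)
        = card (part_multisets S n) + card {M \<in> part_multisets (insert s S) n. {#s#} \<subseteq># M}"
      by (metis (no_types, lifting) card_Un_disjoint finite_Un)
    then show "parts_gf (insert s S) $ n = (parts_gf S + q ^ s * parts_gf (insert s S)) $ n"
      using card_part_multisets_containing[of "{#s#}" "insert s S" n]
      by (simp add: parts_gf_def fps_X_power_mult_nth)
  qed
  then show ?thesis
    by (simp add: algebra_simps)
qed

lemma parts_gf_finite: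
  assumes "finite S" and "0 \<notin> S"
  shows "(\<Prod>s\<in>S. 1 - q ^ s) * parts_gf S = 1"
  using assms
proof (induction S)
  case empty
  have "part_multisets {} n = (if n = 0 then {{#}} else {})" for n
    by (auto simp: part_multisets_def)
  then show ?case
    by (auto simp: parts_gf_def fps_eq_iff)
next
  case (insert s S)
  then have "(\<Prod>s\<in>S. 1 - q ^ s) * ((1 - q ^ s) * parts_gf (insert s S)) = 1"
    by (subst parts_gf_insert) auto
  then show ?case
    using insert by (simp add: ac_simps)
qed

lemma agree_parts_gf: "agree m (parts_gf S) (parts_gf (S \<inter> {..<m}))"
proof -
  have "part_multisets S n = part_multisets (S \<inter> {..<m}) n" if "n < m" for n
  proof -
    have "p \<le> \<Sum>\<^sub># M" if "p \<in># M" for p and M :: "nat multiset"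
      using that by (auto dest!: multi_member_split)
    then show ?thesis
      using that unfolding part_multisets_def by (fastforce dest: order_le_less_trans)
  qed
  then show ?thesis
    by (simp add: agree_def parts_gf_def)
qed

definition residue_parts :: "nat set" where
  "residue_parts = {p. p mod 8 \<in> {1, 5, 6}}"

lemma zero_notin_residue_parts: "0 \<notin> residue_parts"
  by (simp add: residue_parts_def)

lemma residue_parts_prod:
  "(\<Prod>s\<in>residue_parts \<inter> {..<8 * i}. 1 - q ^ s)
    = (\<Prod>j<2 * i. 1 - q ^ (4 * j + 1)) * (\<Prod>j<i. 1 - q ^ (8 * j + 6))"
proof -
  have "residue_parts \<inter> {..<8 * i} = (\<lambda>j. 4 * j
      + 1) ` {..<2 * i} \<union> (\<lambda>j. 8 * j + 6) ` {..<i}"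
    (is "?L = ?A \<union> ?B")
  proof (intro equalityI subsetI)
    fix p assume p: "p \<in> ?L"
    then have "p mod 8 = 1 \<or> p mod 8 = 5 \<or> p mod 8 = 6"
      unfolding residue_parts_def by auto
    then have "p mod 4 = 1 \<or> p mod 8 = 6"
      by presburger
    then consider "p mod 4 = 1" | "p mod 8 = 6"
      by blast
    then show "p \<in> ?A \<union> ?B"
    proof cases
      case 1
      then have "p = 4 * (p div 4) + 1" and "p div 4 < 2 * i"
        using p mult_div_mod_eq[of 4 p] by auto
      then show ?thesis by blast
    next
      case 2
      then have "p = 8 * (p div 8) + 6" and "p div 8 < i"
        using p mult_div_mod_eq[of 8 p] by auto
      then show ?thesis by blast
    qed
  next
    fix p assume "p \<in> ?A \<union> ?B"
    then show "p \<in> ?L"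
    proof
      assume "p \<in> ?A"
      then obtain j where "p = 4 * j + 1" "j < 2 * i"
        by blast
      moreover have "(4 * j + 1) mod 8 = 1 \<or> (4 * j + 1) mod 8 = 5"
        by presburger
      ultimately show ?thesis
        unfolding residue_parts_def by auto
    next
      assume "p \<in> ?B"
      then obtain j where "p = 8 * j + 6" "j < i"
        by blast
      moreover have "(8 * j + 6) mod 8 = 6"
        by presburger
      ultimately show ?thesis
        unfolding residue_parts_def by auto
    qed
  qed
  moreover have "?A \<inter> ?B = {}"
  proof -
    have "4 * j + 1 \<noteq> 8 * k + 6" for j k :: nat
      by presburger
    then show ?thesis by auto
  qed
  moreover have "inj_on (\<lambda>j. 4 * j + 1) {..<2 * i}" and "inj_on (\<lambda>j. 8 * j + 6) {..<i}"
    by (auto simp: inj_on_def)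
  ultimately show ?thesis
    by (simp add: prod.union_disjoint prod.reindex)
qed

lemma little_goellnitz: "parts_gf residue_parts = gap_min_gf 0"
proof (rule fps_ext)
  fix n
  \<comment> \<open>Cancelling the factor \<open>q\<close> costs one coefficient, so coefficient
    \<open>n\<close> needs precision beyond \<open>Suc n\<close>, which \<open>8 * Suc n\<close>
    provides.\<close>
  define i where "i = Suc n"
  let ?S = "residue_parts \<inter> {..<8 * i}"
  let ?P = "\<Prod>s\<in>?S. 1 - q ^ s"
  have P: "?P * parts_gf ?S = 1"
    by (rule parts_gf_finite) (simp_all add: zero_notin_residue_parts)
  have "agree (8 * i) (?P * parts_gf residue_parts) 1"
    using agree_mult[OF agree_parts_gf[of "8 * i" residue_parts], of ?P] P by simp
  moreover have "agree (8 * i) (q * (?P * gap_min_gf 0)) (q * 1)"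
    using little_goellnitz_product[of i] unfolding residue_parts_prod by simp
  then have "agree (n + 1) (?P * gap_min_gf 0) 1"
    unfolding agree_def
  proof (intro allI impI)
    fix k assume eq: "\<forall>k<8 * i. (q * (?P * gap_min_gf 0)) $ k = (q * 1) $ k" and "k < n + 1"
    then have "Suc k < 8 * i"
      by (simp add: i_def)
    with eq have "(q * (?P * gap_min_gf 0)) $ Suc k = (q * 1) $ Suc k"
      by blast
    then show "(?P * gap_min_gf 0) $ k = 1 $ k"
      by (simp only: fps_X_mult_nth) simp
  qed
  ultimately have "agree (n + 1) (?P * parts_gf residue_parts) (?P * gap_min_gf 0)"
    by (simp add: agree_def i_def)
  then have "agree (n + 1) (parts_gf residue_parts) (gap_min_gf 0)"
  proof (rule agree_cancel)
    show "parts_gf ?S * ?P = 1"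
      using P by (simp only: mult.commute)
  qed
  then show "parts_gf residue_parts $ n = gap_min_gf 0 $ n"
    by (simp add: agree_def)
qed

lemma periodic_gf:
  assumes "R \<subseteq> {..<m}" and "0 < m"
  shows "Abs_fps (\<lambda>k. if k mod m \<in> R then 1 else 0) = geo m * (\<Sum>r\<in>R. q ^ r)"
proof (rule geo_eqI[OF assms(2)], rule fps_ext)
  fix n
  have "(\<Sum>r\<in>R. q ^ r) $ n = (if n \<in> R then 1 else 0)"
    using finite_subset[OF assms(1)] by (simp add: fps_sum_nth fps_X_power_nth)
  moreover have "n \<notin> R" if "m \<le> n"
    using assms that by auto
  moreover have "(n - m) mod m = n mod m" if "m \<le> n"
    using that by (simp add: le_mod_geq)
  ultimately show "((1
      - q ^ m) * Abs_fps (\<lambda>k. if k mod m \<in> R then 1 else 0)) $ n = (\<Sum>r\<in>R. q ^ r) $ n"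
    by (auto simp: left_diff_distrib fps_X_power_mult_nth)
qed

text \<open>Injectivity of \<open>w\<close> lets each size come from a single \<open>p\<close>, so a
  0-1 indicator series carries the whole count.\<close>

lemma weighted_count:
  assumes "inj_on w C"
  shows "(\<Sum>p\<in>{p \<in> C. w p \<le> n}. real (card (part_multisets S (n - w p))))
    = (Abs_fps (\<lambda>k. if k \<in> w ` C then 1 else 0) * parts_gf S) $ n"
proof -
  have "(Abs_fps (\<lambda>k. if k \<in> w ` C then 1 else 0) * parts_gf S) $ n
      = (\<Sum>k=0..n. if k \<in> w ` C then real (card (part_multisets S (n - k))) else 0)"
    by (auto simp: fps_mult_nth parts_gf_def intro!: sum.cong)
  also have "\<dots> = (\<Sum>k\<in>w ` {p \<in> C. w p \<le> n}. real (card (part_multisets S (n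
      - k))))"
    by (subst sum.inter_filter[symmetric]) (auto intro!: sum.cong)
  also have "\<dots> = (\<Sum>p\<in>{p \<in> C. w p \<le> n}. real (card (part_multisets S (n - w p))))"
    using assms by (subst sum.reindex) (auto simp: inj_on_def)
  finally show ?thesis ..
qed

section \<open>Counting hooks\<close>

lemma conj_part_initial:
  assumes "sorted_wrt (\<ge>) lam"
  shows "{i. 1 \<le> i \<and> i \<le> length lam \<and> part lam i \<ge> j} = {1..conj_part lam j}"
proof -
  let ?I = "{i. 1 \<le> i \<and> i \<le> length lam \<and> part lam i \<ge> j}"
  have fin: "finite ?I"
    by (rule finite_subset[of _ "{..length lam}"]) auto
  have down: "k \<in> ?I" if "i \<in> ?I" "1 \<le> k" "k \<le> i" for i k
  proof (cases "k = i")
    case False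
    then have "lam ! (k - 1) \<ge> lam ! (i - 1)"
      using that assms by (intro sorted_wrt_nth_less[OF assms]) auto
    then show ?thesis
      using that by (auto simp: Defs.part_def)
  qed (use that in simp)
  show ?thesis
  proof (cases "?I = {}")
    case True
    then show ?thesis by (simp only: conj_part_def) simp
  next
    case False
    define m where "m = Max ?I"
    have "m \<in> ?I"
      unfolding m_def by (rule Max_in[OF fin False])
    moreover have "i \<le> m" if "i \<in> ?I" for i
      unfolding m_def by (rule Max_ge[OF fin that])
    ultimately have "?I = {1..m}"
    proof (intro equalityI subsetI)
      fix k assume "k \<in> {1..m}"
      then show "k \<in> ?I"
        using down[OF \<open>m \<in> ?I\<close>] by (simp only: atLeastAtMost_iff)
    qed simp
    then show ?thesis
      by (simp only: conj_part_def) simp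
  qed
qed

lemma le_conj_part_iff:
  assumes "sorted_wrt (\<ge>) lam" and "1 \<le> i"
  shows "i \<le> conj_part lam j \<longleftrightarrow> i \<le> length lam \<and> part lam i \<ge> j"
  using conj_part_initial[OF assms(1), of j] assms(2) by (metis (mono_tags, lifting) atLeastAtMost_iff mem_Collect_eq)

lemma conj_part_diff:
  assumes "sorted_wrt (\<ge>) lam"
  shows "conj_part lam j = conj_part lam (Suc j) + count (mset lam) j"
proof -
  have "count (mset lam) j = card {i. i < length lam \<and> lam ! i = j}"
    by (simp add: count_mset count_list_eq_length_filter length_filter_conv_card eq_commute[of j])
  also have "\<dots> = card (Suc ` {i. i < length lam \<and> lam ! i = j})"
    by (simp add: card_image)
  also have "Suc ` {i. i < length lam \<and> lam ! i = j} = {i. 1 \<le> i \<and> i \<le> length lam \<and> part lam i = j}"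
  proof (intro equalityI subsetI)
    fix i assume "i \<in> {i. 1 \<le> i \<and> i \<le> length lam \<and> part lam i = j}"
    then have "i = Suc (i - 1)" and "i - 1 \<in> {i. i < length lam \<and> lam ! i = j}"
      by (auto simp: Defs.part_def)
    then show "i \<in> Suc ` {i. i < length lam \<and> lam ! i = j}"
      by blast
  qed (auto simp: Defs.part_def)
  finally have c: "count (mset lam) j = card {i. 1 \<le> i \<and> i \<le> length lam \<and> part lam i = j}" .
  have "conj_part lam j = card ({i. 1 \<le> i \<and> i \<le> length lam \<and> part lam i \<ge> Suc j}
      \<union> {i. 1 \<le> i \<and> i \<le> length lam \<and> part lam i = j})"
    unfolding conj_part_def by (rule arg_cong[of _ _ card]) auto
  also have "\<dots> = conj_part lam (Suc j)
      + card {i. 1 \<le> i \<and> i \<le> length lam \<and> part lam i = j}"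
    unfolding conj_part_def
    by (rule card_Un_disjoint) (auto intro: finite_subset[of _ "{..length lam}"])
  finally show ?thesis
    using c by simp
qed

text \<open>The column heights drop strictly from \<open>p\<close> to \<open>p + 1\<close> when
  \<open>p\<close> occurs, so \<open>conj_part lam p\<close> is the last row of length
  \<open>p\<close>.\<close>

lemma part_conj_part:
  assumes "sorted_wrt (\<ge>) lam" and "p \<in> set lam"
  shows "1 \<le> conj_part lam p" and "conj_part lam p \<le> length lam" and "part lam (conj_part lam p) = p"
proof -
  have c: "conj_part lam p = conj_part lam (Suc p) + count (mset lam) p"
    by (rule conj_part_diff[OF assms(1)])
  have "0 < count (mset lam) p"
    using assms(2) by simp
  then show pos: "1 \<le> conj_part lam p"
    using c by linarith
  have "conj_part lam p \<le> length lam \<and> part lam (conj_part lam p) \<ge> p"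
    using le_conj_part_iff[OF assms(1) pos] by blast
  moreover have "\<not> conj_part lam p \<le> conj_part lam (Suc p)"
    using c \<open>0 < count (mset lam) p\<close> by simp
  then have "\<not> part lam (conj_part lam p) \<ge> Suc p"
    using le_conj_part_iff[OF assms(1) pos, of "Suc p"] calculation by blast
  ultimately show "conj_part lam p \<le> length lam" and "part lam (conj_part lam p) = p"
    by simp_all
qed

lemma part_in_set: "1 \<le> i \<Longrightarrow> i \<le> length lam \<Longrightarrow> part lam i \<in> set lam"
  by (simp add: Defs.part_def)

text \<open>In a partition, a cell has hook length 1 iff it ends both its row and its column, and hook
  length 2 iff its arm and leg have lengths 1 and 0, or 0 and 1.\<close>

lemma num_hooks_1:
  assumes "lam \<in> partitions n"
  shows "num_hooks 1 lam = card (set lam)"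
proof -
  have sorted: "sorted_wrt (\<ge>) lam" and pos: "\<And>p. p \<in> set lam \<Longrightarrow> 0 < p"
    using assms by (auto simp: partitions_def)
  have "{(i, j) \<in> diagram lam. hook_length lam i j = int 1} = (\<lambda>p. (conj_part lam p, p)) ` set lam"
  proof (intro equalityI subsetI)
    fix x assume "x \<in> {(i, j) \<in> diagram lam. hook_length lam i j = int 1}"
    then obtain i j where x: "x = (i, j)" and d: "1 \<le> i" "i \<le> length lam" "1 \<le> j" "j \<le> part lam i"
      and h: "hook_length lam i j = 1"
      unfolding diagram_def by auto
    have "i \<le> conj_part lam j"
      using le_conj_part_iff[OF sorted d(1)] d by blast
    then have "conj_part lam j = i" and "part lam i = j"
      using h d(4) unfolding hook_length_def by linarith+
    then show "x \<in> (\<lambda>p. (conj_part lam p, p)) ` set lam"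
      using part_in_set[OF d(1,2)] x by force
  next
    fix x assume "x \<in> (\<lambda>p. (conj_part lam p, p)) ` set lam"
    then obtain p where "p \<in> set lam" "x = (conj_part lam p, p)"
      by blast
    then show "x \<in> {(i, j) \<in> diagram lam. hook_length lam i j = int 1}"
      using part_conj_part[OF sorted] pos[of p] by (simp add: diagram_def hook_length_def)
  qed
  then show ?thesis
    unfolding num_hooks_def by (simp add: card_image inj_on_def)
qed

lemma num_hooks_2:
  assumes "lam \<in> partitions n"
  shows "num_hooks 2 lam = card {p \<in> set lam. 2 \<le> p \<and> p - 1 \<notin> set lam}
    + card {p \<in> set lam. 2 \<le> count (mset lam) p}"
proof -
  have sorted: "sorted_wrt (\<ge>) lam" and pos: "\<And>p. p \<in> set lam \<Longrightarrow> 0 < p"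
    using assms by (auto simp: partitions_def)
  let ?A = "{p \<in> set lam. 2 \<le> p \<and> p
      - 1 \<notin> set lam}" and ?B = "{p \<in> set lam. 2 \<le> count (mset lam) p}"
  \<comment> \<open>\<open>?f\<close> gives the cell next to the end of the last row of length
    \<open>p\<close>, with leg 0 because no row has length \<open>p - 1\<close>. \<open>?g\<close>
    gives the last cell of the row above it, which has the same length.\<close>
  let ?f = "\<lambda>p. (conj_part lam p, p - 1)" and ?g = "\<lambda>p. (conj_part lam p - 1, p)"
  have pred: "conj_part lam (p - 1) = conj_part lam p" if "p \<in> ?A" for p
    using conj_part_diff[OF sorted, of "p - 1"] that by (simp add: count_eq_zero_iff)
  have "{(i, j) \<in> diagram lam. hook_length lam i j = int 2} = ?f ` ?A \<union> ?g ` ?B"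
  proof (intro equalityI subsetI)
    fix x assume "x \<in> {(i, j) \<in> diagram lam. hook_length lam i j = int 2}"
    then obtain i j where x: "x = (i, j)" and d: "1 \<le> i" "i \<le> length lam" "1 \<le> j" "j \<le> part lam i"
      and h: "hook_length lam i j = 2"
      unfolding diagram_def by auto
    have i: "i \<le> conj_part lam j"
      using le_conj_part_iff[OF sorted d(1)] d by blast
    have p: "part lam i \<in> set lam"
      by (rule part_in_set[OF d(1,2)])
    consider "conj_part lam j = i" "part lam i = j + 1" | "conj_part lam j = i + 1" "part lam i = j"
      using h d(4) i unfolding hook_length_def by linarith
    then show "x \<in> ?f ` ?A \<union> ?g ` ?B"
    proof cases
      case 1
      have "i \<le> conj_part lam (Suc j)"
        using le_conj_part_iff[OF sorted d(1), of "Suc j"] d 1 by simp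
      then have "count (mset lam) j = 0" and "conj_part lam (Suc j) = i"
        using conj_part_diff[OF sorted, of j] 1 by simp_all
      then have "Suc j \<in> ?A" and "x = ?f (Suc j)"
        using p 1 d x by (simp_all add: count_eq_zero_iff)
      then show ?thesis by blast
    next
      case 2
      have "\<not> i \<le> conj_part lam (Suc j)"
        using le_conj_part_iff[OF sorted d(1), of "Suc j"] d 2 by simp
      then have "2 \<le> count (mset lam) j"
        using conj_part_diff[OF sorted, of j] 2 by simp
      then have "j \<in> ?B" and "x = ?g j"
        using p 2 x by simp_all
      then show ?thesis by blast
    qed
  next
    fix x assume "x \<in> ?f ` ?A \<union> ?g ` ?B"
    then show "x \<in> {(i, j) \<in> diagram lam. hook_length lam i j = int 2}"
    proof
      assume "x \<in> ?f ` ?A"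
      then obtain p where p: "p \<in> ?A" "x = ?f p"
        by blast
      then show ?thesis
        using part_conj_part[OF sorted, of p] pred[OF p(1)] by (auto simp: diagram_def hook_length_def)
    next
      assume "x \<in> ?g ` ?B"
      then obtain p where p: "p \<in> ?B" "x = ?g p"
        by blast
      have c: "conj_part lam (Suc p) + 2 \<le> conj_part lam p"
        using conj_part_diff[OF sorted, of p] p by simp
      let ?i = "conj_part lam p - 1"
      have i: "1 \<le> ?i" "?i \<le> conj_part lam p" "\<not> ?i \<le> conj_part lam (Suc p)"
        using c by simp_all
      then have "?i \<le> length lam" "part lam ?i = p"
        using le_conj_part_iff[OF sorted i(1), of p] le_conj_part_iff[OF sorted i(1), of "Suc p"]
        by simp_all
      then show ?thesis
        using i p pos[of p] by (auto simp: diagram_def hook_length_def)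
    qed
  qed
  moreover have "?f ` ?A \<inter> ?g ` ?B = {}"
  proof -
    have "?f p \<noteq> ?g r" if "p \<in> ?A" "r \<in> ?B" for p r
      using pred[OF that(1)] conj_part_diff[OF sorted, of r] part_conj_part(1)[OF sorted, of p] that by auto
    then show ?thesis by blast
  qed
  moreover have "inj_on ?f ?A" and "inj_on ?g ?B"
    by (auto simp: inj_on_def)
  ultimately show ?thesis
    unfolding num_hooks_def by (simp add: card_Un_disjoint card_image)
qed

section \<open>Gap partitions and their generating function\<close>

definition gap_rel :: "nat \<Rightarrow> nat \<Rightarrow> bool" where
  "gap_rel x y \<longleftrightarrow> x + 2 \<le> y \<and> (odd y \<longrightarrow> x + 2 < y)"

text \<open>The increasing order puts the smallest part at the head, where the recursion removes
  it.\<close>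

definition gap_lists :: "nat \<Rightarrow> nat \<Rightarrow> nat list set" where
  "gap_lists N n = {l. length l = N \<and> sum_list l = n \<and> (\<forall>p\<in>set l. 0 < p) \<and> successively gap_rel l}"

lemma gap_partitions_iff_rev:
  "lam \<in> gap_partitions n \<longleftrightarrow> rev lam \<in> gap_lists (length lam) n"
proof -
  have adjacent: "(\<forall>i. 1 \<le> i \<and> i < length lam \<longrightarrow> part lam i
      - part lam (i + 1) \<ge> 2 \<and>
      (odd (part lam i) \<longrightarrow> part lam i - part lam (i + 1) > 2))
    \<longleftrightarrow> successively (\<lambda>x y. gap_rel y x) lam" (is "?L \<longleftrightarrow> ?R")
  proof
    assume L: ?L
    show ?R
      unfolding successively_conv_nth
    proof (intro allI impI)
      fix i assume "Suc i < length lam"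
      with L[rule_format, of "Suc i"] show "gap_rel (lam ! Suc i) (lam ! i)"
        by (auto simp: Defs.part_def gap_rel_def)
    qed
  next
    assume R: ?R
    show ?L
    proof (intro allI impI)
      fix i assume i: "1 \<le> i \<and> i < length lam"
      then have "Suc (i - 1) < length lam"
        by simp
      with R have "gap_rel (lam ! Suc (i - 1)) (lam ! (i - 1))"
        unfolding successively_conv_nth by blast
      with i show "part lam i - part lam (i
          + 1) \<ge> 2 \<and> (odd (part lam i) \<longrightarrow> part lam i - part lam (i
          + 1) > 2)"
        by (auto simp: Defs.part_def gap_rel_def)
    qed
  qed
  have "sorted_wrt (\<ge>) lam" if "successively (\<lambda>x y. gap_rel y x) lam"
  proof -
    have "successively (\<ge>) lam"
      by (rule successively_mono[OF that]) (simp add: gap_rel_def)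
    then show ?thesis
      by (subst (asm) successively_conv_sorted_wrt) (auto simp: transp_def)
  qed
  then show ?thesis
    unfolding gap_partitions_def partitions_def gap_lists_def mem_Collect_eq adjacent
    by (auto simp: successively_rev sum_list_rev)
qed

lemma bij_betw_rev_gap_lists:
  "bij_betw rev (gap_lists N n) {lam \<in> gap_partitions n. length lam = N}"
proof (rule bij_betwI[where g = rev])
  show "rev \<in> gap_lists N n \<rightarrow> {lam \<in> gap_partitions n. length lam = N}"
    by (auto simp: gap_partitions_iff_rev) (auto simp: gap_lists_def)
qed (auto simp: gap_partitions_iff_rev)

lemma finite_gap_lists: "finite (gap_lists N n)"
  using bij_betw_finite[OF bij_betw_rev_gap_lists] finite_gap_partitions by simp

lemma gap_lists_Cons_le:
  assumes "successively gap_rel (x # l)" and "y \<in> set l"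
  shows "x + 2 \<le> y"
proof -
  have "successively (\<lambda>x y. x + 2 \<le> y) (x # l)"
    by (rule successively_mono[OF assms(1)]) (simp add: gap_rel_def)
  then have "sorted_wrt (\<lambda>x y. x + 2 \<le> y) (x # l)"
    by (subst (asm) successively_conv_sorted_wrt) (auto simp: transp_def)
  then show ?thesis
    using assms(2) by simp
qed

section \<open>Removing the smallest part and lowering the others by 2\<close>

abbreviation shift2 :: "nat list \<Rightarrow> nat list" where
  "shift2 l \<equiv> map (\<lambda>x. x + 2) l"

lemma inj_shift2: "inj shift2"
  by (rule inj_mapI) (simp add: inj_def)

lemma sum_list_shift2: "sum_list (shift2 l) = 2 * length l + sum_list l"
  by (induction l) auto

lemma successively_shift2: "successively gap_rel (shift2 l) \<longleftrightarrow> successively gap_rel l"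
  by (simp add: successively_map gap_rel_def)

lemma shift2_preimage:
  assumes "\<forall>x\<in>set l. 3 \<le> x"
  obtains l' where "l = shift2 l'" and "\<forall>x\<in>set l'. 0 < x"
proof
  show "l = shift2 (map (\<lambda>x. x - 2) l)"
    using assms by (induction l) auto
  show "\<forall>x\<in>set (map (\<lambda>x. x - 2) l). 0 < x"
    using assms by fastforce
qed

text \<open>After 1 the part 3 is excluded as an odd part at distance 2, after 2 by the distance
  alone. In both cases the next part is at least 4, hence at least 2 once lowered; parities and
  differences do not change.\<close>

lemma successively_Cons_shift2:
  assumes "a = 1 \<or> a = 2" and "\<forall>p\<in>set l. 0 < p"
  shows "successively gap_rel (a # shift2 l) \<longleftrightarrow> successively gap_rel l \<and> 1 \<notin> set l"
proof (cases l)
  case (Cons y t)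
  have "gap_rel a (y + 2) \<longleftrightarrow> 2 \<le> y"
    using assms Cons by (auto simp: gap_rel_def) presburger+
  moreover have "1 \<notin> set t" if "successively gap_rel l"
    using gap_lists_Cons_le[of y t 1] that Cons by auto
  ultimately show ?thesis
    using assms(2) Cons successively_shift2[of l] by (auto simp: Suc_le_eq)
qed simp

definition gap_lists_no_1 :: "nat \<Rightarrow> nat \<Rightarrow> nat list set" where
  "gap_lists_no_1 N n = {l \<in> gap_lists N n. 1 \<notin> set l}"

lemma gap_lists_hd_small:
  assumes "a = 1 \<or> a = 2"
  shows "card {l \<in> gap_lists (Suc M) n. hd l = a}
    = (if 2 * M + a \<le> n then card (gap_lists_no_1 M (n - (2 * M + a))) else 0)"
proof -
  have eq: "{l \<in> gap_lists (Suc M) n. hd l = a}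
      = (\<lambda>l. a # shift2 l) ` {l. length l = M \<and> 2 * M + a + sum_list l = n \<and> (\<forall>p\<in>set l. 0 < p)
          \<and> successively gap_rel l \<and> 1 \<notin> set l}" (is "?L = _ ` ?R")
  proof (intro equalityI subsetI)
    fix l assume l: "l \<in> ?L"
    then obtain t where t: "l = a # t"
      unfolding gap_lists_def by (cases l) auto
    have suc: "successively gap_rel (a # t)"
      using l t by (simp add: gap_lists_def)
    have "\<forall>x\<in>set t. 3 \<le> x"
      using gap_lists_Cons_le[OF suc] assms by fastforce
    then obtain l' where l': "t = shift2 l'" "\<forall>x\<in>set l'. 0 < x"
      by (rule shift2_preimage)
    have "l' \<in> ?R"
      using l t l' suc successively_Cons_shift2[OF assms l'(2)] sum_list_shift2[of l']
      by (simp add: gap_lists_def)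
    then show "l \<in> (\<lambda>l. a # shift2 l) ` ?R"
      using t l'(1) by blast
  next
    fix l assume "l \<in> (\<lambda>l. a # shift2 l) ` ?R"
    then obtain l' where l': "l = a # shift2 l'" "l' \<in> ?R"
      by blast
    then show "l \<in> ?L"
      using successively_Cons_shift2[OF assms, of l'] assms sum_list_shift2[of l']
      by (auto simp: gap_lists_def)
  qed
  have "?R = (if 2 * M + a \<le> n then gap_lists_no_1 M (n - (2 * M + a)) else {})"
    by (auto simp: gap_lists_no_1_def gap_lists_def)
  moreover have "inj_on (\<lambda>l. a # shift2 l) A" for A
    using inj_shift2 by (auto simp: inj_on_def inj_def)
  ultimately show ?thesis
    unfolding eq by (simp add: card_image)
qed

lemma gap_lists_hd_large:
  "card {l \<in> gap_lists (Suc M) n. 3 \<le> hd l}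
    = (if 2 * M + 2 \<le> n then card (gap_lists (Suc M) (n - (2 * M + 2))) else 0)"
proof -
  have eq: "{l \<in> gap_lists (Suc M) n. 3 \<le> hd l}
      = shift2 ` {l. length l = Suc M \<and> 2 * M + 2 + sum_list l = n \<and> (\<forall>p\<in>set l. 0 < p)
          \<and> successively gap_rel l}" (is "?L = _ ` ?R")
  proof (intro equalityI subsetI)
    fix l assume l: "l \<in> ?L"
    then obtain x t where t: "l = x # t"
      unfolding gap_lists_def by (cases l) auto
    have "successively gap_rel (x # t)" and "3 \<le> x"
      using l t by (simp_all add: gap_lists_def)
    then have "\<forall>x\<in>set l. 3 \<le> x"
      using gap_lists_Cons_le[of x t] t by fastforce
    then obtain l' where l': "l = shift2 l'" "\<forall>x\<in>set l'. 0 < x"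
      by (rule shift2_preimage)
    have "l' \<in> ?R"
      using l l' successively_shift2[of l'] sum_list_shift2[of l']
      by (simp add: gap_lists_def)
    then show "l \<in> shift2 ` ?R"
      using l'(1) by blast
  next
    fix l assume "l \<in> shift2 ` ?R"
    then obtain l' where l': "l = shift2 l'" "l' \<in> ?R"
      by blast
    then obtain x t where "l' = x # t"
      by (cases l') auto
    then have "3 \<le> hd l"
      using l' by auto
    then show "l \<in> ?L"
      using l' successively_shift2[of l'] sum_list_shift2[of l']
      by (auto simp: gap_lists_def)
  qed
  have "?R = (if 2 * M + 2 \<le> n then gap_lists (Suc M) (n - (2 * M + 2)) else {})"
    by (auto simp: gap_lists_def)
  then show ?thesis
    unfolding eq using card_image[OF inj_on_subset[OF inj_shift2 subset_UNIV]] by simp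
qed

definition gap_lists_gf :: "nat \<Rightarrow> real fps" where
  "gap_lists_gf N = Abs_fps (\<lambda>n. real (card (gap_lists N n)))"

definition gap_lists_no_1_gf :: "nat \<Rightarrow> real fps" where
  "gap_lists_no_1_gf N = Abs_fps (\<lambda>n. real (card (gap_lists_no_1 N n)))"

lemma gap_lists_gf_0: "gap_lists_gf 0 = 1" and gap_lists_no_1_gf_0: "gap_lists_no_1_gf 0 = 1"
proof -
  have "gap_lists 0 n = (if n = 0 then {[]} else {})" for n
    by (auto simp: gap_lists_def)
  moreover have "gap_lists_no_1 0 n = (if n = 0 then {[]} else {})" for n
    by (auto simp: gap_lists_no_1_def gap_lists_def)
  ultimately show "gap_lists_gf 0 = 1" and "gap_lists_no_1_gf 0 = 1"
    by (auto simp: gap_lists_gf_def gap_lists_no_1_gf_def fps_eq_iff)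
qed

lemma gap_lists_gf_Suc:
  "gap_lists_gf (Suc M) = q ^ (2 * M + 2) * gap_lists_gf (Suc M)
     + (q ^ (2 * M + 1) + q ^ (2 * M + 2)) * gap_lists_no_1_gf M"
proof (rule fps_ext)
  fix n
  have "1 \<le> hd l" if "l \<in> gap_lists (Suc M) n" for l
    using that unfolding gap_lists_def by (cases l) auto
  then have "gap_lists (Suc M) n = {l \<in> gap_lists (Suc M) n. 3 \<le> hd l}
      \<union> ({l \<in> gap_lists (Suc M) n. hd l = 1} \<union> {l \<in> gap_lists (Suc M) n. hd l = 2})"
    (is "_ = ?A \<union> (?B \<union> ?C)")
    by force
  then have "card (gap_lists (Suc M) n) = card (?A \<union> (?B \<union> ?C))"
    by (rule arg_cong)
  also have "\<dots> = card ?A + card (?B \<union> ?C)"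
    using finite_gap_lists by (intro card_Un_disjoint) auto
  also have "card (?B \<union> ?C) = card ?B + card ?C"
    using finite_gap_lists by (intro card_Un_disjoint) auto
  finally have "card (gap_lists (Suc M) n) = card ?A + (card ?B + card ?C)" .
  then have "real (card (gap_lists (Suc M) n)) = real (card ?A) + (real (card ?B) + real (card ?C))"
    by (simp only: of_nat_add)
  then show "gap_lists_gf (Suc M) $ n = (q ^ (2 * M + 2) * gap_lists_gf (Suc M)
     + (q ^ (2 * M + 1) + q ^ (2 * M + 2)) * gap_lists_no_1_gf M) $ n"
    unfolding gap_lists_gf_def gap_lists_no_1_gf_def distrib_right fps_add_nth fps_X_power_mult_nth
      gap_lists_hd_large gap_lists_hd_small[OF disjI1[OF refl]] gap_lists_hd_small[OF disjI2[OF refl]]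
    by auto
qed

lemma gap_lists_no_1_gf_Suc:
  "gap_lists_no_1_gf (Suc M) = gap_lists_gf (Suc M) - q ^ (2 * M + 1) * gap_lists_no_1_gf M"
proof (rule fps_ext)
  fix n
  have "1 \<in> set l \<longleftrightarrow> hd l = 1" if "l \<in> gap_lists (Suc M) n" for l
  proof -
    obtain x t where l: "l = x # t"
      using \<open>l \<in> gap_lists (Suc M) n\<close> unfolding gap_lists_def by (cases l) auto
    then show ?thesis
      using \<open>l \<in> gap_lists (Suc M) n\<close> gap_lists_Cons_le[of x t 1] by (auto simp: gap_lists_def)
  qed
  then have "gap_lists (Suc M) n = gap_lists_no_1 (Suc M) n \<union> {l \<in> gap_lists (Suc M) n. hd l = 1}"
    and "gap_lists_no_1 (Suc M) n \<inter> {l \<in> gap_lists (Suc M) n. hd l = 1} = {}"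
    unfolding gap_lists_no_1_def by auto
  then have "card (gap_lists (Suc M) n)
      = card (gap_lists_no_1 (Suc M) n) + card {l \<in> gap_lists (Suc M) n. hd l = 1}"
    using finite_gap_lists by (metis (no_types, lifting) card_Un_disjoint finite_Un)
  then show "gap_lists_no_1_gf (Suc M) $ n = (gap_lists_gf (Suc M) - q ^ (2 * M
      + 1) * gap_lists_no_1_gf M) $ n"
    unfolding gap_lists_gf_def gap_lists_no_1_gf_def fps_sub_nth fps_X_power_mult_nth
    by (simp add: gap_lists_hd_small)
qed

text \<open>Each of the two series occurs in the recursion of the other, so both are carried along.
  The factor \<open>1 + q\<close> of the second is supplied by
  \<open>q^(2 M + 1) + q^(2 M + 2)\<close>.\<close>

lemma gap_lists_gf_eq:
  "gap_lists_gf N = gap_gf N \<and> (1 + q) * gap_lists_no_1_gf N = (q + q ^ (2 * N)) * gap_gf N"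
proof (induction N)
  case 0
  then show ?case
    by (simp add: gap_lists_gf_0 gap_lists_no_1_gf_0)
next
  case (Suc M)
  have "(1 - q ^ (2 * M + 2)) * gap_lists_gf (Suc M) = (q ^ (2 * M + 1) + q ^ (2 * M
      + 2)) * gap_lists_no_1_gf M"
    using gap_lists_gf_Suc[of M] by (simp add: algebra_simps)
  also have "\<dots> = q ^ (2 * M + 1) * ((1 + q) * gap_lists_no_1_gf M)"
    by (simp add: algebra_simps)
  finally have step: "(1 - q ^ (2 * M + 2)) * gap_lists_gf (Suc M)
      = q ^ (2 * M + 1) * ((1 + q) * gap_lists_no_1_gf M)" .
  also have "\<dots> = (q ^ (2 * M + 1) * (q + q ^ (2 * M))) * gap_gf M"
    using Suc by (simp only: mult.assoc)
  also have "q ^ (2 * M + 1) * (q + q ^ (2 * M)) = gap_ratio M"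
    by (simp add: gap_ratio_def algebra_simps flip: power_add)
  finally have "gap_lists_gf (Suc M) = geo (2 * M + 2) * (gap_ratio M * gap_gf M)"
    by (intro geo_eqI) simp_all
  then have gf: "gap_lists_gf (Suc M) = gap_gf (Suc M)"
    by (simp only: gap_gf.simps(2))
  have "(1 + q) * gap_lists_no_1_gf (Suc M)
      = (1 + q) * gap_lists_gf (Suc M) - q ^ (2 * M + 1) * ((1 + q) * gap_lists_no_1_gf M)"
    unfolding gap_lists_no_1_gf_Suc by (simp add: algebra_simps)
  also have "\<dots> = (q + q ^ (2 * Suc M)) * gap_gf (Suc M)"
    unfolding step[symmetric] gf by (simp add: algebra_simps)
  finally show ?case
    using gf by blast
qed

lemma gap_lists_no_1_gf_eq: "gap_lists_no_1_gf N = (geo 2 * (1 - q) * (q + q ^ (2 * N))) * gap_gf N"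
proof -
  have "(1 - q ^ 2) * gap_lists_no_1_gf N = (1 - q) * ((1 + q) * gap_lists_no_1_gf N)"
    by (simp add: algebra_simps power2_eq_square)
  then have "gap_lists_no_1_gf N = geo 2 * ((1 - q) * ((1 + q) * gap_lists_no_1_gf N))"
    by (intro geo_eqI) simp_all
  then show ?thesis
    using gap_lists_gf_eq[of N] by (simp only: mult.assoc)
qed

text \<open>Summed over \<open>N\<close>, the series count all gap partitions and those without the
  part 1. Their difference is the \<open>h\<close> of \<open>two_hooks_positive\<close>.\<close>

lemma fsum_gap_lists_no_1_gf:
  "(1 + q) * (gap_min_gf 0 - fsum gap_lists_no_1_gf) = gap_min_gf 0 - gap_min_gf 1"
proof -
  have "graded gap_lists_no_1_gf"
    using graded_gap_gf_mult by (simp only: gap_lists_no_1_gf_eq[abs_def])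
  then have "(1 + q) * fsum gap_lists_no_1_gf = fsum (\<lambda>N. (1 + q) * gap_lists_no_1_gf N)"
    by (rule fsum_mult[symmetric])
  also have "\<dots> = fsum (\<lambda>N. q * (q ^ (2 * 0 * N) * gap_gf N)
      + 1 * (q ^ (2 * 1 * N) * gap_gf N))"
    using gap_lists_gf_eq by (simp add: distrib_right)
  also have "\<dots> = q * gap_min_gf 0 + 1 * gap_min_gf 1"
    by (simp only: fsum_add fsum_power_gap_gf)
  finally show ?thesis
    by (simp add: algebra_simps)
qed

section \<open>Hook totals as coefficients\<close>

lemma gap_partition_distinct:
  assumes "lam \<in> gap_partitions n"
  shows "distinct lam" and "p \<in> set lam \<Longrightarrow> Suc p \<notin> set lam"
proof -
  have suc: "successively gap_rel (rev lam)"
    using assms gap_partitions_iff_rev by (auto simp: gap_lists_def)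
  have "distinct l \<and> (p \<in> set l \<longrightarrow> Suc p \<notin> set l)" if "successively gap_rel l" for l
    using that
  proof (induction l)
    case (Cons x l)
    then show ?case
      using gap_lists_Cons_le[OF Cons.prems] by (cases l) fastforce+
  qed simp
  from this[OF suc] show "distinct lam" and "p \<in> set lam \<Longrightarrow> Suc p \<notin> set lam"
    by simp_all
qed

lemma gap_partitions_partitions: "lam \<in> gap_partitions n \<Longrightarrow> lam \<in> partitions n"
  by (simp add: gap_partitions_def)

lemma sum_gap_partitions_by_length:
  fixes f :: "nat list \<Rightarrow> nat"
  shows "(\<Sum>lam\<in>gap_partitions n. f lam) = (\<Sum>N\<le>n. \<Sum>l\<in>gap_lists N n. f (rev l))"
proof -
  have "length ` gap_partitions n \<subseteq> {..n}"
    using length_le_sum_list_pos by (auto simp: gap_partitions_def partitions_def)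
  then have "(\<Sum>lam\<in>gap_partitions n. f lam) = (\<Sum>N\<le>n. \<Sum>lam\<in>{lam \<in> gap_partitions n. length lam = N}. f lam)"
    by (intro sum.group[symmetric]) (auto simp: finite_gap_partitions)
  also have "\<dots> = (\<Sum>N\<le>n. \<Sum>l\<in>gap_lists N n. f (rev l))"
    by (intro sum.cong refl sum.reindex_bij_betw[symmetric] bij_betw_rev_gap_lists)
  finally show ?thesis .
qed

lemma g1_1_gf: "real (g1 1 n) = fsum (\<lambda>N. of_nat N * gap_gf N) $ n"
proof -
  have "num_hooks 1 lam = length lam" if "lam \<in> gap_partitions n" for lam
    using num_hooks_1[OF gap_partitions_partitions[OF that]] gap_partition_distinct(1)[OF that]
    by (simp add: distinct_card)
  then have "g1 1 n = (\<Sum>lam\<in>gap_partitions n. length lam)"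
    by (simp add: g1_def)
  also have "\<dots> = (\<Sum>N\<le>n. \<Sum>l\<in>gap_lists N n. N)"
    unfolding sum_gap_partitions_by_length by (intro sum.cong) (auto simp: gap_lists_def)
  finally show ?thesis
    using gap_lists_gf_eq by (simp add: fsum_def fps_mult_of_nat_nth gap_lists_gf_def fps_eq_iff mult.commute)
qed

text \<open>Distinct parts leave no 2-hook with leg 1, and consecutive integers never occur
  together, so every part except 1 carries exactly one 2-hook.\<close>

lemma g1_2_gf:
  "real (g1 2 n) = (fsum (\<lambda>N. of_nat N * gap_gf N) - (gap_min_gf 0
      - fsum gap_lists_no_1_gf)) $ n"
proof -
  have hooks: "num_hooks 2 lam
      + of_bool (1 \<in> set lam) = num_hooks 1 lam" if lam: "lam \<in> gap_partitions n" for lam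
  proof -
    note dist = gap_partition_distinct[OF lam]
    have pos: "0 < p" if "p \<in> set lam" for p
      using gap_partitions_partitions[OF lam] that by (simp add: partitions_def)
    have "{p \<in> set lam. 2 \<le> count (mset lam) p} = {}"
      using dist(1) by (auto simp: distinct_count_atmost_1 split: if_splits)
    moreover have "{p \<in> set lam. 2 \<le> p \<and> p - 1 \<notin> set lam} = set lam - {1}"
    proof (intro equalityI subsetI)
      fix p assume p: "p \<in> set lam - {1}"
      then have "2 \<le> p"
        using pos[of p] by auto
      moreover have "p - 1 \<notin> set lam"
        using dist(2)[of "p - 1"] p \<open>2 \<le> p\<close> by auto
      ultimately show "p \<in> {p \<in> set lam. 2 \<le> p \<and> p - 1 \<notin> set lam}"
        using p by simp
    qed auto
    ultimately have "num_hooks 2 lam = card (set lam - {1})"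
      using num_hooks_2[OF gap_partitions_partitions[OF lam]] by (simp only: card.empty add_0_right)
    moreover have "card (set lam - {1}) + of_bool (1 \<in> set lam) = card (set lam)"
      using card_Suc_Diff1[of "set lam" 1] by (cases "1 \<in> set lam") simp_all
    ultimately show ?thesis
      using num_hooks_1[OF gap_partitions_partitions[OF lam]] by simp
  qed
  have "g1 2 n + (\<Sum>lam\<in>gap_partitions n. of_bool (1 \<in> set lam)) = g1 1 n"
    unfolding g1_def sum.distrib[symmetric] using hooks by (rule sum.cong[OF refl])
  moreover have "(\<Sum>lam\<in>gap_partitions n. of_bool (1 \<in> set lam))
      + (\<Sum>N\<le>n. card (gap_lists_no_1 N n))
      = (\<Sum>N\<le>n. card (gap_lists N n))"
  proof -
    have "(\<Sum>l\<in>gap_lists N n. of_bool (1 \<in> set (rev l)))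
        + card (gap_lists_no_1 N n) = card (gap_lists N n)" for N
    proof -
      have "gap_lists N n = {l \<in> gap_lists N n. 1 \<in> set l} \<union> gap_lists_no_1 N n"
        and "{l \<in> gap_lists N n. 1 \<in> set l} \<inter> gap_lists_no_1 N n = {}"
        unfolding gap_lists_no_1_def by auto
      moreover have "finite {l \<in> gap_lists N n. 1 \<in> set l}" "finite (gap_lists_no_1 N n)"
        using finite_gap_lists unfolding gap_lists_no_1_def by auto
      ultimately have "card (gap_lists N n) = card {l \<in> gap_lists N n. 1 \<in> set l} + card (gap_lists_no_1 N n)"
        by (metis (no_types, lifting) card_Un_disjoint)
      then show ?thesis
        using finite_gap_lists by (simp add: sum_of_bool_eq Int_def)
    qed
    then show ?thesis
      unfolding sum_gap_partitions_by_length sum.distrib[symmetric] by (intro sum.cong) auto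
  qed
  ultimately have "real (g1 2 n) = real (g1 1 n) - (real (\<Sum>N\<le>n. card (gap_lists N n))
      - real (\<Sum>N\<le>n. card (gap_lists_no_1 N n)))"
    by linarith
  moreover have "gap_min_gf 0 = fsum gap_lists_gf"
    unfolding gap_min_gf_def using gap_lists_gf_eq by (simp add: ext[of gap_lists_gf gap_gf])
  ultimately show ?thesis
    unfolding g1_1_gf by (simp add: fsum_def gap_lists_gf_def gap_lists_no_1_gf_def)
qed

lemma sum_congruence_partitions:
  fixes f :: "nat multiset \<Rightarrow> 'a :: comm_monoid_add"
  shows "(\<Sum>lam\<in>congruence_partitions n. f (mset lam)) = (\<Sum>M\<in>part_multisets residue_parts n. f M)"
proof -
  have "congruence_partitions n = {lam \<in> partitions n. set lam \<subseteq> residue_parts}"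
    unfolding congruence_partitions_def residue_parts_def by auto
  then show ?thesis
    using sum.reindex_bij_betw[OF bij_betw_mset_partitions[OF zero_notin_residue_parts]] by simp
qed

text \<open>Double counting: each part size \<open>p\<close> in \<open>C\<close> contributes the multisets containing \<open>A p\<close>,
  and removing \<open>A p\<close> lowers the size by its sum.\<close>
lemma sum_card_containing:
  assumes "\<And>p. p \<in> C \<Longrightarrow> set_mset (A p) \<subseteq> residue_parts" and "inj_on (\<lambda>p. \<Sum>\<^sub># (A p)) C"
    and "\<And>p. p \<in> C \<Longrightarrow> p \<le> \<Sum>\<^sub># (A p)"
  shows "(\<Sum>M\<in>part_multisets residue_parts n. real (card {p \<in> C. A p \<subseteq># M}))
    = (Abs_fps (\<lambda>k. if k \<in> (\<lambda>p. \<Sum>\<^sub># (A p)) ` C then 1 else 0) * parts_gf residue_parts) $ n"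
proof -
  have "finite {p \<in> C. \<Sum>\<^sub># (A p) \<le> n}"
    by (rule finite_subset[of _ "{..n}"]) (use assms(3) order_trans in auto)
  note fin = this finite_part_multisets[OF zero_notin_residue_parts, of n]
  have sum_le: "\<Sum>\<^sub># (A p) \<le> n" if "A p \<subseteq># M" "M \<in> part_multisets residue_parts n" for p M
    using that unfolding part_multisets_def
    by (metis (mono_tags, lifting) le_add1 mem_Collect_eq subset_mset.add_diff_inverse sum_mset.union)
  have "(\<Sum>M\<in>part_multisets residue_parts n. card {p \<in> C. A p \<subseteq># M})
      = (\<Sum>M\<in>part_multisets residue_parts n. \<Sum>p\<in>{p \<in> C. \<Sum>\<^sub># (A p) \<le> n}. of_bool (A p \<subseteq># M))"
  proof (rule sum.cong[OF refl])
    fix M assume "M \<in> part_multisets residue_parts n"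
    then have "{p \<in> C. A p \<subseteq># M} = {p \<in> C. \<Sum>\<^sub># (A p) \<le> n} \<inter> {p. A p \<subseteq># M}"
      using sum_le by auto
    then show "card {p \<in> C. A p \<subseteq># M} = (\<Sum>p\<in>{p \<in> C. \<Sum>\<^sub># (A p) \<le> n}. of_bool (A p \<subseteq># M))"
      using fin by (simp add: sum_of_bool_eq)
  qed
  also have "\<dots> = (\<Sum>p\<in>{p \<in> C. \<Sum>\<^sub># (A p) \<le> n}. card {M \<in> part_multisets residue_parts n. A p \<subseteq># M})"
    using fin by (subst sum.swap) (simp add: sum_of_bool_eq Int_def)
  also have "\<dots> = (\<Sum>p\<in>{p \<in> C. \<Sum>\<^sub># (A p) \<le> n}. card (part_multisets residue_parts (n
      - \<Sum>\<^sub># (A p))))"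
    using assms(1) by (intro sum.cong) (auto simp: card_part_multisets_containing)
  finally show ?thesis
    using weighted_count[OF assms(2), where n = n and S = residue_parts] by (simp flip: of_nat_sum)
qed

lemma residue_parts_indicator:
  "Abs_fps (\<lambda>k. if k \<in> residue_parts then 1 else 0) = geo 8 * (q + q ^ 5 + q ^ 6)"
  using periodic_gf[of "{1, 5, 6}" 8] by (simp add: residue_parts_def add.assoc)

lemma g2_1_gf: "real (g2 1 n) = (geo 8 * (q + q ^ 5 + q ^ 6) * gap_min_gf 0) $ n"
proof -
  have "num_hooks 1 lam = card (set_mset (mset lam))" if "lam \<in> congruence_partitions n" for lam
    using num_hooks_1[of lam n] that by (simp add: congruence_partitions_def)
  then have "g2 1 n = (\<Sum>lam\<in>congruence_partitions n. card (set_mset (mset lam)))"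
    unfolding g2_def by (rule sum.cong[OF refl])
  also have "\<dots> = (\<Sum>M\<in>part_multisets residue_parts n. card (set_mset M))"
    by (rule sum_congruence_partitions)
  also have "\<dots> = (\<Sum>M\<in>part_multisets residue_parts n. card {p \<in> residue_parts. {#p#} \<subseteq># M})"
    by (intro sum.cong refl arg_cong[of _ _ card]) (auto simp: part_multisets_def)
  finally have "real (g2 1 n) = (\<Sum>M\<in>part_multisets residue_parts n. real (card {p \<in> residue_parts. {#p#} \<subseteq># M}))"
    by simp
  then show ?thesis
    using sum_card_containing[of residue_parts "\<lambda>p. {#p#}" n]
    by (simp add: residue_parts_indicator little_goellnitz)
qed

text \<open>Among the residues 1, 5, 6 only 5 and 6 are consecutive. So a part other than 1 lacks
  its 2-hook with arm 1 only if it is 6 modulo 8 and its predecessor occurs too. The count is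
  thereby reduced to containment of fixed small multisets.\<close>

lemma two_hooks_multiset:
  assumes "M \<in> part_multisets residue_parts n"
  shows "real (card {p \<in> set_mset M. 2 \<le> p \<and> p
      - 1 \<notin> set_mset M} + card {p \<in> set_mset M. 2 \<le> count M p})
    = real (card {p \<in> residue_parts. {#p, p#} \<subseteq># M}) + real (card {p \<in> residue_parts - {1}. {#p#} \<subseteq># M})
      - real (card {p \<in> {p. p mod 8 = 6}. {#p, p - 1#} \<subseteq># M})"
proof -
  have sub: "p \<in> residue_parts" if "p \<in># M" for p
    using assms that unfolding part_multisets_def by blast
  have "{p \<in> set_mset M. 2 \<le> count M p} = {p \<in> residue_parts. {#p, p#} \<subseteq># M}"
  proof -
    have "{#p, p#} \<subseteq># M \<longleftrightarrow> 2 \<le> count M p" for p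
      using count_le_replicate_mset_subset_eq[of 2 M p] by (simp add: numeral_2_eq_2)
    then show ?thesis
      using sub by (auto simp: count_greater_zero_iff[symmetric] simp del: count_greater_zero_iff)
  qed
  moreover have "{p \<in> residue_parts - {1}. {#p#} \<subseteq># M}
      = {p \<in> set_mset M. 2 \<le> p \<and> p
          - 1 \<notin> set_mset M} \<union> {p \<in> {p. p mod 8 = 6}. {#p, p - 1#} \<subseteq># M}"
    and "{p \<in> set_mset M. 2 \<le> p \<and> p
        - 1 \<notin> set_mset M} \<inter> {p \<in> {p. p mod 8 = 6}. {#p, p
        - 1#} \<subseteq># M} = {}"
  proof -
    have pair: "{#p, p - 1#} \<subseteq># M \<longleftrightarrow> p \<in># M \<and> p
        - 1 \<in># M" if "2 \<le> p" for p
      using that by (auto simp: insert_subset_eq_iff in_diff_count dest: mset_subset_eqD)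
    have six: "p mod 8 = 6" if "p \<in># M" "p - 1 \<in># M" "2 \<le> p" for p
    proof -
      obtain r where r: "p = Suc r"
        using \<open>2 \<le> p\<close> by (cases p) auto
      have "Suc r mod 8 = 1 \<or> Suc r mod 8 = 5 \<or> Suc r mod 8 = 6" and "r mod 8 = 1 \<or> r mod 8 = 5 \<or> r mod 8 = 6"
        using sub[OF that(1)] sub[OF that(2)] unfolding r residue_parts_def by simp_all
      then show ?thesis
        unfolding r by presburger
    qed
    have ge: "2 \<le> p" if "p mod 8 = 6" for p :: nat
      using that by presburger
    have ge': "2 \<le> p" if "p \<in># M" "p \<noteq> 1" for p
      using sub[OF that(1)] that(2) zero_notin_residue_parts by (cases "p = 0") auto
    show "{p \<in> residue_parts - {1}. {#p#} \<subseteq># M}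
      = {p \<in> set_mset M. 2 \<le> p \<and> p
          - 1 \<notin> set_mset M} \<union> {p \<in> {p. p mod 8 = 6}. {#p, p - 1#} \<subseteq># M}"
      using sub pair six ge ge' by auto
    show "{p \<in> set_mset M. 2 \<le> p \<and> p
        - 1 \<notin> set_mset M} \<inter> {p \<in> {p. p mod 8 = 6}. {#p, p
        - 1#} \<subseteq># M} = {}"
      using pair ge by auto
  qed
  moreover have "finite {p \<in> residue_parts - {1}. {#p#} \<subseteq># M}"
    by (rule finite_subset[of _ "set_mset M"]) auto
  ultimately show ?thesis
    by (simp add: card_Un_disjoint)
qed

text \<open>Pairs \<open>p, p\<close> have sums 2, 10 or 12 modulo 16; the parts other than 1 give
  the residue series without \<open>q\<close>; and pairs \<open>p, p - 1\<close> with
  \<open>p\<close> congruent to 6 modulo 8 have sum 11 modulo 16.\<close>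

lemma g2_2_gf:
  "real (g2 2 n) = ((geo 16 * (q ^ 2 + q ^ 10 + q ^ 12) + geo 8 * (q + q ^ 5 + q ^ 6) - q
      - geo 16 * q ^ 11)
    * gap_min_gf 0) $ n"
proof -
  let ?S = "\<lambda>C A. \<Sum>M\<in>part_multisets residue_parts n. real (card {p \<in> C. A p \<subseteq># M})"
  have "num_hooks 2 lam = card {p \<in> set_mset (mset lam). 2 \<le> p \<and> p
      - 1 \<notin> set_mset (mset lam)}
      + card {p \<in> set_mset (mset lam). 2 \<le> count (mset lam) p}" if "lam \<in> congruence_partitions n" for lam
    using num_hooks_2[of lam n] that by (simp add: congruence_partitions_def)
  then have "g2 2 n = (\<Sum>lam\<in>congruence_partitions n.
      card {p \<in> set_mset (mset lam). 2 \<le> p \<and> p - 1 \<notin> set_mset (mset lam)}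
      + card {p \<in> set_mset (mset lam). 2 \<le> count (mset lam) p})"
    unfolding g2_def by (rule sum.cong[OF refl])
  also have "\<dots> = (\<Sum>M\<in>part_multisets residue_parts n. card {p \<in> set_mset M. 2 \<le> p \<and> p
      - 1 \<notin> set_mset M}
      + card {p \<in> set_mset M. 2 \<le> count M p})"
    by (rule sum_congruence_partitions)
  finally have "real (g2 2 n) = (\<Sum>M\<in>part_multisets residue_parts n.
      real (card {p \<in> set_mset M. 2 \<le> p \<and> p
          - 1 \<notin> set_mset M} + card {p \<in> set_mset M. 2 \<le> count M p}))"
    by simp
  also have "\<dots> = ?S residue_parts (\<lambda>p. {#p, p#}) + ?S (residue_parts
      - {1}) (\<lambda>p. {#p#})
      - ?S {p. p mod 8 = 6} (\<lambda>p. {#p, p - 1#})"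
    unfolding sum.distrib[symmetric] sum_subtractf[symmetric]
    using two_hooks_multiset by (rule sum.cong[OF refl])
  also have "?S residue_parts (\<lambda>p. {#p, p#}) = (geo 16 * (q ^ 2 + q ^ 10
      + q ^ 12) * gap_min_gf 0) $ n"
  proof -
    have "k \<in> (\<lambda>p. \<Sum>\<^sub># {#p, p#}) ` residue_parts \<longleftrightarrow> k mod 16 \<in> {2, 10, 12}" for k
    proof
      assume "k \<in> (\<lambda>p. \<Sum>\<^sub># {#p, p#}) ` residue_parts"
      then obtain p where p: "k = p + p" "p mod 8 = 1 \<or> p mod 8 = 5 \<or> p mod 8 = 6"
        unfolding residue_parts_def by auto
      have "k = 16 * (p div 8) + 2 * (p mod 8)"
        using mult_div_mod_eq[of 8 p] p(1) by linarith
      then have "k mod 16 = 2 \<or> k mod 16 = 10 \<or> k mod 16 = 12"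
        using p(2) by auto
      then show "k mod 16 \<in> {2, 10, 12}"
        by simp
    next
      assume "k mod 16 \<in> {2, 10, 12}"
      then have "\<exists>r\<in>{1, 5, 6}. k mod 16 = r + r"
        by (simp add: numeral_2_eq_2)
      then obtain r where r: "r \<in> {1, 5, 6}" "k mod 16 = r + r"
        by blast
      define p where "p = 8 * (k div 16) + r"
      have "k = p + p"
        using mult_div_mod_eq[of 16 k] r(2) by (simp add: p_def)
      moreover have "p mod 8 = r"
        using r(1) by (auto simp: p_def)
      ultimately show "k \<in> (\<lambda>p. \<Sum>\<^sub># {#p, p#}) ` residue_parts"
        using r(1) unfolding residue_parts_def by (intro image_eqI[of _ _ p]) auto
    qed
    then show ?thesis
      using sum_card_containing[of residue_parts "\<lambda>p. {#p, p#}" n] periodic_gf[of "{2, 10, 12}" 16]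
      by (simp add: little_goellnitz inj_on_def add.assoc)
  qed
  also have "?S (residue_parts - {1}) (\<lambda>p. {#p#}) = ((geo 8 * (q + q ^ 5 + q ^ 6)
      - q) * gap_min_gf 0) $ n"
  proof -
    have "Abs_fps (\<lambda>k. if k \<in> residue_parts - {1} then 1 else 0)
        = Abs_fps (\<lambda>k. if k \<in> residue_parts then 1 else 0) - q"
      by (auto simp: fps_eq_iff residue_parts_def)
    then show ?thesis
      using sum_card_containing[of "residue_parts - {1}" "\<lambda>p. {#p#}" n]
      by (simp add: residue_parts_indicator little_goellnitz)
  qed
  also have "?S {p. p mod 8 = 6} (\<lambda>p. {#p, p - 1#}) = (geo 16 * q ^ 11 * gap_min_gf 0) $ n"
  proof -
    have "k \<in> (\<lambda>p. \<Sum>\<^sub># {#p, p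
        - 1#}) ` {p. p mod 8 = 6} \<longleftrightarrow> k mod 16 \<in> {11}" for k :: nat
    proof
      assume "k \<in> (\<lambda>p. \<Sum>\<^sub># {#p, p - 1#}) ` {p. p mod 8 = 6}"
      then obtain p where "k = p + (p - 1)" "p mod 8 = 6"
        by auto
      then have "k = 16 * (p div 8) + 11"
        using mult_div_mod_eq[of 8 p] by simp
      then have "k mod 16 = 11"
        by simp
      then show "k mod 16 \<in> {11}"
        by simp
    next
      assume "k mod 16 \<in> {11}"
      then have "k mod 16 = 11"
        by simp
      then have "k = 16 * (k div 16) + 11"
        using mult_div_mod_eq[of 16 k] by simp
      then show "k \<in> (\<lambda>p. \<Sum>\<^sub># {#p, p - 1#}) ` {p. p mod 8 = 6}"
        by (intro image_eqI[of _ _ "8 * (k div 16) + 6"]) auto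
    qed
    moreover have "set_mset {#p, p
        - 1#} \<subseteq> residue_parts" if "p \<in> {p. p mod 8 = 6}" for p :: nat
    proof -
      have "p mod 8 = 6" using that by simp
      then have "p - 1 = 8 * (p div 8) + 5"
        using mult_div_mod_eq[of 8 p] by simp
      then have "(p - 1) mod 8 = (8 * (p div 8) + 5) mod 8"
        by (rule arg_cong)
      then have "(p - 1) mod 8 = 5"
        by simp
      then show ?thesis using \<open>p mod 8 = 6\<close> by (auto simp: residue_parts_def)
    qed
    moreover have "inj_on (\<lambda>p. \<Sum>\<^sub># {#p, p - 1#}) {p :: nat. p mod 8 = 6}"
    proof (rule inj_onI)
      fix x y :: nat
      assume "x \<in> {p. p mod 8 = 6}" and "y \<in> {p. p mod 8 = 6}" and eq: "\<Sum>\<^sub># {#x, x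
          - 1#} = \<Sum>\<^sub># {#y, y - 1#}"
      then have "x \<noteq> 0" and "y \<noteq> 0"
        by auto
      then show "x = y"
        using eq by simp
    qed
    ultimately show ?thesis
      using sum_card_containing[of "{p. p mod 8 = 6}" "\<lambda>p. {#p, p
          - 1#}" n] periodic_gf[of "{11}" 16]
      by (simp add: little_goellnitz)
  qed
  finally show ?thesis
    by (simp add: algebra_simps)
qed

theorem theorem1p5:
  shows "\<exists>N::nat. \<forall>n\<ge>N. g1 1 n > g2 1 n \<and> g1 2 n < g2 2 n"
proof -
  obtain N1 where N1: "\<forall>n\<ge>N1. 0 < (fsum (\<lambda>N. of_nat N * gap_gf N) - geo 8 * (q
      + q ^ 5 + q ^ 6) * gap_min_gf 0) $ n"
    using one_hooks_positive by blast
  obtain N2 where N2: "\<forall>n\<ge>N2. 0 < ((geo 16 * (q ^ 2 + q ^ 10 + q ^ 12) + geo 8 * (q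
      + q ^ 5 + q ^ 6) - q - geo 16 * q ^ 11)
      * gap_min_gf 0 - (fsum (\<lambda>N. of_nat N * gap_gf N) - (gap_min_gf 0
          - fsum gap_lists_no_1_gf))) $ n"
    using two_hooks_positive[OF fsum_gap_lists_no_1_gf] by blast
  have "g2 1 n < g1 1 n" if "n \<ge> N1" for n
  proof -
    have "real (g2 1 n) < real (g1 1 n)"
      using N1 that unfolding g2_1_gf g1_1_gf fps_sub_nth by fastforce
    then show ?thesis by simp
  qed
  moreover have "g1 2 n < g2 2 n" if "n \<ge> N2" for n
  proof -
    have "real (g1 2 n) < real (g2 2 n)"
      using N2 that unfolding g2_2_gf g1_2_gf fps_sub_nth[of "_ * gap_min_gf 0"] by fastforce
    then show ?thesis by simp
  qed
  ultimately show ?thesis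
    by (intro exI[of _ "max N1 N2"]) simp
qed

end
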